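(* Let $\varphi$ be the Laplace transform of a probability distribution on $[0,\infty)$ and let $f$ be a $\varphi$-ID characteristic function. If $f$ is $\varphi$-strictly stable and $\varphi$ is in class $L$, then $f$ is in class $L$. Consequently, (the law with characteristic function) $f$ is unimodal and absolutely continuous.
   Context: $\varphi(s)=E(e^{-sU})$ for a non-negative random variable $U$, used for all complex $s$ with $\operatorname{Re}s\ge 0$. A characteristic function $f$ is called $\varphi$-ID if there are positive constants $a_n$ and characteristic functions $f_n$ ($n\ge1$) such that $f(t)=\lim_{n\to\infty}\varphi\{a_n(1-f_n(t))\}$ for all $t\in\mathbf{R}$; here $\varphi\{a_n(1-f_n(t))\}$ is the characteristic function of a sum of $N$ i.i.d. random variables with characteristic function $f_n$, where $N$ is independent of the summands and has probability generating function $\varphi\{a_n(1-s)\}$. $f$ is $\varphi$-strictly stable if $f(t)=\varphi(\psi(t))$ where $e^{-\psi(t)}$ is a strictly stable characteristic function, i.e. $\psi(t)=\lambda|t|^{\alpha}e^{-i\theta\,\mathrm{sgn}(t)}$ with $\lambda>0$, $0<\alpha\le2$, $|\theta|\le\min(\pi\alpha/2,\ \pi-\pi\alpha/2)$. A characteristic function $f$ is in class $L$ if for every $0<c<1$ there is a characteristic function $f_c$ with $f(t)=f(ct)f_c(t)$ for all $t$. A Laplace transform $\varphi$ (of a probability distribution on $[0,\infty)$) is in class $L$ if for every $0<c<1$ there is a Laplace transform $\varphi_c$ of a probability distribution on $[0,\infty)$ with $\varphi(s)=\varphi(cs)\varphi_c(s)$ for all $s>0$.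
   Formalization: Absolute continuity is claimed only when f is not the characteristic function of a point mass; point masses (e.g. φ ≡ 1, f ≡ 1) meet every hypothesis but are not absolutely continuous. Class L and unimodality are claimed without exception. *)

theory Defs
  imports "HOL-Probability.Probability"
begin

definition laplace_transform :: "real measure \<Rightarrow> complex \<Rightarrow> complex" where
  "laplace_transform M s = (CLINT u|M. exp (- (s * complex_of_real u)))"

text \<open>Functions are total on the complex plane; only their values on the closed right
  half-plane are constrained, and only those are used below.\<close>

definition is_laplace_transform :: "(complex \<Rightarrow> complex) \<Rightarrow> bool" where
  "is_laplace_transform \<phi> \<longleftrightarrow>
     (\<exists>M. real_distribution M \<and> (AE u in M. 0 \<le> u) \<and>
          (\<forall>s. 0 \<le> Re s \<longrightarrow> \<phi> s = laplace_transform M s))"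

definition is_char :: "(real \<Rightarrow> complex) \<Rightarrow> bool" where
  "is_char f \<longleftrightarrow> (\<exists>M. real_distribution M \<and> f = char M)"

definition phi_ID :: "(complex \<Rightarrow> complex) \<Rightarrow> (real \<Rightarrow> complex) \<Rightarrow> bool" where
  "phi_ID \<phi> f \<longleftrightarrow> is_char f \<and>
     (\<exists>(a :: nat \<Rightarrow> real) (g :: nat \<Rightarrow> real \<Rightarrow> complex).
        (\<forall>n. 0 < a n) \<and> (\<forall>n. is_char (g n)) \<and>
        (\<forall>t. (\<lambda>n. \<phi> (complex_of_real (a n) * (1 - g n t))) \<longlonglongrightarrow> f t))"

definition strictly_stable_exponent :: "(real \<Rightarrow> complex) \<Rightarrow> bool" where
  "strictly_stable_exponent \<psi> \<longleftrightarrow>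
     (\<exists>(l :: real) (\<alpha> :: real) (\<theta> :: real).
        0 < l \<and> 0 < \<alpha> \<and> \<alpha> \<le> 2 \<and> \<bar>\<theta>\<bar> \<le> min (pi * \<alpha> / 2) (pi - pi * \<alpha> / 2) \<and>
        (\<forall>t. \<psi> t = complex_of_real (l * \<bar>t\<bar> powr \<alpha>) * exp (- (\<i> * complex_of_real (\<theta> * sgn t)))))"

definition phi_strictly_stable :: "(complex \<Rightarrow> complex) \<Rightarrow> (real \<Rightarrow> complex) \<Rightarrow> bool" where
  "phi_strictly_stable \<phi> f \<longleftrightarrow>
     (\<exists>\<psi>. strictly_stable_exponent \<psi> \<and> (\<forall>t. f t = \<phi> (\<psi> t)))"

definition class_L_char :: "(real \<Rightarrow> complex) \<Rightarrow> bool" where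
  "class_L_char f \<longleftrightarrow> is_char f \<and>
     (\<forall>c. 0 < c \<and> c < 1 \<longrightarrow> (\<exists>fc. is_char fc \<and> (\<forall>t. f t = f (c * t) * fc t)))"

definition class_L_laplace :: "(complex \<Rightarrow> complex) \<Rightarrow> bool" where
  "class_L_laplace \<phi> \<longleftrightarrow> is_laplace_transform \<phi> \<and>
     (\<forall>c::real. 0 < c \<and> c < 1 \<longrightarrow>
        (\<exists>\<phi>c. is_laplace_transform \<phi>c \<and>
           (\<forall>s::real. 0 < s \<longrightarrow>
              \<phi> (complex_of_real s) = \<phi> (complex_of_real (c * s)) * \<phi>c (complex_of_real s))))"

text \<open>Khinchin's notion: the distribution function may jump at the mode \<open>m\<close>,
  so point masses are unimodal.\<close>

definition unimodal :: "real measure \<Rightarrow> bool" where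
  "unimodal M \<longleftrightarrow> (\<exists>m. convex_on {..<m} (cdf M) \<and> concave_on {m<..} (cdf M))"

text \<open>Point masses meet every hypothesis of the theorem in two ways (\<open>U = 0\<close>; or \<open>U\<close> constant with
  \<open>\<alpha> = 1\<close>, \<open>\<bar>\<theta>\<bar> = pi / 2\<close>). They are in class L and unimodal, but not absolutely continuous.\<close>

definition degenerate :: "real measure \<Rightarrow> bool" where
  "degenerate M \<longleftrightarrow> (\<exists>b. AE x in M. x = b)"

end

theory Submission
  imports Defs "HOL-Complex_Analysis.Complex_Analysis"
begin

text \<open>
  Let \<open>\<phi>\<close> be the Laplace transform of \<open>U\<close>, so that \<open>f\<close> is the characteristic function of
  \<open>U powr (1 / \<alpha>) * S\<close> with \<open>S\<close> strictly stable and independent of \<open>U\<close>. Since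
  \<open>\<psi> (c * t) = c powr \<alpha> * \<psi> t\<close>, a factorization of \<open>\<phi>\<close> at \<open>c powr \<alpha>\<close> gives one of \<open>f\<close> at \<open>c\<close>.

  For unimodality, differentiate \<open>- ln \<phi>\<close> along the ray \<open>r powr \<alpha> * \<psi> t\<close>, \<open>0 < r < 1\<close>: as \<open>c\<close> tends to
  \<open>1\<close>, the integral of \<open>\<alpha> / (1 - c) * (1 - \<phi>\<^sub>c (r powr \<alpha> * \<psi> t)) / r\<close> tends to \<open>- ln (f t)\<close>. Here
  \<open>\<phi>\<^sub>c (\<psi> t)\<close> is a characteristic function, hence the integral is the exponent of a law with Levy
  density \<open>k x / \<bar>x\<bar>\<close>, where \<open>k\<close> decreases away from \<open>0\<close>. Such a law is a limit of lattice laws that are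
  differences of two independent variables with generating functions
  \<open>exp (\<Sum>j. k j / j * (z ^ j - 1))\<close>, \<open>k\<close> decreasing. The coefficients \<open>a n\<close> of the latter satisfy
  \<open>n * a n = (\<Sum>u<n. k (n - u) * a u)\<close>, which makes them unimodal and log-concave up to the mode; as
  Yamazato observed, this suffices for the difference to be unimodal. Unimodality survives weak limits.

  A unimodal law is absolutely continuous apart from an atom at the mode, and a nondegenerate
  self-decomposable law has no such atom.
\<close>

section \<open>Characteristic functions and weak limits\<close>

text \<open>The hypothesis on \<open>\<phi>\<close> is an identity between Laplace transforms on the
  positive reals, whereas \<open>f\<close> evaluates them at \<open>\<psi> t\<close>, in a sector of
  the closed right half-plane. Holomorphic continuation carries the identity to the open half-plane
  and continuity to the imaginary axis. Estimates carry over because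
  \<open>|1 - \<phi>\<^sub>c s|\<close> is at most \<open>|s| / Re s\<close> times the value of
  \<open>1 - \<phi>\<^sub>c\<close> at \<open>Re s\<close>, and \<open>|s| / Re s\<close> is
  constant along the ray \<open>r powr \<alpha> * \<psi> t\<close>; so a single real majorant, built
  from the derivative of \<open>- ln \<phi>\<close>, serves on the whole ray. This fails when
  \<open>\<psi> t\<close> is imaginary, that is for \<open>\<alpha> = 1\<close> and
  \<open>|\<theta>| = pi / 2\<close>. Moreover, at \<open>\<alpha> = 1\<close> and
  \<open>\<alpha> = 2\<close> the two extremal stable exponents, from which all others are combined,
  become linearly dependent. Both values of \<open>\<alpha>\<close> are therefore reached as limits
  of admissible parameters. Since unimodality is not preserved by convolution, it cannot be
  collected from independent factors: each approximating law has to be shown unimodal as a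
  whole.\<close>

lemma char_swap:
  assumes "real_distribution M" "real_distribution N"
  shows "(CLINT y|N. char M (s * y)) = (CLINT x|M. char N (s * x))"
proof -
  interpret M: real_distribution M by fact
  interpret N: real_distribution N by fact
  interpret P: pair_prob_space M N ..
  have "integrable (M \<Otimes>\<^sub>M N) (\<lambda>(x, y). iexp (s * x * y))"
    by (rule P.integrable_const_bound[where B=1])
       (auto simp: norm_exp_eq_Re intro!: measurable_compose[OF _ borel_measurable_exp])
  from P.Fubini_integral[OF this] show ?thesis
    unfolding char_def by (simp add: mult_ac)
qed

text \<open>Averaging \<open>1 - char M\<close> over a Gaussian scale gives a tail bound, by Fubini.\<close>

lemma tail_le_char:
  assumes "real_distribution M"
  shows "(1 - exp (-1/2::real)) * measure M {x. 1 \<le> \<bar>s * x\<bar>}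
    \<le> Re (CLINT y|std_normal_distribution. 1 - char M (s * y))"
proof -
  let ?N = "std_normal_distribution"
  interpret M: real_distribution M by fact
  interpret N: real_distribution ?N by (rule real_dist_normal_dist)
  have intN: "integrable ?N (\<lambda>y. char M (s * y))"
    by (rule N.integrable_const_bound[where B=1]) (auto simp: M.cmod_char_le_1)
  have e: "(\<lambda>x. char ?N (s * x)) = (\<lambda>x. of_real (exp (- ((s*x)\<^sup>2) / 2)))"
    by (simp add: char_std_normal_distribution)
  have intM: "integrable M (\<lambda>x. exp (- ((s*x)\<^sup>2) / 2))"
    by (rule M.integrable_const_bound[where B=1]) auto
  have "Re (CLINT y|?N. 1 - char M (s * y)) = 1 - Re (CLINT y|?N. char M (s * y))"
    using intN N.prob_space by (subst Bochner_Integration.integral_diff) (auto simp del: N.space_eq_univ)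
  \<comment> \<open>The Gaussian serves as the averaging law because its characteristic function is
    again an explicit positive function, decreasing in \<open>|x|\<close>.\<close>
  also have "\<dots> = 1 - (LINT x|M. exp (- ((s*x)\<^sup>2) / 2))"
    by (subst char_swap[OF assms real_dist_normal_dist]) (simp only: e integral_complex_of_real Re_complex_of_real)
  also have "\<dots> = (LINT x|M. 1 - exp (- ((s*x)\<^sup>2) / 2))"
    using intM M.prob_space by (subst Bochner_Integration.integral_diff) (auto simp del: M.space_eq_univ)
  \<comment> \<open>Once \<open>|s * x| \<ge> 1\<close>, the Gaussian factor is at most
    \<open>exp (-1/2)\<close>: this is the origin of the constant.\<close>
  also have "\<dots> \<ge> (LINT x|M. (1 - exp (-1/2::real)) * indicator {x. 1 \<le> \<bar>s * x\<bar>} x)"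
  proof (rule integral_mono)
    show "integrable M (\<lambda>x. (1 - exp (-1/2::real)) * indicator {x. 1 \<le> \<bar>s * x\<bar>} x)"
      by (rule M.integrable_const_bound[where B=1]) (auto simp: abs_le_iff split: split_indicator)
    show "integrable M (\<lambda>x. 1 - exp (- ((s*x)\<^sup>2) / 2))" using intM by auto
    show "(1 - exp (-1/2::real)) * indicator {x. 1 \<le> \<bar>s * x\<bar>} x \<le> 1 - exp (- ((s*x)\<^sup>2) / 2)" for x
    proof (cases "1 \<le> \<bar>s * x\<bar>")
      case True
      then have "1 \<le> (s*x)\<^sup>2" by (metis one_le_power power2_abs)
      then show ?thesis using True by simp
    qed (auto)
  qed
  finally show ?thesis by (simp)
qed

text \<open>Dominated convergence is applied twice to the Gaussian average of
  \<open>1 - char\<close>. As the scale tends to \<open>0\<close>, continuity at \<open>0\<close>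
  makes the average for \<open>f\<close> small; at such a fixed scale, the smallness passes to all
  but finitely many \<open>M n\<close>. The remaining laws are tight one by one.\<close>

lemma tight_of_char_convergence:
  assumes M: "\<And>n. real_distribution (M n)"
    and conv: "\<And>t. (\<lambda>n. char (M n) t) \<longlonglongrightarrow> f t"
    and cont: "isCont f 0"
  shows "tight M"
proof -
  let ?N = "std_normal_distribution"
  interpret N: real_distribution ?N by (rule real_dist_normal_dist)
  have f0: "f 0 = 1"
    using LIMSEQ_unique[OF conv[of 0]] real_distribution.char_zero[OF M] by simp
  have fb: "cmod (f t) \<le> 1" for t
    by (rule tendsto_upperbound[OF tendsto_norm[OF conv[of t]]])
       (auto simp: real_distribution.cmod_char_le_1[OF M])
  have meas[measurable]: "f \<in> borel_measurable borel"
    by (rule borel_measurable_LIMSEQ_metric[OF _ conv]) (auto simp: real_distribution.char_measurable[OF M])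
  have b2: "norm (1 - z) \<le> 2" if "cmod z \<le> 1" for z
    using norm_triangle_ineq4[of 1 z] that by simp
  have lim0: "(\<lambda>k. CLINT y|?N. 1 - f (1 / Suc k * y)) \<longlonglongrightarrow> 0"
  proof (rule integral_dominated_convergence[where w="\<lambda>_. 2" and f="\<lambda>_. 0", simplified integral_zero])
    show "AE x in ?N. (\<lambda>i. 1 - f (1 / real (Suc i) * x)) \<longlonglongrightarrow> 0"
    proof (rule AE_I2)
      fix x
      have "(\<lambda>i. 1 / real (Suc i) * x) \<longlonglongrightarrow> 0 * x"
        by (intro tendsto_mult tendsto_const) (use LIMSEQ_inverse_real_of_nat in \<open>simp add: inverse_eq_divide\<close>)
      then have "(\<lambda>i. f (1 / real (Suc i) * x)) \<longlonglongrightarrow> f 0"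
        using isCont_tendsto_compose[OF cont] by simp
      then show "(\<lambda>i. 1 - f (1 / real (Suc i) * x)) \<longlonglongrightarrow> 0"
        using tendsto_diff[OF tendsto_const, of _ _ _ 1] f0 by fastforce
    qed
  qed (auto intro!: b2 fb)
  have limn: "(\<lambda>n. CLINT y|?N. 1 - char (M n) (s * y)) \<longlonglongrightarrow> (CLINT y|?N. 1 - f (s * y))" for s
  proof (rule integral_dominated_convergence[where w="\<lambda>_. 2"])
    show "(\<lambda>y. 1 - char (M i) (s * y)) \<in> borel_measurable ?N" for i
      using real_distribution.char_measurable[OF M, of i] by simp
  qed (auto intro!: b2 fb tendsto_intros conv real_distribution.cmod_char_le_1[OF M])
  have "\<exists>a b. a < b \<and> (\<forall>n. 1 - \<epsilon> < measure (M n) {a<..b})" if "\<epsilon> > 0" for \<epsilon> :: real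
  proof -
    define c where "c = 1 - exp (-1/2::real)"
    have c: "c > 0" by (simp add: c_def)
    have c\<epsilon>: "c * \<epsilon> / 2 > 0" using c that by simp
    obtain k where k: "norm (CLINT y|?N. 1 - f (1 / Suc k * y)) < c * \<epsilon> / 2"
      using LIMSEQ_D[OF lim0 c\<epsilon>] unfolding diff_zero by blast
    define s where "s = 1 / real (Suc k)"
    have s: "s > 0" by (simp add: s_def)
    obtain n0 where n0: "\<And>n. n \<ge> n0 \<Longrightarrow> norm ((CLINT y|?N. 1 - char (M n) (s * y)) - (CLINT y|?N. 1 - f (s * y))) < c * \<epsilon> / 2"
      using LIMSEQ_D[OF limn[of s] c\<epsilon>] by blast
    have big: "measure (M n) {- (1/s)<..1/s} > 1 - \<epsilon>" if "n \<ge> n0" for n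
    proof -
      interpret Mn: real_distribution "M n" by (rule M)
      have "Re (CLINT y|?N. 1 - char (M n) (s * y)) \<le> norm (CLINT y|?N. 1 - char (M n) (s * y))"
        by (rule complex_Re_le_cmod)
      also have "\<dots> < c * \<epsilon>"
        using n0[OF that] k norm_triangle_sub[of "CLINT y|?N. 1 - char (M n) (s * y)" "CLINT y|?N. 1 - f (s * y)"]
        unfolding s_def[symmetric] by linarith
      finally have "c * measure (M n) {x. 1 \<le> \<bar>s * x\<bar>} < c * \<epsilon>"
        using tail_le_char[OF M, of n s] unfolding c_def by linarith
      then have "measure (M n) {x. 1 \<le> \<bar>s * x\<bar>} < \<epsilon>" using c by simp
      moreover have "1 - measure (M n) {x. 1 \<le> \<bar>s * x\<bar>} = measure (M n) (space (M n) - {x. 1 \<le> \<bar>s * x\<bar>})"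
        by (rule Mn.prob_compl[symmetric]) auto
      moreover have "measure (M n) (space (M n) - {x. 1 \<le> \<bar>s * x\<bar>}) \<le> measure (M n) {- (1/s)<..1/s}"
        by (rule Mn.finite_measure_mono) (use s in \<open>auto simp: field_simps abs_mult abs_if split: if_splits\<close>)
      ultimately show ?thesis by linarith
    qed
    have "\<exists>K. \<forall>k\<ge>K. measure (M n) {- real k<..real k} > 1 - \<epsilon>" for n
    proof -
      interpret Mn: real_distribution "M n" by (rule M)
      have *: "(UN (k :: nat). {- real k<..real k}) = UNIV"
        by (auto, metis leI le_less_trans less_imp_le minus_less_iff reals_Archimedean2)
      have "(\<lambda>k. measure (M n) {- real k<..real k}) \<longlonglongrightarrow>
          measure (M n) (UN (k :: nat). {- real k<..real k})"
        by (rule Mn.finite_Lim_measure_incseq, auto simp add: incseq_def)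
      hence "(\<lambda>k. measure (M n) {- real k<..real k}) \<longlonglongrightarrow> 1"
        using Mn.prob_space unfolding * Mn.borel_UNIV by simp
      then have "eventually (\<lambda>k. measure (M n) {- real k<..real k} > 1 - \<epsilon>) sequentially"
        using \<open>\<epsilon> > 0\<close> order_tendstoD by fastforce
      then show ?thesis by (auto simp: eventually_sequentially)
    qed
    then obtain K where K: "\<And>n k. k \<ge> K n \<Longrightarrow> measure (M n) {- real k<..real k} > 1 - \<epsilon>" by metis
    \<comment> \<open>\<open>K n\<close> serves the index \<open>n\<close> alone. The maximum over
      \<open>n \<le> n0\<close>, joined with the radius \<open>1/s\<close> of the uniform tail
      bound, serves all indices.\<close>
    define b where "b = max (1/s) (real (Max (K ` {..n0})))"
    have b0: "b > 0" using s by (auto simp: b_def less_max_iff_disj)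
    have "1 - \<epsilon> < measure (M n) {-b<..b}" for n
    proof (cases "n \<ge> n0")
      case True
      show ?thesis
        by (rule less_le_trans[OF big[OF True]])
           (auto intro!: finite_measure.finite_measure_mono real_distribution.finite_borel_measure_M
             simp: b_def M real_distribution.events_eq_borel finite_borel_measure.axioms(1)
               real_distribution.axioms(1) prob_space.finite_measure)
    next
      case False
      have "real (Max (K ` {..n0})) \<le> b" by (simp add: b_def)
      show ?thesis
        by (rule less_le_trans[OF K[of n "Max (K ` {..n0})"]])
           (use False in \<open>auto intro!: Max_ge finite_measure.finite_measure_mono
             simp: b_def M real_distribution.events_eq_borel
               real_distribution.axioms(1) prob_space.finite_measure\<close>)
    qed
    then show ?thesis using b0 by (intro exI[of _ "-b"] exI[of _ b]) auto
  qed
  then show ?thesis using M by (auto simp: tight_def)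
qed

text \<open>The limit law is extracted rather than given: tightness yields a weakly convergent
  subsequence, whose limit must have characteristic function \<open>f\<close>. With the limit
  identified, the whole sequence converges to it.\<close>

theorem levy_continuity_existence:
  assumes M: "\<And>n. real_distribution (M n)"
    and conv: "\<And>t. (\<lambda>n. char (M n) t) \<longlonglongrightarrow> f t"
    and cont: "isCont f 0"
  obtains M' where "real_distribution M'" "char M' = f" "weak_conv_m M M'"
proof -
  from tight_imp_convergent_subsubsequence[OF tight_of_char_convergence[OF assms] strict_mono_id]
  obtain r M' where r: "strict_mono r" "real_distribution M'" "weak_conv_m (M \<circ> id \<circ> r) M'" by blast
  have "(\<lambda>n. char ((M \<circ> id \<circ> r) n) t) \<longlonglongrightarrow> char M' t" for t
    by (rule levy_continuity1[OF _ r(2,3)]) (simp add: M)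
  moreover have "(\<lambda>n. char ((M \<circ> id \<circ> r) n) t) \<longlonglongrightarrow> f t" for t
    using LIMSEQ_subseq_LIMSEQ[OF conv r(1), of t] by (simp add: o_def)
  ultimately have eq: "char M' = f" using LIMSEQ_unique by blast
  have "weak_conv_m M M'"
    by (rule levy_continuity[OF M r(2)]) (use conv eq in auto)
  with that r(2) eq show ?thesis by blast
qed

section \<open>Unimodality under weak limits\<close>

text \<open>The slope inequality is kept in cross-multiplied form so that it passes to limits of the
  function and of the points, with no denominators to control.\<close>

lemma convex_on_slopes:
  fixes F :: "real \<Rightarrow> real"
  assumes "convex I"
    and "\<And>x y z. x \<in> I \<Longrightarrow> z \<in> I \<Longrightarrow> x < y \<Longrightarrow> y < z \<Longrightarrow> (F y - F x) * (z - y) \<le> (F z - F y) * (y - x)"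
  shows "convex_on I F"
proof (rule convex_on_linorderI)
  fix t x z :: real assume t: "0 < t" "t < 1" and xz: "x \<in> I" "z \<in> I" "x < z"
  define y where "y = (1 - t) * x + t * z"
  have yx: "y - x = t * (z - x)" and zy: "z - y = (1 - t) * (z - x)" unfolding y_def by (simp_all add: algebra_simps)
  have "t * (z - x) > 0" "(1-t) * (z-x) > 0" using t xz by auto
  then have "x < y" "y < z" unfolding yx[symmetric] zy[symmetric] by simp_all
  then have "(F y - F x) * (z - y) \<le> (F z - F y) * (y - x)" by (intro assms(2) xz)
  then have "((F y - F x) * (1 - t)) * (z-x) \<le> ((F z - F y) * t) * (z-x)" unfolding yx zy by (simp add: mult.assoc)
  then have "(F y - F x) * (1 - t) \<le> (F z - F y) * t" using xz by simp
  then have "F y \<le> (1 - t) * F x + t * F z" by (simp add: algebra_simps)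
  then show "F ((1 - t) *\<^sub>R x + t *\<^sub>R z) \<le> (1 - t) * F x + t * F z" unfolding y_def by simp
qed fact

lemma slopes_of_convex_on:
  fixes F :: "real \<Rightarrow> real"
  assumes "convex_on I F" "x \<in> I" "z \<in> I" "x < y" "y < z"
  shows "(F y - F x) * (z - y) \<le> (F z - F y) * (y - x)"
proof -
  define t where "t = (y - x) / (z - x)"
  have t: "0 \<le> t" "t \<le> 1" using assms by (auto simp: t_def)
  have y: "y = (1 - t) * x + t * z"
  proof -
    have "t * (z - x) = y - x" using assms by (simp add: t_def)
    then show ?thesis by (simp add: algebra_simps)
  qed
  have "F y \<le> (1 - t) * F x + t * F z"
    using convex_onD[OF assms(1) t assms(2,3)] by (simp add: y[symmetric])
  then have "(F y - F x) * (1 - t) \<le> (F z - F y) * t" by (simp add: algebra_simps)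
  then have "(F y - F x) * (1 - t) * (z - x) \<le> (F z - F y) * t * (z - x)"
    using assms by (intro mult_right_mono) auto
  moreover have "(1 - t) * (z - x) = z - y" "t * (z - x) = y - x" using y by (auto simp: algebra_simps)
  ultimately show ?thesis by (simp add: mult.assoc)
qed

text \<open>Weak convergence speaks only about continuity points of the limit. These form a dense
  set, and distribution functions are right-continuous, so each of the three points is approached
  from the right within \<open>C\<close>; openness of \<open>I\<close> keeps the approximants
  inside.\<close>

lemma slopes_extend:
  fixes F :: "real \<Rightarrow> real"
  assumes dense: "\<And>a b::real. a < b \<Longrightarrow> \<exists>x\<in>C. a < x \<and> x < b"
    and rc: "\<And>x. continuous (at_right x) F"
    and I: "open I"
    and ineq: "\<And>x y z. x \<in> C \<Longrightarrow> y \<in> C \<Longrightarrow> z \<in> C \<Longrightarrow> x \<in> I \<Longrightarrow> z \<in> I \<Longrightarrow> x < y \<Longrightarrow> y < z \<Longrightarrow>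
       (F y - F x) * (z - y) \<le> (F z - F y) * (y - x)"
    and xyz: "x \<in> I" "z \<in> I" "x < y" "y < z"
  shows "(F y - F x) * (z - y) \<le> (F z - F y) * (y - x)"
proof -
  have *: "\<exists>s. (\<forall>n. s n \<in> C \<and> w < s n) \<and> s \<longlonglongrightarrow> w" for w
  proof -
    have "\<forall>n. \<exists>x\<in>C. w < x \<and> x < w + 1 / real (Suc n)" by (intro allI dense) auto
    then obtain s where s: "\<And>n. s n \<in> C" "\<And>n. w < s n" "\<And>n. s n < w + 1 / real (Suc n)" by metis
    have "s \<longlonglongrightarrow> w"
      by (rule tendsto_sandwich[of "\<lambda>_. w" _ _ "\<lambda>n. w + 1 / real (Suc n)"])
         (use s LIMSEQ_inverse_real_of_nat_add[of w] in \<open>auto simp: less_imp_le inverse_eq_divide\<close>)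
    then show ?thesis using s by blast
  qed
  obtain sx sy sz where sx: "\<And>n. sx n \<in> C" "\<And>n. x < sx n" "sx \<longlonglongrightarrow> x"
    and sy: "\<And>n. sy n \<in> C" "\<And>n. y < sy n" "sy \<longlonglongrightarrow> y"
    and sz: "\<And>n. sz n \<in> C" "\<And>n. z < sz n" "sz \<longlonglongrightarrow> z" using * by metis
  have F: "(\<lambda>n. F (s n)) \<longlonglongrightarrow> F w" if "\<And>n. w < s n" "s \<longlonglongrightarrow> w" for s w
  proof -
    have "filterlim s (at_right w) sequentially"
      using that by (auto simp: filterlim_at less_imp_neq[THEN not_sym])
    then show ?thesis using rc[of w] unfolding continuous_within by (rule filterlim_compose[rotated])
  qed
  have 1: "eventually (\<lambda>n. sx n < y) sequentially" "eventually (\<lambda>n. sy n < z) sequentially"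
    using sx(3) sy(3) xyz by (auto dest: order_tendstoD)
  have 2: "eventually (\<lambda>n. sx n \<in> I) sequentially" "eventually (\<lambda>n. sz n \<in> I) sequentially"
    using topological_tendstoD[OF sx(3) I] topological_tendstoD[OF sz(3) I] xyz by auto
  have "eventually (\<lambda>n. (F (sy n) - F (sx n)) * (sz n - sy n) \<le> (F (sz n) - F (sy n)) * (sy n - sx n)) sequentially"
    using 1 2
  proof eventually_elim
    case (elim n)
    have "sx n < sy n" "sy n < sz n" using elim sy(2)[of n] sz(2)[of n] by linarith+
    then show ?case using elim by (intro ineq sx(1) sy(1) sz(1)) auto
  qed
  then show ?thesis
    by (rule tendsto_le[OF trivial_limit_sequentially, rotated 2])
       (intro tendsto_intros F sx sy sz)+
qed

text \<open>The functions \<open>r n\<close> allow lattice distributions: there \<open>F n\<close> is a step function, whose slopes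
  are monotone only when measured along the lattice.\<close>

lemma unimodal_limit:
  fixes F r :: "nat \<Rightarrow> real \<Rightarrow> real" and m :: "nat \<Rightarrow> real"
  assumes M: "real_distribution M"
    and conv: "\<And>x. isCont (cdf M) x \<Longrightarrow> (\<lambda>n. F n x) \<longlonglongrightarrow> cdf M x"
    and r: "\<And>x. (\<lambda>n. r n x) \<longlonglongrightarrow> x"
    and left: "\<And>n x y z. x < y \<Longrightarrow> y < z \<Longrightarrow> z < m n \<Longrightarrow>
        (F n y - F n x) * (r n z - r n y) \<le> (F n z - F n y) * (r n y - r n x)"
    and right: "\<And>n x y z. m n < x \<Longrightarrow> x < y \<Longrightarrow> y < z \<Longrightarrow>
        (F n z - F n y) * (r n y - r n x) \<le> (F n y - F n x) * (r n z - r n y)"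
  shows "unimodal M"
proof -
  interpret M: real_distribution M by fact
  let ?F = "cdf M"
  define C where "C = {x. isCont ?F x}"
  have dense: "\<exists>x\<in>C. a < x \<and> x < b" if "a < b" for a b :: real
  proof -
    have "uncountable ({a<..<b} - {x. \<not> isCont ?F x})"
      using that mono_ctble_discont[OF monoI[OF M.cdf_nondecreasing]] by (intro uncountable_minus_countable) (auto simp: uncountable_open_interval)
    then have "{a<..<b} - {x. \<not> isCont ?F x} \<noteq> {}" by (metis countable_empty)
    then show ?thesis by (auto simp: C_def)
  qed
  have c: "(\<lambda>n. F (s n) w) \<longlonglongrightarrow> ?F w" if "strict_mono s" "w \<in> C" for s w
    using LIMSEQ_subseq_LIMSEQ[OF conv that(1), of w] that(2) by (simp add: o_def C_def)
  have r': "(\<lambda>n. r (s n) w) \<longlonglongrightarrow> w" if "strict_mono s" for s w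
    using LIMSEQ_subseq_LIMSEQ[OF r that, of w] by (simp add: o_def)
  \<comment> \<open>The subsequence is a parameter because the inequality is used along two kinds:
    along modes that escape to infinity, for a contradiction, and along modes that converge.\<close>
  have L: "(?F y - ?F x) * (z - y) \<le> (?F z - ?F y) * (y - x)"
    if "strict_mono s" "eventually (\<lambda>n. z < m (s n)) sequentially" "x \<in> C" "y \<in> C" "z \<in> C" "x < y" "y < z" for s x y z
  proof (rule tendsto_le[OF trivial_limit_sequentially])
    show "(\<lambda>n. (F (s n) y - F (s n) x) * (r (s n) z - r (s n) y)) \<longlonglongrightarrow> (?F y - ?F x) * (z - y)"
      by (intro tendsto_intros c r' that(1,3-5))
    show "(\<lambda>n. (F (s n) z - F (s n) y) * (r (s n) y - r (s n) x)) \<longlonglongrightarrow> (?F z - ?F y) * (y - x)"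
      by (intro tendsto_intros c r' that(1,3-5))
    show "eventually (\<lambda>n. (F (s n) y - F (s n) x) * (r (s n) z - r (s n) y) \<le> (F (s n) z - F (s n) y) * (r (s n) y - r (s n) x)) sequentially"
      using that(2) by eventually_elim (use left that in blast)
  qed
  have R: "(?F z - ?F y) * (y - x) \<le> (?F y - ?F x) * (z - y)"
    if "strict_mono s" "eventually (\<lambda>n. m (s n) < x) sequentially" "x \<in> C" "y \<in> C" "z \<in> C" "x < y" "y < z" for s x y z
  proof (rule tendsto_le[OF trivial_limit_sequentially])
    show "(\<lambda>n. (F (s n) y - F (s n) x) * (r (s n) z - r (s n) y)) \<longlonglongrightarrow> (?F y - ?F x) * (z - y)"
      by (intro tendsto_intros c r' that(1,3-5))
    show "(\<lambda>n. (F (s n) z - F (s n) y) * (r (s n) y - r (s n) x)) \<longlonglongrightarrow> (?F z - ?F y) * (y - x)"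
      by (intro tendsto_intros c r' that(1,3-5))
    show "eventually (\<lambda>n. (F (s n) z - F (s n) y) * (r (s n) y - r (s n) x) \<le> (F (s n) y - F (s n) x) * (r (s n) z - r (s n) y)) sequentially"
      using that(2) by eventually_elim (use right that in blast)
  qed
  have "\<exists>x\<in>C. \<exists>y\<in>C. x < y \<and> ?F x < ?F y"
  proof -
    have "eventually (\<lambda>x. ?F x < 1/2) at_bot" using M.cdf_lim_at_bot by (rule order_tendstoD) auto
    then obtain a where a: "\<And>x. x \<le> a \<Longrightarrow> ?F x < 1/2" by (auto simp: eventually_at_bot_linorder)
    have "eventually (\<lambda>x. ?F x > 1/2) at_top" using M.cdf_lim_at_top_prob by (rule order_tendstoD) auto
    then obtain b where b: "\<And>x. x \<ge> b \<Longrightarrow> ?F x > 1/2" by (auto simp: eventually_at_top_linorder)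
    obtain x where x: "x \<in> C" "x < a" using dense[of "a-1" a] by auto
    obtain y where y: "y \<in> C" "y > b" using dense[of b "b+1"] by auto
    have "?F x < ?F y" using a[of x] b[of y] x y by auto
    moreover have "x < y" using calculation M.cdf_nondecreasing[of y x] by linarith
    ultimately show ?thesis using x y by blast
  qed
  then obtain p q where pq: "p \<in> C" "q \<in> C" "p < q" "?F p < ?F q" by blast
  have sub: "\<exists>s. strict_mono s \<and> (\<forall>n. P (s n) (real n))"
    if "\<And>B k. \<exists>n\<ge>k. P n B" for P :: "nat \<Rightarrow> real \<Rightarrow> bool"
  proof -
    have "\<exists>f. \<forall>n. P (f n) (real n) \<and> f n < f (Suc n)"
      by (rule dependent_nat_choice) (use that in \<open>auto simp: Suc_le_eq[symmetric]\<close>)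
    then show ?thesis by (auto simp: strict_mono_Suc_iff)
  qed
  have unb: "\<exists>n\<ge>k. B < h n" if "\<not> bdd_above (range h)" for h :: "nat \<Rightarrow> real" and B k
  proof (rule ccontr)
    assume "\<not> ?thesis"
    then have "h n \<le> max B (Max (h ` {..k}))" for n
      by (cases "n \<ge> k") (auto simp: le_max_iff_disj not_less intro!: Max_ge)
    then show False using that by (auto simp: bdd_above_def)
  qed
  \<comment> \<open>If modes escaped to the right, \<open>?F\<close> would satisfy the convexity
    inequality at all continuity points. Beyond \<open>q\<close> it would grow at least with slope
    \<open>d / (q - p)\<close>, hence gain more than total mass \<open>1\<close> over a distance
    exceeding \<open>(q - p) / d\<close>; this dictates the choice of \<open>z\<close>.\<close>
  have "bdd_above (range m)"
  proof (rule ccontr)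
    assume "\<not> bdd_above (range m)"
    then obtain s where s: "strict_mono s" "\<And>n. real n < m (s n)"
      using sub[of "\<lambda>n B. B < m n", OF unb[OF \<open>\<not> bdd_above (range m)\<close>]] by (elim exE conjE) auto
    define d where "d = ?F q - ?F p"
    have d: "d > 0" using pq by (simp add: d_def)
    obtain z where z: "z \<in> C" "z > q + (q - p) / d + 1" using dense[of "q + (q - p) / d + 1" "q + (q - p) / d + 2"] by auto
    have "(q-p)/d > 0" using pq d by simp
    have ev: "eventually (\<lambda>n. z < m (s n)) sequentially"
    proof -
      have "eventually (\<lambda>n. z < real n) sequentially" using filterlim_real_sequentially
        by (simp add: filterlim_at_top_dense)
      then show ?thesis by eventually_elim (use s in \<open>auto intro: less_trans\<close>)
    qed
    have "d * (z - q) \<le> (?F z - ?F q) * (q - p)"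
      unfolding d_def by (rule L[OF s(1) ev]) (use pq z \<open>(q-p)/d > 0\<close> in auto)
    also have "\<dots> \<le> 1 * (q - p)"
      using pq M.cdf_bounded_prob[of z] M.cdf_nonneg[of q] by (intro mult_right_mono) auto
    finally have "z - q \<le> (q - p) / d" using d by (simp add: field_simps)
    then show False using z by simp
  qed
  moreover have "bdd_below (range m)"
  proof (rule ccontr)
    assume "\<not> bdd_below (range m)"
    then have "\<not> bdd_above (range (\<lambda>n. - m n))"
      unfolding bdd_above_def bdd_below_def by (metis (no_types, lifting) minus_le_iff rangeE rangeI)
    from sub[of "\<lambda>n B. B < - m n", OF unb[OF this]]
    obtain s where s: "strict_mono s" "\<And>n. real n < - m (s n)" by (elim exE conjE) auto
    define d where "d = ?F q - ?F p"
    have d: "d > 0" using pq by (simp add: d_def)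
    obtain z where z: "z \<in> C" "z < p - (q - p) / d - 1" using dense[of "p - (q - p) / d - 2" "p - (q - p) / d - 1"] by auto
    have "(q-p)/d > 0" using pq d by simp
    have ev: "eventually (\<lambda>n. m (s n) < z) sequentially"
    proof -
      have "eventually (\<lambda>n. -z < real n) sequentially" using filterlim_real_sequentially
        by (simp add: filterlim_at_top_dense)
      then show ?thesis by eventually_elim (use s in \<open>smt (verit)\<close>)
    qed
    have "d * (p - z) \<le> (?F p - ?F z) * (q - p)"
      unfolding d_def by (rule R[OF s(1) ev]) (use pq z \<open>(q-p)/d > 0\<close> in auto)
    also have "\<dots> \<le> 1 * (q - p)"
      using pq M.cdf_bounded_prob[of p] M.cdf_nonneg[of z] by (intro mult_right_mono) auto
    finally have "p - z \<le> (q - p) / d" using d by (simp add: field_simps)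
    then show False using z by simp
  qed
  ultimately obtain b1 b2 where "\<And>n. m n \<le> b2" "\<And>n. b1 \<le> m n" by (auto simp: bdd_above_def bdd_below_def)
  then have "range m \<subseteq> {b1..b2}" by auto
  then have "bounded (range m)" by (rule bounded_subset[OF bounded_closed_interval])
  \<comment> \<open>Any limit point of the modes is a mode of the limit: points below
    \<open>\<mu>\<close> eventually lie below \<open>m (s n)\<close>, points above it eventually
    above.\<close>
  then obtain \<mu> s where s: "strict_mono s" "(m \<circ> s) \<longlonglongrightarrow> \<mu>"
    using bounded_imp_convergent_subsequence by blast
  have mcont: "continuous (at_right x) ?F" for x by (rule M.cdf_is_right_cont)
  have "convex_on {..<\<mu>} ?F"
  proof (rule convex_on_slopes)
    fix x y z assume xyz: "x \<in> {..<\<mu>}" "z \<in> {..<\<mu>}" "x < y" "y < z"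
    show "(?F y - ?F x) * (z - y) \<le> (?F z - ?F y) * (y - x)"
    proof (rule slopes_extend[OF dense mcont, of "{..<\<mu>}"])
      fix x y z assume *: "x \<in> C" "y \<in> C" "z \<in> C" "x \<in> {..<\<mu>}" "z \<in> {..<\<mu>}" "x < y" "y < z"
      have "eventually (\<lambda>n. z < m (s n)) sequentially"
        using order_tendstoD(1)[OF s(2), of z] * by simp
      then show "(?F y - ?F x) * (z - y) \<le> (?F z - ?F y) * (y - x)" using L s * by blast
    qed (use xyz in auto)
  qed auto
  moreover have "concave_on {\<mu><..} ?F"
    unfolding concave_on_def
  proof (rule convex_on_slopes)
    fix x y z assume xyz: "x \<in> {\<mu><..}" "z \<in> {\<mu><..}" "x < y" "y < z"
    have mc: "continuous (at_right x) (\<lambda>x. - ?F x)" for x by (intro continuous_intros mcont)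
    show "(- ?F y - - ?F x) * (z - y) \<le> (- ?F z - - ?F y) * (y - x)"
    proof (rule slopes_extend[OF dense mc, of "{\<mu><..}"])
      fix x y z assume *: "x \<in> C" "y \<in> C" "z \<in> C" "x \<in> {\<mu><..}" "z \<in> {\<mu><..}" "x < y" "y < z"
      have "eventually (\<lambda>n. m (s n) < x) sequentially"
        using order_tendstoD(2)[OF s(2), of x] * by simp
      then have "(?F z - ?F y) * (y - x) \<le> (?F y - ?F x) * (z - y)" using R s * by blast
      then show "(- ?F y - - ?F x) * (z - y) \<le> (- ?F z - - ?F y) * (y - x)" by (simp add: algebra_simps)
    qed (use xyz in auto)
  qed auto
  ultimately show ?thesis by (auto simp: unimodal_def)
qed

definition unimodal_char :: "(real \<Rightarrow> complex) \<Rightarrow> bool" where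
  "unimodal_char f \<longleftrightarrow> (\<exists>M. real_distribution M \<and> unimodal M \<and> char M = f)"

lemma unimodal_char_limit:
  assumes f: "\<And>n. unimodal_char (f n)" and lim: "\<And>t. (\<lambda>n. f n t) \<longlonglongrightarrow> g t" and cont: "isCont g 0"
  shows "unimodal_char g"
proof -
  obtain M where M: "\<And>n. real_distribution (M n)" "\<And>n. unimodal (M n)" "\<And>n. char (M n) = f n"
    using f unfolding unimodal_char_def by metis
  obtain m where m: "\<And>n. convex_on {..<m n} (cdf (M n))" "\<And>n. concave_on {m n<..} (cdf (M n))"
    using M(2) unfolding unimodal_def by metis
  obtain M' where M': "real_distribution M'" "char M' = g" "weak_conv_m M M'"
  proof (rule levy_continuity_existence[of M g])
    show "(\<lambda>n. char (M n) t) \<longlonglongrightarrow> g t" for t using lim[of t] by (simp add: M(3))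
  qed (use M cont in auto)
  have "unimodal M'"
  proof (rule unimodal_limit[OF M'(1), where r="\<lambda>_ x. x" and m=m])
    show "isCont (cdf M') x \<Longrightarrow> (\<lambda>n. cdf (M n) x) \<longlonglongrightarrow> cdf M' x" for x
      using M'(3) by (auto simp: weak_conv_m_def weak_conv_def)
    show "(cdf (M n) y - cdf (M n) x) * (z - y) \<le> (cdf (M n) z - cdf (M n) y) * (y - x)"
      if "x < y" "y < z" "z < m n" for n x y z
      using that by (intro slopes_of_convex_on[OF m(1)]) auto
    show "(cdf (M n) z - cdf (M n) y) * (y - x) \<le> (cdf (M n) y - cdf (M n) x) * (z - y)"
      if "m n < x" "x < y" "y < z" for n x y z
      using slopes_of_convex_on[OF m(2)[unfolded concave_on_def], of x n z y] that
      by (auto simp: algebra_simps)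
  qed auto
  then show ?thesis using M' unfolding unimodal_char_def by blast
qed

section \<open>Discrete self-decomposable laws\<close>

text \<open>For the generating function \<open>g\<close> of \<open>a\<close>, the recursion says
  \<open>g' = R g\<close>, where \<open>R\<close> has the coefficients \<open>k (j + 1)\<close>.
  Monotonicity of \<open>k\<close> is the discrete form of self-decomposability.\<close>

locale renewal_sequence =
  fixes a k :: "nat \<Rightarrow> real"
  assumes a0: "a 0 > 0" and a_nonneg: "\<And>n. 0 \<le> a n" and a_sum: "summable a"
    and k_nonneg: "\<And>j. 0 \<le> k j" and k_antimono: "\<And>i j. 0 < i \<Longrightarrow> i \<le> j \<Longrightarrow> k j \<le> k i"
    and rec: "\<And>n. real n * a n = (\<Sum>u<n. k (n - u) * a u)"
begin

definition d :: "nat \<Rightarrow> real" where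
  "d n = a n - (if n = 0 then 0 else a (n - 1))"

lemma sum_d: "(\<Sum>u\<le>n. d u) = a n"
  by (induction n) (auto simp: d_def)

text \<open>Summation by parts in the recursion. The weight \<open>- 1\<close> arises because the
  difference of the recursion at \<open>p + 1\<close> and at \<open>p\<close> equals
  \<open>(p + 1) * d (p + 1) + a p\<close>, and \<open>a p\<close> is the sum of all
  \<open>d u\<close> with \<open>u \<le> p\<close>.\<close>

lemma rec_d: "real (Suc p) * d (Suc p) = (\<Sum>u\<le>p. (k (Suc p - u) - 1) * d u)"
proof -
  have "(\<Sum>u\<le>p. k (Suc p - u) * d u) = k (Suc p) * a 0 + (\<Sum>u<p. k (p - u) * (a (Suc u) - a u))"
    unfolding lessThan_Suc_atMost[symmetric] by (subst sum.lessThan_Suc_shift) (simp add: d_def)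
  also have "\<dots> = (k (Suc p) * a 0 + (\<Sum>u<p. k (p - u) * a (Suc u))) - (\<Sum>u<p. k (p - u) * a u)"
    by (simp add: algebra_simps sum_subtractf)
  also have "k (Suc p) * a 0 + (\<Sum>u<p. k (p - u) * a (Suc u)) = (\<Sum>u<Suc p. k (Suc p - u) * a u)"
    by (subst sum.lessThan_Suc_shift) simp
  also have "\<dots> - (\<Sum>u<p. k (p - u) * a u) = real (Suc p) * a (Suc p) - real p * a p"
    by (simp only: rec)
  finally have "(\<Sum>u\<le>p. k (Suc p - u) * d u) = real (Suc p) * a (Suc p) - real p * a p" .
  moreover have "(\<Sum>u\<le>p. (k (Suc p - u) - 1) * d u) = (\<Sum>u\<le>p. k (Suc p - u) * d u) - a p"
    by (simp add: algebra_simps sum_subtractf sum_d)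
  ultimately show ?thesis by (simp add: d_def algebra_simps)
qed

lemma ex_neg_d: "\<exists>n. d (Suc n) < 0"
proof (rule ccontr)
  assume "\<not> ?thesis"
  then have "a n \<le> a (Suc n)" for n by (auto simp: d_def not_less dest: spec[of _ n])
  then have "incseq a" by (rule incseq_SucI)
  moreover have "a \<longlonglongrightarrow> 0" using a_sum by (rule summable_LIMSEQ_zero)
  ultimately have "a 0 \<le> 0" by (rule incseq_le)
  then show False using a0 by simp
qed

definition N :: nat where "N = (LEAST n. d (Suc n) < 0)"

lemma d_Suc_N: "d (Suc N) < 0"
  unfolding N_def by (rule LeastI_ex[OF ex_neg_d])

lemma d_nonneg: "u \<le> N \<Longrightarrow> 0 \<le> d u"
  using not_less_Least[of "u - 1" "\<lambda>n. d (Suc n) < 0"] a0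
  unfolding N_def[symmetric] by (cases u) (auto simp: d_def)

text \<open>Let \<open>N\<close> be the last index before the first descent. If \<open>k (n - N - 1) \<ge> 1\<close>, all later weights
  \<open>k (n - u) - 1\<close> are nonnegative and the earlier part is at most its value at \<open>N + 1\<close>; otherwise
  the weights are monotone across the sign change of \<open>d\<close>.\<close>

lemma d_nonpos: "N < n \<Longrightarrow> d n \<le> 0"
proof (induction n rule: less_induct)
  case (less n)
  show ?case
  proof (cases "n = Suc N")
    case True
    then show ?thesis using d_Suc_N by simp
  next
    case False
    then obtain p where n: "n = Suc p" and p: "N < p" using less.prems by (cases n) auto
    have split: "{..p} = {..N} \<union> {N<..p}" "{..N} \<inter> {N<..p} = {}" using p by auto
    have "(\<Sum>u\<le>p. (k (n - u) - 1) * d u) \<le> 0"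
    proof (cases "k (n - Suc N) \<ge> 1")
      case True
      have "(\<Sum>u\<le>N. (k (n - u) - 1) * d u) \<le> (\<Sum>u\<le>N. (k (Suc N - u) - 1) * d u)"
        by (intro sum_mono mult_right_mono d_nonneg diff_right_mono k_antimono) (use n p in auto)
      also have "\<dots> = real (Suc N) * d (Suc N)" by (rule rec_d[symmetric])
      also have "\<dots> \<le> 0" using d_Suc_N by (simp add: mult_nonneg_nonpos)
      finally have 1: "(\<Sum>u\<le>N. (k (n - u) - 1) * d u) \<le> 0" .
      have 2: "(\<Sum>u\<in>{N<..p}. (k (n - u) - 1) * d u) \<le> 0"
      proof (intro sum_nonpos mult_nonneg_nonpos)
        fix u assume u: "u \<in> {N<..p}"
        have "k (n - Suc N) \<le> k (n - u)" by (rule k_antimono) (use u n in auto)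
        then show "0 \<le> k (n - u) - 1" using True by simp
        show "d u \<le> 0" using less.IH u n by auto
      qed
      show ?thesis unfolding split(1) by (subst sum.union_disjoint) (use 1 2 split(2) in auto)
    next
      case False
      have "(\<Sum>u\<le>p. (k (n - u) - 1) * d u) \<le> (\<Sum>u\<le>p. (k (n - Suc N) - 1) * d u)"
      proof (intro sum_mono)
        fix u assume u: "u \<in> {..p}"
        show "(k (n - u) - 1) * d u \<le> (k (n - Suc N) - 1) * d u"
        proof (cases "u \<le> N")
          case True
          have "k (n - u) \<le> k (n - Suc N)" by (rule k_antimono) (use True n p in auto)
          then show ?thesis using d_nonneg[OF True] by (intro mult_right_mono) auto
        next
          case False
          have "k (n - Suc N) \<le> k (n - u)" by (rule k_antimono) (use False n u in auto)
          moreover have "d u \<le> 0" using less.IH u n False by auto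
          ultimately show ?thesis by (intro mult_right_mono_neg) auto
        qed
      qed
      also have "\<dots> = (k (n - Suc N) - 1) * a p" by (simp add: sum_distrib_left[symmetric] sum_d)
      also have "\<dots> \<le> 0" using False a_nonneg[of p] by (intro mult_nonpos_nonneg) auto
      finally show ?thesis .
    qed
    then have "real n * d n \<le> 0" using rec_d[of p] n by simp
    then show ?thesis using n by (simp add: mult_le_0_iff)
  qed
qed

lemma a_incr: "i < N \<Longrightarrow> a i \<le> a (Suc i)"
  using d_nonneg[of "Suc i"] by (auto simp: d_def)

lemma a_pos: "i \<le> N \<Longrightarrow> 0 < a i"
  by (induction i) (use a0 a_incr in \<open>auto simp: Suc_le_eq intro: less_le_trans\<close>)

lemma rec_ratio: "real (Suc p) * a (Suc p) - real p * a p = k 1 * a p - (\<Sum>u<p. (k (p - u) - k (Suc p - u)) * a u)"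
proof -
  have "real (Suc p) * a (Suc p) - real p * a p = (\<Sum>u<Suc p. k (Suc p - u) * a u) - (\<Sum>u<p. k (p - u) * a u)"
    by (simp only: rec)
  then show ?thesis by (simp add: algebra_simps sum_subtractf)
qed

text \<open>Dividing the recursion by \<open>a p\<close> shows that, as long as the ratios \<open>a (p + 1) / a p\<close> decrease and
  are at least \<open>1\<close>, so does the next one.\<close>

lemma ratio_antimono:
  assumes "p < N" "i \<le> p"
  shows "a (Suc p) / a p \<le> a (Suc i) / a i"
  using assms
proof (induction p arbitrary: i)
  case (Suc p)
  define \<rho> where "\<rho> i = a (Suc i) / a i" for i
  have pos: "a (Suc p) > 0" "a p > 0" using a_pos Suc.prems by auto
  have k: "k (Suc p - u) \<ge> k (Suc (Suc p) - u)" if "u < Suc p" for u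
    using that by (intro k_antimono) auto
  have frac: "a u / a p \<le> a (Suc u) / a (Suc p)" if "u < p" for u
  proof -
    have "a (Suc p) / a p \<le> a (Suc u) / a u" using Suc.IH[of u] Suc.prems that by simp
    moreover have "a u > 0" using a_pos that Suc.prems by auto
    ultimately show ?thesis using pos by (simp add: field_simps)
  qed
  have "real (Suc (Suc p)) * \<rho> (Suc p) - real (Suc p)
     = k 1 - (\<Sum>u<Suc p. (k (Suc p - u) - k (Suc (Suc p) - u)) * a u) / a (Suc p)"
    using rec_ratio[of "Suc p"] pos unfolding \<rho>_def by (simp add: field_simps)
  also have "\<dots> \<le> k 1 - (\<Sum>u<p. (k (p - u) - k (Suc p - u)) * a u) / a p"
  proof -
    have "(\<Sum>u<p. (k (p - u) - k (Suc p - u)) * a u) / a p = (\<Sum>u<p. (k (p - u) - k (Suc p - u)) * (a u / a p))"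
      by (simp add: sum_divide_distrib)
    also have "\<dots> \<le> (\<Sum>u<p. (k (p - u) - k (Suc p - u)) * (a (Suc u) / a (Suc p)))"
      by (intro sum_mono mult_left_mono frac) (auto intro!: k_antimono)
    also have "\<dots> \<le> (k (Suc p) - k (Suc (Suc p))) * (a 0 / a (Suc p)) + \<dots>"
      using k[of 0] a0 pos by simp
    also have "\<dots> = (\<Sum>u<Suc p. (k (Suc p - u) - k (Suc (Suc p) - u)) * (a u / a (Suc p)))"
      by (subst sum.lessThan_Suc_shift) simp
    also have "\<dots> = (\<Sum>u<Suc p. (k (Suc p - u) - k (Suc (Suc p) - u)) * a u) / a (Suc p)"
      by (simp only: sum_divide_distrib times_divide_eq_right)
    finally show ?thesis by linarith
  qed
  also have "\<dots> = real (Suc p) * \<rho> p - real p"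
    using rec_ratio[of "p"] pos unfolding \<rho>_def by (simp add: field_simps)
  finally have le: "real (Suc (Suc p)) * (\<rho> (Suc p) - 1) \<le> real (Suc p) * (\<rho> p - 1)" by (simp add: algebra_simps)
  have "1 \<le> \<rho> (Suc p)" using a_incr[of "Suc p"] pos Suc.prems by (simp add: \<rho>_def)
  then have "real (Suc p) * (\<rho> (Suc p) - 1) \<le> real (Suc (Suc p)) * (\<rho> (Suc p) - 1)"
    by (intro mult_right_mono) auto
  with le have "\<rho> (Suc p) - 1 \<le> \<rho> p - 1" by (meson mult_le_cancel_left_pos of_nat_0_less_iff order_trans zero_less_Suc)
  then have 1: "\<rho> (Suc p) \<le> \<rho> p" by simp
  show ?case
  proof (cases "i = Suc p")
    case False
    then have "\<rho> p \<le> \<rho> i" using Suc.IH[of i] Suc.prems by (simp add: \<rho>_def)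
    with 1 show ?thesis by (simp add: \<rho>_def)
  qed simp
qed simp

end

text \<open>The last clause says that the ratios \<open>a i / a (i - 1)\<close> decrease up to the
  mode \<open>N\<close>. Cross-multiplication lets it cover the indices where the denominator
  vanishes. Past \<open>N\<close> only monotonicity is available.\<close>

definition half_log_concave :: "(int \<Rightarrow> real) \<Rightarrow> int \<Rightarrow> bool" where
  "half_log_concave a N \<longleftrightarrow> 0 \<le> N \<and> (\<forall>i. 0 \<le> a i) \<and> (\<forall>i<0. a i = 0) \<and> (\<forall>i. 0 \<le> i \<and> i \<le> N \<longrightarrow> 0 < a i) \<and>
    (\<forall>i\<le>N. a (i - 1) \<le> a i) \<and> (\<forall>i\<ge>N. a (i + 1) \<le> a i) \<and>
    (\<forall>i j. i \<le> j \<and> j \<le> N \<longrightarrow> a (i - 1) * a j \<le> a (j - 1) * a i)"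

lemma (in renewal_sequence) half_log_concave:
  "half_log_concave (\<lambda>i. if i < 0 then 0 else a (nat i)) (int N)"
proof -
  let ?a = "\<lambda>i::int. if i < 0 then 0 else a (nat i)"
  have up: "?a (i - 1) \<le> ?a i" if "i \<le> int N" for i
    using a_incr[of "nat (i - 1)"] a_nonneg that by (auto simp: nat_diff_distrib' Suc_nat_eq_nat_zadd1 intro: a_nonneg)
  have down: "?a (i + 1) \<le> ?a i" if "i \<ge> int N" for i
    using d_nonpos[of "nat (i + 1)"] that by (auto simp: d_def nat_add_distrib split: if_splits)
  have lc: "?a (i - 1) * ?a j \<le> ?a (j - 1) * ?a i" if "i \<le> j" "j \<le> int N" for i j
  proof (cases "i \<le> 0")
    case True
    then show ?thesis using a_nonneg by auto
  next
    case False
    define p q where "p = nat (i - 1)" and "q = nat (j - 1)"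
    have ij: "i = int (Suc p)" "j = int (Suc q)" using False that by (auto simp: p_def q_def)
    have "a (Suc q) / a q \<le> a (Suc p) / a p" using ij that by (intro ratio_antimono) auto
    moreover have "a p > 0" "a q > 0" using ij that by (auto intro!: a_pos)
    ultimately show ?thesis unfolding ij by (simp add: field_simps nat_add_distrib)
  qed
  show ?thesis unfolding half_log_concave_def
    using up down lc by (auto simp: a_nonneg intro!: a_pos)
qed

section \<open>Unimodality of the difference of two independent lattice variables\<close>

locale cross_correlation =
  fixes a b :: "int \<Rightarrow> real" and A B :: int
  assumes a: "half_log_concave a A" and b: "half_log_concave b B"
    and int_a: "integrable (count_space UNIV) a" and int_b: "integrable (count_space UNIV) b"
begin

text \<open>If \<open>a\<close> and \<open>b\<close> are the probabilities of independent
  \<open>X\<close> and \<open>Y\<close>, these are the probabilities of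
  \<open>X - Y\<close>.\<close>

definition q :: "int \<Rightarrow> real" where
  "q x = (LINT u|count_space UNIV. a u * b (u - x))"

lemma b_le: "\<bar>b i\<bar> \<le> b B"
proof -
  have up: "b (B - int n) \<le> b B" for n
  proof (induction n)
    case (Suc n)
    have "b (B - int n - 1) \<le> b (B - int n)" using b by (simp add: half_log_concave_def)
    then show ?case using Suc by (simp add: algebra_simps)
  qed simp
  have down: "b (B + int n) \<le> b B" for n
  proof (induction n)
    case (Suc n)
    have "b (B + int n + 1) \<le> b (B + int n)" using b by (simp add: half_log_concave_def)
    then show ?case using Suc by (simp add: algebra_simps)
  qed simp
  have "b i \<le> b B" using up[of "nat (B - i)"] down[of "nat (i - B)"] by (cases "i \<le> B") auto
  moreover have "0 \<le> b i" using b by (simp add: half_log_concave_def)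
  ultimately show ?thesis by simp
qed

lemma int_shift: "integrable (count_space UNIV) (\<lambda>u. a (u + c))"
  by (subst integrable_bij_count_space[where f=a and g="\<lambda>u. u + c" and B=UNIV])
     (auto simp: int_a intro!: bij_betwI[where g="\<lambda>u. u - c"])

lemma int_ab: "integrable (count_space UNIV) (\<lambda>u. a (u + c) * b (u - x))"
proof (rule Bochner_Integration.integrable_bound)
  show "integrable (count_space UNIV) (\<lambda>u. a (u + c) * b B)" using int_shift by simp
  show "AE u in count_space UNIV. norm (a (u + c) * b (u - x)) \<le> norm (a (u + c) * b B)"
    using b_le by (auto simp: abs_mult intro!: mult_left_mono order_trans[OF b_le])
qed simp

definition D :: "int \<Rightarrow> real" where "D x = q x - q (x - 1)"

lemma int_D: "integrable (count_space UNIV) (\<lambda>u. (a u - a (u - 1)) * b (u - x))"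
  using Bochner_Integration.integrable_diff[OF int_ab[of 0 x] int_ab[of "-1" x]] by (simp add: algebra_simps)

text \<open>Summation by parts puts the difference on \<open>a\<close>, whose increments are
  nonnegative up to \<open>A\<close> and nonpositive afterwards.\<close>

lemma D_eq: "D x = (LINT u|count_space UNIV. (a u - a (u - 1)) * b (u - x))"
proof -
  have "q (x - 1) = (LINT u|count_space UNIV. a (u - 1) * b (u - x))"
    unfolding q_def
    by (subst integral_bij_count_space[where g="\<lambda>u. u - 1" and A=UNIV, symmetric])
       (auto intro!: bij_betwI[where g="\<lambda>u. u + 1"])
  then have "D x = (LINT u|count_space UNIV. a u * b (u - x) - a (u - 1) * b (u - x))"
    unfolding D_def q_def using int_ab[of 0 x] int_ab[of "-1" x]
    by (subst Bochner_Integration.integral_diff) auto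
  then show ?thesis by (simp add: left_diff_distrib)
qed

text \<open>The differences of \<open>a\<close> change sign at \<open>A\<close>. By log-concavity of \<open>b\<close>, replacing
  \<open>b (u - x - 1) * b (A - x)\<close> by \<open>b (u - x) * b (A - x - 1)\<close> therefore increases every term of \<open>D_eq\<close>.\<close>

lemma D_step:
  assumes x: "A - B \<le> x" and D: "D x \<le> 0"
  shows "D (x + 1) \<le> 0"
proof (cases "A < x")
  case True
  \<comment> \<open>The rising part of \<open>a\<close>, where \<open>u \<le> A < x\<close>, meets
    \<open>b\<close> only at negative arguments, where it vanishes. Only the falling part
    contributes.\<close>
  have "(a u - a (u - 1)) * b (u - (x + 1)) \<le> 0" for u
  proof (cases "u \<le> A")
    case True
    then have "b (u - (x + 1)) = 0" using b \<open>A < x\<close> by (auto simp: half_log_concave_def)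
    then show ?thesis by simp
  next
    case False
    then have "a u \<le> a (u - 1)" using a unfolding half_log_concave_def by (metis diff_add_cancel not_le zle_diff1_eq)
    moreover have "0 \<le> b (u - (x + 1))" using b by (auto simp: half_log_concave_def)
    ultimately show ?thesis by (intro mult_nonpos_nonneg) auto
  qed
  then have "0 \<le> (LINT u|count_space UNIV. - ((a u - a (u - 1)) * b (u - (x + 1))))"
    by (intro integral_nonneg_AE) auto
  then show ?thesis unfolding D_eq by simp
next
  case False
  have pos: "0 < b (A - x)" using b x False by (auto simp: half_log_concave_def)
  have lc: "b (i - 1) * b j \<le> b (j - 1) * b i" if "i \<le> j" "j \<le> B" for i j
    using b that by (auto simp: half_log_concave_def)
  have "D (x + 1) * b (A - x) = (LINT u|count_space UNIV. (a u - a (u - 1)) * b (u - (x + 1)) * b (A - x))"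
    unfolding D_eq by simp
  also have "\<dots> \<le> (LINT u|count_space UNIV. (a u - a (u - 1)) * b (u - x) * b (A - x - 1))"
  proof (rule integral_mono)
    fix u
    show "(a u - a (u - 1)) * b (u - (x + 1)) * b (A - x) \<le> (a u - a (u - 1)) * b (u - x) * b (A - x - 1)"
    proof (cases "u \<le> A")
      case True
      then have "a (u - 1) \<le> a u" using a by (auto simp: half_log_concave_def)
      moreover have "b (u - x - 1) * b (A - x) \<le> b (A - x - 1) * b (u - x)" using True x by (intro lc) auto
      ultimately have "(a u - a (u - 1)) * (b (u - x - 1) * b (A - x)) \<le> (a u - a (u - 1)) * (b (A - x - 1) * b (u - x))"
        by (intro mult_left_mono) auto
      then show ?thesis by (simp add: algebra_simps)
    next
      case False
      then have "a u \<le> a (u - 1)" using a unfolding half_log_concave_def by (metis diff_add_cancel not_le zle_diff1_eq)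
      moreover have "b (A - x - 1) * b (u - x) \<le> b (u - x - 1) * b (A - x)"
      proof (cases "u - x \<le> B")
        case True
        then show ?thesis using False by (intro lc) auto
      next
        case False
        \<comment> \<open>Past its mode \<open>b\<close> is not known to be log-concave. Two
          monotonicities replace the ratio inequality: \<open>b\<close> falls from
          \<open>u - x - 1\<close> to \<open>u - x\<close>, and rises from \<open>A - x - 1\<close>
          to \<open>A - x\<close>, which is still at most \<open>B\<close>.\<close>
        then have "b (u - x - 1 + 1) \<le> b (u - x - 1)" using b unfolding half_log_concave_def by (metis not_le zle_diff1_eq)
        moreover have "b (A - x - 1) \<le> b (A - x)" using b x by (auto simp: half_log_concave_def)
        ultimately show ?thesis using b
          by (subst mult.commute, intro mult_mono) (auto simp: half_log_concave_def)
      qed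
      ultimately have "(a u - a (u - 1)) * (b (u - x - 1) * b (A - x)) \<le> (a u - a (u - 1)) * (b (A - x - 1) * b (u - x))"
        by (intro mult_left_mono_neg) auto
      then show ?thesis by (simp add: algebra_simps)
    qed
  qed (intro integrable_mult_left int_D)+
  also have "\<dots> = D x * b (A - x - 1)" unfolding D_eq by simp
  also have "\<dots> \<le> 0" using D b by (intro mult_nonpos_nonneg) (auto simp: half_log_concave_def)
  finally show ?thesis using pos by (simp add: mult_le_0_iff)
qed

end

lemma (in cross_correlation) swap: "cross_correlation b a B A"
  using a b int_a int_b by unfold_locales

text \<open>Exchanging the sequences turns \<open>X - Y\<close> into \<open>Y - X\<close>. This
  reflection yields the left-hand counterpart of \<open>D_step\<close>.\<close>

lemma (in cross_correlation) q_swap: "cross_correlation.q b a x = q (- x)"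
  unfolding cross_correlation.q_def[OF swap] q_def
  by (subst integral_bij_count_space[where g="\<lambda>u. u - x" and A=UNIV and B=UNIV, symmetric])
     (auto intro!: bij_betwI[where g="\<lambda>u. u + x"] Bochner_Integration.integral_cong simp: mult.commute)

lemma no_infinite_lower_bound:
  fixes q :: "int \<Rightarrow> real" and g :: "nat \<Rightarrow> int"
  assumes sum: "\<And>F. finite F \<Longrightarrow> sum q F \<le> 1" and g: "inj g" and \<delta>: "\<delta> > 0"
  shows "\<exists>n. q (g n) < \<delta>"
proof (rule ccontr)
  assume "\<not> ?thesis"
  then have *: "\<delta> \<le> q (g n)" for n by (simp add: not_less)
  obtain n :: nat where n: "1 < real n * \<delta>" using reals_Archimedean3[OF \<delta>] by blast
  have "real n * \<delta> = (\<Sum>i<n. \<delta>)" by simp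
  also have "\<dots> \<le> (\<Sum>i<n. q (g i))" by (intro sum_mono *)
  also have "\<dots> = sum q (g ` {..<n})" using g by (subst sum.reindex) (auto intro: inj_on_subset)
  also have "\<dots> \<le> 1" by (rule sum) simp
  finally show False using n by simp
qed

text \<open>From \<open>y0 = A - B\<close> to the right, \<open>D\<close> stays nonpositive once it
  is so; by reflection, to the left it stays nonnegative. The sign of \<open>D y0\<close> therefore
  tells on which side the mode lies, and settles the other side. A sign change does occur on the
  side of the mode, since otherwise \<open>q\<close> would stay above a positive constant at
  infinitely many points.\<close>

lemma (in cross_correlation) q_unimodal:
  assumes sum: "\<And>F. finite F \<Longrightarrow> sum q F \<le> 1"
  shows "\<exists>m. (\<forall>i\<le>m. q (i - 1) \<le> q i) \<and> (\<forall>i\<ge>m. q (i + 1) \<le> q i)"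
proof -
  interpret s: cross_correlation b a B A by (rule swap)
  have q_nonneg: "0 \<le> q x" for x
    unfolding q_def using a b by (intro integral_nonneg_AE) (auto simp: half_log_concave_def)
  define y0 where "y0 = A - B"
  have right: "D (x + 1) \<le> 0" if "y0 \<le> x" "D x \<le> 0" for x using D_step that by (simp add: y0_def)
  \<comment> \<open>The reflected index is \<open>1 - x\<close> rather than \<open>- x\<close>
    because \<open>D x\<close> compares \<open>x\<close> with \<open>x - 1\<close>; hence the range
    up to \<open>y0 + 1\<close> in \<open>left\<close>.\<close>
  have sD: "s.D x = - D (1 - x)" for x by (simp add: s.D_def D_def q_swap algebra_simps)
  have left: "0 \<le> D (y - 1)" if "y \<le> y0 + 1" "0 \<le> D y" for y
    using s.D_step[of "1 - y"] that by (simp add: sD y0_def algebra_simps)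
  have rights: "D y \<le> 0" if "y0 \<le> x" "D x \<le> 0" "x \<le> y" for x y
    using \<open>x \<le> y\<close>
  proof (induction y rule: int_ge_induct)
    case (step i) then show ?case using right[of i] that by auto
  qed (use that in auto)
  have lefts: "0 \<le> D y" if "x \<le> y0 + 1" "0 \<le> D x" "y \<le> x" for x y
    using \<open>y \<le> x\<close>
  proof (induction y rule: int_le_induct)
    case (step i) then show ?case using left[of i] that by auto
  qed (use that in auto)
  have "\<exists>m. (\<forall>i\<le>m. 0 \<le> D i) \<and> (\<forall>i>m. D i \<le> 0)"
  proof (cases "0 \<le> D y0")
    case True
    have "\<exists>n. D (y0 + 1 + int n) \<le> 0"
    proof (rule ccontr)
      assume "\<not> ?thesis"
      then have pos: "0 < D (y0 + 1 + int n)" for n by (simp add: not_le)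
      have "q (y0 + 1) \<le> q (y0 + 1 + int n)" for n
      proof (induction n)
        case (Suc n)
        have "q (y0 + 1 + int n) \<le> q (y0 + 1 + int (Suc n))" using pos[of "Suc n"] by (simp add: D_def algebra_simps)
        then show ?case using Suc by linarith
      qed simp
      moreover have "0 < q (y0 + 1)" using pos[of 0] q_nonneg[of y0] by (simp add: D_def)
      ultimately show False
        using no_infinite_lower_bound[OF sum, of "\<lambda>n. y0 + 1 + int n" "q (y0 + 1)"] by (auto simp: inj_def not_less[symmetric])
    qed
    define n where "n = (LEAST n. D (y0 + 1 + int n) \<le> 0)"
    have n: "D (y0 + 1 + int n) \<le> 0" unfolding n_def by (rule LeastI_ex) fact
    have "0 \<le> D i" if "i \<le> y0 + int n" for i
    proof (cases "i \<le> y0")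
      case True
      then show ?thesis using lefts[of y0 i] \<open>0 \<le> D y0\<close> by simp
    next
      case False
      then have "nat (i - y0 - 1) < n" using that by linarith
      from not_less_Least[OF this[unfolded n_def]] show ?thesis using False by simp
    qed
    moreover have "D i \<le> 0" if "i > y0 + int n" for i using rights[OF _ n, of i] that by simp
    ultimately show ?thesis by blast
  next
    case False
    have "\<exists>n. 0 \<le> D (y0 - 1 - int n)"
    proof (rule ccontr)
      assume "\<not> ?thesis"
      then have neg: "D (y0 - 1 - int n) < 0" for n by (simp add: not_le)
      have "q (y0 - 1) \<le> q (y0 - 1 - int n)" for n
      proof (induction n)
        case (Suc n)
        have "q (y0 - 1 - int n) \<le> q (y0 - 1 - int (Suc n))" using neg[of n] by (simp add: D_def algebra_simps)
        then show ?case using Suc by linarith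
      qed simp
      moreover have "0 < q (y0 - 1)" using False q_nonneg[of y0] by (simp add: D_def)
      ultimately show False
        using no_infinite_lower_bound[OF sum, of "\<lambda>n. y0 - 1 - int n" "q (y0 - 1)"] by (auto simp: inj_def not_less[symmetric])
    qed
    define n where "n = (LEAST n. 0 \<le> D (y0 - 1 - int n))"
    have n: "0 \<le> D (y0 - 1 - int n)" unfolding n_def by (rule LeastI_ex) fact
    have "D i \<le> 0" if "i > y0 - 1 - int n" for i
    proof (cases "i \<ge> y0")
      case True
      then show ?thesis using rights[of y0 i] False by simp
    next
      case False
      then have "nat (y0 - 1 - i) < n" using that by linarith
      from not_less_Least[OF this[unfolded n_def]] show ?thesis using False by simp
    qed
    moreover have "0 \<le> D i" if "i \<le> y0 - 1 - int n" for i using lefts[OF _ n, of i] that by simp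
    ultimately show ?thesis by blast
  qed
  then obtain m where m: "\<And>i. i \<le> m \<Longrightarrow> 0 \<le> D i" "\<And>i. i > m \<Longrightarrow> D i \<le> 0" by blast
  have "q (i - 1) \<le> q i" if "i \<le> m" for i using m(1)[OF that] by (simp add: D_def)
  moreover have "q (i + 1) \<le> q i" if "i \<ge> m" for i using m(2)[of "i + 1"] that by (simp add: D_def)
  ultimately show ?thesis by blast
qed

section \<open>Lattice laws\<close>

text \<open>The exponential \<open>g\<close> solves \<open>g' = P g\<close>, where the polynomial
  \<open>P\<close> has the coefficients \<open>k (j + 1)\<close>; comparing coefficients gives the
  recursion. As the exponent is a finite sum, \<open>g\<close> is entire, so its expansion may be
  evaluated at \<open>1\<close>, which gives summability.\<close>

lemma renewal_generating_function:
  fixes k :: "nat \<Rightarrow> real"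
  assumes k_nonneg: "\<And>j. 0 \<le> k j" and k_antimono: "\<And>i j. 0 < i \<Longrightarrow> i \<le> j \<Longrightarrow> k j \<le> k i"
    and k_fin: "\<And>j. n < j \<Longrightarrow> k j = 0"
  obtains a where "renewal_sequence a k"
    "\<And>z::complex. (\<lambda>m. of_real (a m) * z ^ m) sums exp (\<Sum>j=1..n. of_real (k j / real j) * (z ^ j - 1))"
proof -
  define g where "g z = exp (\<Sum>j=1..n. of_real (k j / real j) * (z ^ j - 1))" for z :: complex
  define P where "P z = (\<Sum>j=1..n. of_real (k j) * z ^ (j - 1))" for z :: complex
  have hol: "g holomorphic_on UNIV" unfolding g_def by (intro holomorphic_intros)
  define G where "G = fps_expansion g 0"
  have G: "g has_fps_expansion G" unfolding G_def by (rule has_fps_expansion_fps_expansion[OF _ _ hol]) auto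
  define FP where "FP = (\<Sum>j=1..n. fps_const (complex_of_real (k j)) * fps_X ^ (j - 1))"
  have FP: "P has_fps_expansion FP" unfolding P_def FP_def by (intro fps_expansion_intros)
  have dg: "deriv g z = P z * g z" for z
  proof (rule DERIV_imp_deriv)
    have *: "complex_of_real (k j / real j) * (of_nat j * w) = of_real (k j) * w" if "j \<ge> 1" for j w
      using that by simp
    have "(g has_field_derivative g z *
       (\<Sum>j=1..n. of_real (k j / real j) * (of_nat j * z ^ (j - 1)))) (at z)"
      unfolding g_def by (rule derivative_eq_intros refl | simp add: mult.commute)+
    also have "(\<Sum>j=1..n. complex_of_real (k j / real j) * (of_nat j * z ^ (j - 1))) = P z"
      unfolding P_def by (intro sum.cong refl *) auto
    finally show "(g has_field_derivative P z * g z) (at z)" by (simp only: mult.commute)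
  qed
  have "fps_deriv G = FP * G"
  proof (rule fps_expansion_unique_complex)
    show "deriv g has_fps_expansion fps_deriv G" using G by (rule has_fps_expansion_deriv)
    have "(\<lambda>z. P z * g z) has_fps_expansion FP * G" using FP G by (rule has_fps_expansion_mult)
    then show "deriv g has_fps_expansion FP * G" using dg by (simp add: fun_eq_iff[symmetric] dg[abs_def])
  qed
  moreover have FPn: "FP $ i = of_real (k (Suc i))" for i
  proof -
    have "FP $ i = (\<Sum>j=1..n. if j = Suc i then of_real (k j) else 0)"
      unfolding FP_def fps_sum_nth by (intro sum.cong refl) (auto simp: fps_X_power_nth)
    also have "\<dots> = of_real (k (Suc i))" using k_fin[of "Suc i"] by (auto simp: sum.delta)
    finally show ?thesis .
  qed
  ultimately have Gn: "of_nat (Suc i) * G $ Suc i = (\<Sum>l\<le>i. of_real (k (Suc l)) * G $ (i - l))" for i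
    by (metis (no_types, lifting) Suc_eq_plus1 atMost_atLeast0 fps_deriv_nth fps_mult_nth sum.cong)
  have G0: "G $ 0 = of_real (exp (- (\<Sum>j=1..n. k j / real j)))"
  proof -
    have "G $ 0 = g 0" using has_fps_expansion_imp_0_eq_fps_nth_0[OF G] by simp
    also have "\<dots> = exp (of_real (- (\<Sum>j=1..n. k j / real j)))"
      unfolding g_def by (intro arg_cong[where f=exp]) (simp add: sum_negf power_0_left)
    finally show ?thesis by (simp only: exp_of_real)
  qed
  \<comment> \<open>The recursion propagates realness and nonnegativity, starting from the positive
    value of \<open>g\<close> at \<open>0\<close>.\<close>
  have Gr: "G $ i = of_real (Re (G $ i)) \<and> 0 \<le> Re (G $ i)" for i
  proof (induction i rule: less_induct)
    case (less i)
    show ?case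
    proof (cases i)
      case (Suc p)
      have "(\<Sum>l\<le>p. of_real (k (Suc l)) * G $ (p - l)) = (\<Sum>l\<le>p. of_real (k (Suc l)) * of_real (Re (G $ (p - l))))"
        using less Suc by (intro sum.cong refl) (metis diff_le_self le_imp_less_Suc)
      also have "\<dots> = of_real (\<Sum>l\<le>p. k (Suc l) * Re (G $ (p - l)))" by simp
      finally have "G $ i = of_real ((\<Sum>l\<le>p. k (Suc l) * Re (G $ (p - l))) / real (Suc p))"
        using Gn[of p] Suc by (simp add: field_simps del: of_nat_Suc)
      moreover have "0 \<le> (\<Sum>l\<le>p. k (Suc l) * Re (G $ (p - l))) / real (Suc p)"
        using less Suc by (intro divide_nonneg_nonneg sum_nonneg mult_nonneg_nonneg k_nonneg) auto
      ultimately show ?thesis by (metis Re_complex_of_real)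
    qed (simp add: G0)
  qed
  define a where "a i = Re (G $ i)" for i
  have Ga: "G $ i = of_real (a i)" for i using Gr by (simp add: a_def)
  have sums: "(\<lambda>m. of_real (a m) * z ^ m) sums g z" for z :: complex
  proof -
    have "(\<lambda>m. G $ m * z ^ m) sums g z"
      by (rule has_fps_expansion_imp_sums_complex[OF G, where r="\<infinity>"])
         (use hol in \<open>auto intro: holomorphic_on_subset\<close>)
    then show ?thesis by (simp add: Ga)
  qed
  have "renewal_sequence a k"
  proof
    show "a 0 > 0" by (simp add: a_def G0)
    show "0 \<le> a i" for i using Gr by (simp add: a_def)
    have "(\<lambda>m. complex_of_real (a m)) sums g 1" using sums[of 1] by simp
    then have "summable (\<lambda>m. complex_of_real (a m))" by (rule sums_summable)
    then show "summable a" by (simp add: summable_of_real_iff)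
    show "real m * a m = (\<Sum>u<m. k (m - u) * a u)" for m
    proof (cases m)
      case (Suc p)
      have "complex_of_real (real m * a m) = (\<Sum>l\<le>p. of_real (k (Suc l)) * G $ (p - l))"
        using Gn[of p] Suc by (simp add: Ga)
      also have "\<dots> = of_real (\<Sum>l<m. k (Suc l) * a (p - l))" by (simp add: Ga Suc lessThan_Suc_atMost)
      finally have "real m * a m = (\<Sum>l<m. k (Suc l) * a (p - l))" by (simp only: of_real_eq_iff)
      also have "\<dots> = (\<Sum>l<m. k (m - (m - Suc l)) * a (m - Suc l))"
        by (intro sum.cong refl) (auto simp: Suc intro!: arg_cong2[where f="(*)"] arg_cong[where f=k])
      also have "\<dots> = (\<Sum>u<m. k (m - u) * a u)"
        by (rule sum.nat_diff_reindex[of "\<lambda>u. k (m - u) * a u"])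
      finally show ?thesis .
    qed simp
  qed (use k_nonneg k_antimono in auto)
  then show ?thesis using sums that unfolding g_def by blast
qed

text \<open>At \<open>z = 1\<close> the exponent vanishes, so the coefficients sum to
  \<open>1\<close>; at \<open>z = iexp t\<close> the generating function becomes the characteristic
  function.\<close>

lemma one_sided_lattice_law:
  fixes k :: "nat \<Rightarrow> real"
  assumes k_nonneg: "\<And>j. 0 \<le> k j" and k_antimono: "\<And>i j. 0 < i \<Longrightarrow> i \<le> j \<Longrightarrow> k j \<le> k i"
    and k_fin: "\<And>j. n < j \<Longrightarrow> k j = 0"
  obtains A :: "int pmf" and N where "half_log_concave (pmf A) N"
    "\<And>t. (CLINT u|measure_pmf A. iexp (t * real_of_int u)) = exp (\<Sum>j=1..n. of_real (k j / real j) * (iexp (t * real j) - 1))"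
proof -
  obtain a where a: "renewal_sequence a k"
    and sums: "\<And>z::complex. (\<lambda>m. of_real (a m) * z ^ m) sums exp (\<Sum>j=1..n. of_real (k j / real j) * (z ^ j - 1))"
    by (rule renewal_generating_function[of k n]) ((rule assms | rule that); assumption)+
  interpret renewal_sequence a k by (rule a)
  have "(\<lambda>m. complex_of_real (a m)) sums complex_of_real 1" using sums[of 1] by simp
  then have a1: "a sums 1" by (simp only: sums_of_real_iff)
  have nn: "(\<integral>\<^sup>+x. a x \<partial>count_space UNIV) = 1"
    using a1 a_nonneg by (simp add: nn_integral_count_space_nat suminf_ennreal2 a_sum sums_unique[symmetric])
  define A0 where "A0 = embed_pmf a"
  have A0: "pmf A0 i = a i" for i unfolding A0_def by (rule pmf_embed_pmf[OF a_nonneg nn])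
  define A where "A = map_pmf int A0"
  have "pmf A i = (if i < 0 then 0 else a (nat i))" for i
  proof (cases "i < 0")
    case True
    then have "i \<notin> set_pmf A" by (auto simp: A_def)
    then show ?thesis using True by (simp add: set_pmf_iff)
  next
    case False
    then show ?thesis using pmf_map_inj'[of int A0 "nat i"] by (simp add: A_def A0 inj_on_def)
  qed
  then have "pmf A = (\<lambda>i. if i < 0 then 0 else a (nat i))" by auto
  then have 1: "half_log_concave (pmf A) (int N)" using half_log_concave by simp
  have 2: "(CLINT u|measure_pmf A. iexp (t * real_of_int u)) = exp (\<Sum>j=1..n. of_real (k j / real j) * (iexp (t * real j) - 1))" for t
  proof -
    have e: "iexp (t * real j) = iexp t ^ j" for j by (simp add: exp_of_nat_mult[symmetric] mult_ac)
    have "(CLINT u|measure_pmf A. iexp (t * real_of_int u)) = (CLINT u|measure_pmf A0. iexp (t * real u))"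
      by (simp add: A_def)
    also have "\<dots> = (CLINT u|measure_pmf A0. iexp t ^ u)" by (simp only: e)
    also have "\<dots> = (CLINT u|count_space UNIV. a u *\<^sub>R iexp t ^ u)"
      unfolding measure_pmf_eq_density by (subst integral_density) (auto simp: A0 a_nonneg)
    also have "\<dots> = (\<Sum>u. a u *\<^sub>R iexp t ^ u)"
    proof (rule integral_count_space_nat)
      show "integrable (count_space UNIV) (\<lambda>u. a u *\<^sub>R iexp t ^ u)"
        unfolding integrable_count_space_nat_iff using a_sum a_nonneg by (simp add: norm_power)
    qed
    also have "\<dots> = exp (\<Sum>j=1..n. of_real (k j / real j) * (iexp t ^ j - 1))"
      using sums_unique[OF sums[of "iexp t"]] by (simp add: scaleR_conv_of_real)
    finally show ?thesis by (simp only: e)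
  qed
  show ?thesis using that[OF 1 2] .
qed

lemma integral_bind_pmf_complex:
  fixes f :: "'a \<Rightarrow> complex"
  assumes f: "\<And>x. cmod (f x) \<le> K"
  shows "(CLINT x|bind_pmf M N. f x) = (CLINT y|M. CLINT x|N y. f x)"
proof -
  have i: "integrable (measure_pmf p) f" for p :: "'a pmf"
    by (rule measure_pmf.integrable_const_bound[where B=K]) (use f in auto)
  have j: "integrable (measure_pmf M) (\<lambda>y. CLINT x|N y. f x)"
  proof (rule measure_pmf.integrable_const_bound[where B=K])
    have "cmod (CLINT x|N y. f x) \<le> K" for y
    proof -
      have "cmod (CLINT x|N y. f x) \<le> (LINT x|N y. cmod (f x))" by (rule integral_norm_bound)
      also have "\<dots> \<le> (LINT x|N y. K)" using f by (intro integral_mono) (auto simp: i)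
      finally show ?thesis by simp
    qed
    then show "AE y in measure_pmf M. cmod (CLINT x|N y. f x) \<le> K" by simp
  qed simp
  have b: "(LINT x|bind_pmf M N. h x) = (LINT y|M. LINT x|N y. h x)" if "\<And>x. \<bar>h x\<bar> \<le> K" for h :: "'a \<Rightarrow> real"
    unfolding measure_pmf_bind
    by (rule integral_bind[where K="count_space UNIV" and B=K and B'=1])
       (use that in \<open>auto intro: measure_pmf.finite_measure_axioms simp: measure_pmf.emeasure_space_1
          space_subprob_algebra subprob_space_measure_pmf\<close>)
  show ?thesis
  proof (rule complex_eqI)
    show "Re (CLINT x|bind_pmf M N. f x) = Re (CLINT y|M. CLINT x|N y. f x)"
      unfolding integral_Re[OF i, symmetric] integral_Re[OF j, symmetric]
      by (rule b[OF order_trans[OF abs_Re_le_cmod f]])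
    show "Im (CLINT x|bind_pmf M N. f x) = Im (CLINT y|M. CLINT x|N y. f x)"
      unfolding integral_Im[OF i, symmetric] integral_Im[OF j, symmetric]
      by (rule b[OF order_trans[OF abs_Im_le_cmod f]])
  qed
qed

text \<open>\<open>Z\<close> is the difference of independent variables with the one-sided laws for
  \<open>k\<close> and \<open>l\<close>; subtraction puts \<open>- t\<close> into the factor that
  comes from \<open>l\<close>.\<close>

lemma two_sided_lattice_law:
  fixes k l :: "nat \<Rightarrow> real"
  assumes k: "\<And>j. 0 \<le> k j" "\<And>i j. 0 < i \<Longrightarrow> i \<le> j \<Longrightarrow> k j \<le> k i" "\<And>j. n < j \<Longrightarrow> k j = 0"
    and l: "\<And>j. 0 \<le> l j" "\<And>i j. 0 < i \<Longrightarrow> i \<le> j \<Longrightarrow> l j \<le> l i" "\<And>j. n < j \<Longrightarrow> l j = 0"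
  obtains Z :: "int pmf" and m where "\<And>i. i \<le> m \<Longrightarrow> pmf Z (i - 1) \<le> pmf Z i" "\<And>i. i \<ge> m \<Longrightarrow> pmf Z (i + 1) \<le> pmf Z i"
    "\<And>t. (CLINT u|measure_pmf Z. iexp (t * real_of_int u)) =
      exp (\<Sum>j=1..n. of_real (k j / real j) * (iexp (t * real j) - 1) + of_real (l j / real j) * (iexp (- t * real j) - 1))"
proof -
  obtain A A0 where A: "half_log_concave (pmf A) A0"
    and cA: "\<And>t. (CLINT u|measure_pmf A. iexp (t * real_of_int u)) = exp (\<Sum>j=1..n. of_real (k j / real j) * (iexp (t * real j) - 1))"
    by (rule one_sided_lattice_law[of k n]) ((rule k | rule that); assumption)+
  obtain B B0 where B: "half_log_concave (pmf B) B0"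
    and cB: "\<And>t. (CLINT u|measure_pmf B. iexp (t * real_of_int u)) = exp (\<Sum>j=1..n. of_real (l j / real j) * (iexp (t * real j) - 1))"
    by (rule one_sided_lattice_law[of l n]) ((rule l | rule that); assumption)+
  interpret cross_correlation "pmf A" "pmf B" A0 B0
    using A B by unfold_locales (auto intro: integrable_pmf)
  define Z where "Z = bind_pmf B (\<lambda>j. map_pmf (\<lambda>i. i - j) A)"
  have pZ: "pmf Z x = q x" for x
  proof -
    have "pmf (map_pmf (\<lambda>i. i - j) A) x = pmf A (x + j)" for j
      using pmf_map_inj'[of "\<lambda>i. i - j" A "x + j"] by (simp add: inj_def)
    then have "pmf Z x = (LINT j|measure_pmf B. pmf A (x + j))" by (simp add: Z_def pmf_bind)
    also have "\<dots> = (LINT j|count_space UNIV. pmf B j * pmf A (x + j))"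
      unfolding measure_pmf_eq_density by (subst integral_density) auto
    also have "\<dots> = q x"
      unfolding q_def
      by (subst integral_bij_count_space[where g="\<lambda>u. u + x" and A=UNIV and B=UNIV, symmetric])
         (auto intro!: bij_betwI[where g="\<lambda>u. u - x"] Bochner_Integration.integral_cong simp: algebra_simps)
    finally show ?thesis .
  qed
  have "sum q F \<le> 1" if "finite F" for F
    using measure_measure_pmf_finite[OF that, of Z] measure_pmf.prob_le_1[of Z F] by (simp add: pZ)
  then obtain m where m: "\<And>i. i \<le> m \<Longrightarrow> q (i - 1) \<le> q i" "\<And>i. i \<ge> m \<Longrightarrow> q (i + 1) \<le> q i"
    using q_unimodal by blast
  have "(CLINT u|measure_pmf Z. iexp (t * real_of_int u)) =
      exp (\<Sum>j=1..n. of_real (k j / real j) * (iexp (t * real j) - 1) + of_real (l j / real j) * (iexp (- t * real j) - 1))" for t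
  proof -
    have "(CLINT u|measure_pmf Z. iexp (t * real_of_int u)) = (CLINT j|B. CLINT i|A. iexp (t * real_of_int (i - j)))"
      unfolding Z_def by (subst integral_bind_pmf_complex[where K=1]) auto
    also have "\<dots> = (CLINT j|B. CLINT i|A. iexp (- t * real_of_int j) * iexp (t * real_of_int i))"
      by (intro Bochner_Integration.integral_cong refl) (simp add: exp_add[symmetric] algebra_simps)
    also have "\<dots> = (CLINT j|B. iexp (- t * real_of_int j)) * (CLINT i|A. iexp (t * real_of_int i))"
      by simp
    also have "\<dots> = exp (\<Sum>j=1..n. of_real (k j / real j) * (iexp (t * real j) - 1) + of_real (l j / real j) * (iexp (- t * real j) - 1))"
      unfolding cA cB[of "-t"] by (simp only: exp_add[symmetric] sum.distrib add.commute)
    finally show ?thesis .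
  qed
  with m that[of m Z] show ?thesis by (simp add: pZ)
qed

section \<open>Distribution functions of unimodal lattice laws\<close>

lemma measure_pmf_int_diff:
  fixes Z :: "int pmf"
  assumes "x \<le> y"
  shows "measure Z {..y} - measure Z {..x} = sum (pmf Z) {x<..y}"
proof -
  have "{..y} = {..x} \<union> {x<..y}" using assms by auto
  then have "measure Z {..y} = measure Z {..x} + measure Z {x<..y}"
    by (simp only:) (subst measure_pmf.finite_measure_Union; auto)
  then show ?thesis by (simp add: measure_measure_pmf_finite)
qed

text \<open>Both increments are compared with the middle probability \<open>pmf Z j\<close>: below
  the mode, each mass in \<open>{i<..j}\<close> is at most this value and each mass in
  \<open>{j<..l}\<close> at least this value.\<close>

lemma pmf_slopes_left:
  fixes Z :: "int pmf"
  assumes ij: "i \<le> j" "j \<le> l" and up: "\<And>x. x \<le> m \<Longrightarrow> pmf Z (x - 1) \<le> pmf Z x" and lm: "l \<le> m"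
  shows "(measure Z {..j} - measure Z {..i}) * (l - j) \<le> (measure Z {..l} - measure Z {..j}) * (j - i)"
proof -
  have mono: "pmf Z x \<le> pmf Z y" if "x \<le> y" "y \<le> l" for x y
    using that
  proof (induction y rule: int_ge_induct)
    case (step y)
    then show ?case using up[of "y + 1"] lm by simp
  qed simp
  have "sum (pmf Z) {i<..j} \<le> (\<Sum>x\<in>{i<..j}. pmf Z j)" by (intro sum_mono mono) (use ij in auto)
  then have 1: "measure Z {..j} - measure Z {..i} \<le> real_of_int (j - i) * pmf Z j" using ij by (simp add: measure_pmf_int_diff)
  have "(\<Sum>x\<in>{j<..l}. pmf Z j) \<le> sum (pmf Z) {j<..l}" by (intro sum_mono mono) auto
  then have 2: "real_of_int (l - j) * pmf Z j \<le> measure Z {..l} - measure Z {..j}" using ij by (simp add: measure_pmf_int_diff)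
  have "(measure Z {..j} - measure Z {..i}) * (l - j) \<le> real_of_int (j - i) * pmf Z j * (l - j)"
    using ij by (intro mult_right_mono 1) auto
  also have "\<dots> = real_of_int (l - j) * pmf Z j * (j - i)" by simp
  also have "\<dots> \<le> (measure Z {..l} - measure Z {..j}) * (j - i)" using ij by (intro mult_right_mono 2) auto
  finally show ?thesis .
qed

lemma pmf_slopes_right:
  fixes Z :: "int pmf"
  assumes ij: "i \<le> j" "j \<le> l" and down: "\<And>x. x \<ge> m \<Longrightarrow> pmf Z (x + 1) \<le> pmf Z x" and im: "m \<le> i"
  shows "(measure Z {..l} - measure Z {..j}) * (j - i) \<le> (measure Z {..j} - measure Z {..i}) * (l - j)"
proof -
  have mono: "pmf Z y \<le> pmf Z x" if "x \<le> y" "i \<le> x" for x y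
    using that
  proof (induction y rule: int_ge_induct)
    case (step y)
    then show ?case using down[of y] im by auto
  qed simp
  have "(\<Sum>x\<in>{i<..j}. pmf Z j) \<le> sum (pmf Z) {i<..j}" by (intro sum_mono mono) auto
  then have 1: "real_of_int (j - i) * pmf Z j \<le> measure Z {..j} - measure Z {..i}" using ij by (simp add: measure_pmf_int_diff)
  have "sum (pmf Z) {j<..l} \<le> (\<Sum>x\<in>{j<..l}. pmf Z j)" by (intro sum_mono mono) (use ij in auto)
  then have 2: "measure Z {..l} - measure Z {..j} \<le> real_of_int (l - j) * pmf Z j" using ij by (simp add: measure_pmf_int_diff)
  have "(measure Z {..l} - measure Z {..j}) * (j - i) \<le> real_of_int (l - j) * pmf Z j * (j - i)"
    using ij by (intro mult_right_mono 2) auto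
  also have "\<dots> = real_of_int (j - i) * pmf Z j * (l - j)" by simp
  also have "\<dots> \<le> (measure Z {..j} - measure Z {..i}) * (l - j)" using ij by (intro mult_right_mono 1) auto
  finally show ?thesis .
qed

lemma unimodal_char_lattice_limit:
  fixes Z :: "nat \<Rightarrow> int pmf" and m :: "nat \<Rightarrow> int"
  assumes up: "\<And>n i. i \<le> m n \<Longrightarrow> pmf (Z n) (i - 1) \<le> pmf (Z n) i"
    and down: "\<And>n i. i \<ge> m n \<Longrightarrow> pmf (Z n) (i + 1) \<le> pmf (Z n) i"
    and lim: "\<And>t. (\<lambda>n. CLINT u|measure_pmf (Z n). iexp (t / Suc n * real_of_int u)) \<longlonglongrightarrow> f t"
    and cont: "isCont f 0"
  shows "unimodal_char f"
proof -
  define h where "h n = 1 / real (Suc n)" for n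
  have h: "h n > 0" for n by (simp add: h_def)
  define M where "M n = distr (measure_pmf (Z n)) borel (\<lambda>u. h n * real_of_int u)" for n
  have M: "real_distribution (M n)" for n
    unfolding M_def real_distribution_def real_distribution_axioms_def
    by (auto intro!: measure_pmf.prob_space_distr)
  have charM: "char (M n) t = (CLINT u|measure_pmf (Z n). iexp (t / Suc n * real_of_int u))" for n t
    unfolding char_def M_def by (subst integral_distr) (auto simp: h_def)
  have "(\<lambda>n. char (M n) t) \<longlonglongrightarrow> f t" for t unfolding charM by (rule lim)
  from levy_continuity_existence[OF M this cont]
  obtain M' where M': "real_distribution M'" "char M' = f" "weak_conv_m M M'" by blast
  have cdfM: "cdf (M n) x = measure (Z n) {..\<lfloor>x / h n\<rfloor>}" for n x
  proof -
    have "(\<lambda>u. h n * real_of_int u) -` {..x} = {..\<lfloor>x / h n\<rfloor>}"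
      using h[of n] by (auto simp: le_floor_iff field_simps)
    then show ?thesis unfolding cdf_def M_def by (subst measure_distr) auto
  qed
  have "unimodal M'"
  \<comment> \<open>\<open>r n x\<close> is the last lattice point not exceeding \<open>x\<close>,
    at which the distribution function has the same value as at \<open>x\<close>. Between such
    points slopes are averages of the probabilities, up to the factor \<open>h n\<close>.\<close>
  proof (rule unimodal_limit[OF M'(1), where r="\<lambda>n x. h n * \<lfloor>x / h n\<rfloor>" and m="\<lambda>n. h n * m n"])
    show "isCont (cdf M') x \<Longrightarrow> (\<lambda>n. cdf (M n) x) \<longlonglongrightarrow> cdf M' x" for x
      using M'(3) by (auto simp: weak_conv_m_def weak_conv_def)
    show "(\<lambda>n. h n * \<lfloor>x / h n\<rfloor>) \<longlonglongrightarrow> x" for x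
    proof (rule tendsto_sandwich[of "\<lambda>n. x - h n" _ _ "\<lambda>_. x"])
      have "h \<longlonglongrightarrow> 0" using LIMSEQ_inverse_real_of_nat by (simp add: h_def[abs_def] inverse_eq_divide)
      then show "(\<lambda>n. x - h n) \<longlonglongrightarrow> x" using tendsto_diff[OF tendsto_const[of x]] by fastforce
      have "x - h n \<le> h n * \<lfloor>x / h n\<rfloor>" "h n * \<lfloor>x / h n\<rfloor> \<le> x" for n
      proof -
        have "h n * (x / h n - 1) \<le> h n * \<lfloor>x / h n\<rfloor>" "h n * \<lfloor>x / h n\<rfloor> \<le> h n * (x / h n)"
          by (rule mult_left_mono[OF _ less_imp_le[OF h]], linarith)+
        moreover have "h n * (x / h n) = x" using h[of n] by simp
        ultimately show "x - h n \<le> h n * \<lfloor>x / h n\<rfloor>" "h n * \<lfloor>x / h n\<rfloor> \<le> x"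
          by (simp_all only: right_diff_distrib mult_1_right)
      qed
      then show "eventually (\<lambda>n. x - h n \<le> h n * \<lfloor>x / h n\<rfloor>) sequentially"
        "eventually (\<lambda>n. h n * \<lfloor>x / h n\<rfloor> \<le> x) sequentially" by auto
    qed simp
    have fm: "\<lfloor>x / h n\<rfloor> \<le> \<lfloor>y / h n\<rfloor>" if "x < y" for x y n
      using that h[of n] by (intro floor_mono divide_right_mono) auto
    show "(cdf (M n) y - cdf (M n) x) * (h n * \<lfloor>z / h n\<rfloor> - h n * \<lfloor>y / h n\<rfloor>)
        \<le> (cdf (M n) z - cdf (M n) y) * (h n * \<lfloor>y / h n\<rfloor> - h n * \<lfloor>x / h n\<rfloor>)"
      if "x < y" "y < z" "z < h n * m n" for n x y z
    proof -
      have "\<lfloor>z / h n\<rfloor> \<le> m n" using that(3) h[of n] by (simp add: floor_le_iff field_simps)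
      from pmf_slopes_left[OF fm[OF that(1)] fm[OF that(2)] up this]
      have "h n * ((cdf (M n) y - cdf (M n) x) * (\<lfloor>z / h n\<rfloor> - \<lfloor>y / h n\<rfloor>)) \<le>
          h n * ((cdf (M n) z - cdf (M n) y) * (\<lfloor>y / h n\<rfloor> - \<lfloor>x / h n\<rfloor>))"
        unfolding cdfM using h[of n] by (intro mult_left_mono) auto
      then show ?thesis by (simp add: algebra_simps)
    qed
    show "(cdf (M n) z - cdf (M n) y) * (h n * \<lfloor>y / h n\<rfloor> - h n * \<lfloor>x / h n\<rfloor>)
        \<le> (cdf (M n) y - cdf (M n) x) * (h n * \<lfloor>z / h n\<rfloor> - h n * \<lfloor>y / h n\<rfloor>)"
      if "h n * m n < x" "x < y" "y < z" for n x y z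
    proof -
      have "m n \<le> \<lfloor>x / h n\<rfloor>" using that(1) h[of n] by (simp add: le_floor_iff field_simps)
      from pmf_slopes_right[OF fm[OF that(2)] fm[OF that(3)] down this]
      have "h n * ((cdf (M n) z - cdf (M n) y) * (\<lfloor>y / h n\<rfloor> - \<lfloor>x / h n\<rfloor>)) \<le>
          h n * ((cdf (M n) y - cdf (M n) x) * (\<lfloor>z / h n\<rfloor> - \<lfloor>y / h n\<rfloor>))"
        unfolding cdfM using h[of n] by (intro mult_left_mono) auto
      then show ?thesis by (simp add: algebra_simps)
    qed
  qed
  then show ?thesis using M' unfolding unimodal_char_def by blast
qed

section \<open>Self-decomposable exponents with a probability weight\<close>

text \<open>\<open>exp (w * E (t * x))\<close> is the characteristic function of the self-decomposable law with
  Levy density \<open>w / v\<close> on the interval between \<open>0\<close> and \<open>x\<close>.\<close>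

definition E :: "real \<Rightarrow> complex" where
  "E y = (CLBINT r:{0<..<1}. (iexp (r * y) - 1) / of_real r)"

lemma iexp_minus_1_le: "cmod (iexp x - 1) \<le> \<bar>x\<bar>"
  using iexp_approx1[of x 0] by simp

lemma iexp_minus_1_le_2: "cmod (iexp x - 1) \<le> 2"
  using norm_triangle_ineq4[of "iexp x" 1] by simp

lemma E_integrand_le: "r > 0 \<Longrightarrow> cmod ((iexp (r * y) - 1) / of_real r) \<le> \<bar>y\<bar>"
  using iexp_minus_1_le[of "r * y"] by (simp add: norm_divide field_simps abs_mult)

text \<open>The bounds \<open>|y|\<close> and \<open>2 / r\<close> are merged into one whose
  integral over \<open>r\<close> is a logarithm; a logarithmic moment then dominates
  \<open>E\<close>. Adding the two bounds gives the constant \<open>3\<close>, rounded up to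
  \<open>4\<close>.\<close>

lemma E_integrand_le': 
  assumes r: "r > 0"
  shows "cmod ((iexp (r * y) - 1) / of_real r) \<le> 4 * \<bar>y\<bar> / (1 + \<bar>y\<bar> * r)"
proof -
  have 1: "cmod ((iexp (r * y) - 1) / of_real r) \<le> \<bar>y\<bar>" by (rule E_integrand_le[OF r])
  have "cmod ((iexp (r * y) - 1) / of_real r) = cmod (iexp (r * y) - 1) / r" using r by (simp add: norm_divide)
  also have "\<dots> \<le> 2 / r" using r by (intro divide_right_mono iexp_minus_1_le_2) auto
  finally have 2: "cmod ((iexp (r * y) - 1) / of_real r) * (\<bar>y\<bar> * r) \<le> 2 * \<bar>y\<bar>"
  proof -
    assume "cmod ((iexp (r * y) - 1) / of_real r) \<le> 2 / r"
    then have "cmod ((iexp (r * y) - 1) / of_real r) * (\<bar>y\<bar> * r) \<le> 2 / r * (\<bar>y\<bar> * r)"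
      using r by (intro mult_right_mono) auto
    then show ?thesis using r by simp
  qed
  have "cmod ((iexp (r * y) - 1) / of_real r) * (1 + \<bar>y\<bar> * r) \<le> 4 * \<bar>y\<bar>"
    using 1 2 unfolding distrib_left by linarith
  moreover have "1 + \<bar>y\<bar> * r > 0" using r by (intro add_pos_nonneg) auto
  ultimately show ?thesis by (simp add: pos_le_divide_eq)
qed

lemma FTC_unit_interval:
  fixes F f :: "real \<Rightarrow> 'a :: euclidean_space"
  assumes "continuous_on {0..1} f"
    and "\<And>x. 0 \<le> x \<Longrightarrow> x \<le> 1 \<Longrightarrow> (F has_vector_derivative f x) (at x within {0..1})"
  shows "(LBINT r:{0<..<1}. f r) = F 1 - F 0"
proof -
  have "(LBINT r:{0<..<1}. f r) = (LBINT r:{0..1}. f r)"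
    by (rule set_integral_discrete_difference[where X="{0, 1}"]) auto
  also have "\<dots> = F 1 - F 0" unfolding set_lebesgue_integral_def
    by (rule integral_FTC_atLeastAtMost) (use assms in auto)
  finally show ?thesis .
qed

lemma E_integrable: "set_integrable lborel {0<..<1} (\<lambda>r. (iexp (r * y) - 1) / of_real r)"
  unfolding set_integrable_def
  by (rule integrableI_bounded_set_indicator[where B="\<bar>y\<bar>"]) (auto intro!: AE_I2 E_integrand_le simp del: of_real_mult)

lemma ln_integral:
  fixes y :: real
  assumes "y \<ge> 0"
  shows "set_integrable lborel {0<..<1} (\<lambda>r. 4 * y / (1 + y * r))"
    and "(LBINT r:{0<..<1}. 4 * y / (1 + y * r)) = 4 * ln (1 + y)"
proof -
  have pos: "1 + y * r > 0" if "r \<ge> 0" for r by (rule add_pos_nonneg) (use that assms in auto)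
  have cont: "continuous_on {0..1} (\<lambda>r. 4 * y / (1 + y * r))"
    using pos by (intro continuous_intros) (metis atLeastAtMost_iff less_irrefl)
  have "set_integrable lborel {0..1} (\<lambda>r. 4 * y / (1 + y * r))"
    by (rule borel_integrable_atLeastAtMost'[OF cont])
  then show "set_integrable lborel {0<..<1} (\<lambda>r. 4 * y / (1 + y * r))"
    by (rule set_integrable_subset) auto
  have "(LBINT r:{0<..<1}. 4 * y / (1 + y * r)) = 4 * ln (1 + y * 1) - 4 * ln (1 + y * 0)"
  proof (rule FTC_unit_interval[OF cont])
    show "((\<lambda>r. 4 * ln (1 + y * r)) has_vector_derivative 4 * y / (1 + y * x)) (at x within {0..1})"
      if "0 \<le> x" for x
      using pos[OF that]
      by (auto intro!: derivative_eq_intros simp: has_real_derivative_iff_has_vector_derivative[symmetric])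
  qed
  then show "(LBINT r:{0<..<1}. 4 * y / (1 + y * r)) = 4 * ln (1 + y)" by simp
qed

lemma E_abs_integral_le: "(LBINT r:{0<..<1}. cmod ((iexp (r * y) - 1) / of_real r)) \<le> 4 * ln (1 + \<bar>y\<bar>)"
proof -
  have "(LBINT r:{0<..<1}. cmod ((iexp (r * y) - 1) / of_real r)) \<le> (LBINT r:{0<..<1}. 4 * \<bar>y\<bar> / (1 + \<bar>y\<bar> * r))"
    by (rule set_integral_mono[OF set_integrable_norm[OF E_integrable] ln_integral(1)])
       (auto intro!: E_integrand_le' simp del: of_real_mult)
  then show ?thesis by (simp add: ln_integral(2))
qed

lemma E_le: "cmod (E y) \<le> 4 * ln (1 + \<bar>y\<bar>)"
  unfolding E_def
  by (rule order_trans[OF set_integral_norm_bound[OF E_integrable] E_abs_integral_le])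

text \<open>From \<open>1 + |t * x| \<le> (1 + |t|) * (1 + |x|)\<close>. Separating \<open>t\<close>
  from \<open>x\<close> gives a majorant in \<open>x\<close> that is uniform over bounded
  \<open>t\<close>.\<close>

lemma ln_one_plus_mult_le:
  fixes t x :: real
  assumes "\<bar>t\<bar> \<le> K"
  shows "4 * ln (1 + \<bar>t * x\<bar>) \<le> 4 * (ln (1 + K) + ln (1 + \<bar>x\<bar>))"
proof -
  have K: "0 \<le> K" using assms by linarith
  have "1 + \<bar>t * x\<bar> \<le> (1 + K) * (1 + \<bar>x\<bar>)"
    using K mult_right_mono[OF assms, of "\<bar>x\<bar>"] by (simp add: abs_mult algebra_simps)
  then have "ln (1 + \<bar>t * x\<bar>) \<le> ln ((1 + K) * (1 + \<bar>x\<bar>))"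
    using K by (subst ln_le_cancel_iff) (auto intro!: mult_pos_pos add_pos_nonneg)
  also have "\<dots> = ln (1 + K) + ln (1 + \<bar>x\<bar>)" using K by (intro ln_mult_pos) auto
  finally show ?thesis by simp
qed

lemma E_meas [measurable]: "E \<in> borel_measurable borel"
  unfolding E_def set_lebesgue_integral_def by measurable

lemma E_tendsto_0: "(E \<longlongrightarrow> 0) (at 0)"
proof (rule Lim_null_comparison)
  show "eventually (\<lambda>y. norm (E y) \<le> 4 * ln (1 + \<bar>y\<bar>)) (at 0)" using E_le by simp
  have "((\<lambda>y. 4 * ln (1 + \<bar>y\<bar>)) \<longlongrightarrow> 4 * ln (1 + \<bar>0\<bar>)) (at (0::real))"
    by (intro tendsto_intros) auto
  then show "((\<lambda>y. 4 * ln (1 + \<bar>y\<bar>)) \<longlongrightarrow> 0) (at (0::real))" by simp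
qed

lemma E_0: "E 0 = 0" by (simp add: E_def)

subsection \<open>Lattice approximation\<close>

text \<open>For \<open>x \<ge> 0\<close>, \<open>E (t * x)\<close> is the integral of
  \<open>(iexp (t * v) - 1) / v\<close> over \<open>0 < v < x\<close>. This is its Riemann sum over
  the points \<open>v = j / (n + 1)\<close>, where spacing divided by \<open>v\<close> is
  \<open>1 / j\<close>.\<close>

definition E_lattice :: "nat \<Rightarrow> real \<Rightarrow> real \<Rightarrow> complex" where
  "E_lattice n t x = (\<Sum>j = 1..nat \<lfloor>x * Suc n\<rfloor>. (iexp (t * (real j / Suc n)) - 1) / of_nat j)"

text \<open>This is the derivative of \<open>E_lattice n (r * t) x\<close> with respect to
  \<open>r\<close>. Differentiation cancels the weights \<open>1 / j\<close> and leaves a geometric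
  sum with an explicit limit, to which dominated convergence applies.\<close>

definition lattice_sum :: "nat \<Rightarrow> real \<Rightarrow> real \<Rightarrow> real \<Rightarrow> complex" where
  "lattice_sum n t x = (\<lambda>r. \<i> * of_real (t / Suc n) * (\<Sum>j = 1..nat \<lfloor>x * Suc n\<rfloor>. iexp (r * t / Suc n) ^ j))"

lemma lattice_sum_meas [measurable]: "lattice_sum n t x \<in> borel_measurable borel"
  unfolding lattice_sum_def by measurable

lemma E_lattice_eq: "E_lattice n t x = (CLBINT r:{0<..<1}. lattice_sum n t x r)"
proof -
  have *: "(CLBINT r:{0<..<1}. \<i> * of_real (t / Suc n) * iexp (r * t / Suc n) ^ j) = (iexp (t * (real j / Suc n)) - 1) / of_nat j"
    if "j \<ge> 1" for j
  proof -
    have e: "iexp (r * t / Suc n) ^ j = iexp (r * (t * (real j / Suc n)))" for r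
      by (simp add: exp_of_nat_mult[symmetric] mult_ac)
    have "(CLBINT r:{0<..<1}. \<i> * of_real (t / Suc n) * iexp (r * t / Suc n) ^ j) = iexp (1 * (t * (real j / Suc n))) / of_nat j - iexp (0 * (t * (real j / Suc n))) / of_nat j"
    proof (rule FTC_unit_interval[where F="\<lambda>r. iexp (r * (t * (real j / Suc n))) / of_nat j"])
      show "continuous_on {0..1} (\<lambda>r. \<i> * of_real (t / Suc n) * iexp (r * t / Suc n) ^ j)"
        by (intro continuous_intros) (simp del: of_nat_Suc)
      have "((\<lambda>r. iexp (r * c) / of_nat j) has_vector_derivative (\<i> * of_real c / of_nat j) * iexp (x * c)) (at x within S)" for x c S
      proof -
        have "((\<lambda>z. exp (\<i> * (z * of_real c)) / of_nat j) has_field_derivative (\<i> * of_real c / of_nat j) * exp (\<i> * (of_real x * of_real c))) (at (of_real x))"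
          using that by (auto intro!: derivative_eq_intros)
        from has_vector_derivative_real_field[OF this] show ?thesis by simp
      qed
      from this[of "t * (real j / Suc n)"]
      show "((\<lambda>r. iexp (r * (t * (real j / Suc n))) / of_nat j) has_vector_derivative \<i> * of_real (t / Suc n) * iexp (x * t / Suc n) ^ j) (at x within {0..1})" for x
        unfolding e using that by simp
    qed
    then show ?thesis by (simp add: diff_divide_distrib)
  qed
  have "(CLBINT r:{0<..<1}. \<i> * of_real (t / Suc n) * (\<Sum>j = 1..nat \<lfloor>x * Suc n\<rfloor>. iexp (r * t / Suc n) ^ j))
      = (\<Sum>j = 1..nat \<lfloor>x * Suc n\<rfloor>. CLBINT r:{0<..<1}. \<i> * of_real (t / Suc n) * iexp (r * t / Suc n) ^ j)"
    unfolding sum_distrib_left set_lebesgue_integral_def scaleR_sum_right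
  proof (rule Bochner_Integration.integral_sum)
    show "integrable lborel (\<lambda>r. indicator {0<..<1} r *\<^sub>R (\<i> * of_real (t / Suc n) * iexp (r * t / Suc n) ^ j))" for j
      by (rule integrableI_bounded_set_indicator[where B="\<bar>t / Suc n\<bar>"])
         (auto intro!: AE_I2 simp: norm_mult norm_power simp del: of_nat_Suc of_real_mult of_real_divide)
  qed
  also have "\<dots> = E_lattice n t x" unfolding E_lattice_def by (intro sum.cong refl *) auto
  finally show ?thesis unfolding lattice_sum_def by (rule sym)
qed

lemma lattice_floor:
  fixes x :: real
  assumes x: "0 \<le> x"
  shows "real (nat \<lfloor>x * Suc n\<rfloor>) / Suc n \<le> x" "x - 1 / Suc n \<le> real (nat \<lfloor>x * Suc n\<rfloor>) / Suc n"
proof -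
  from x have "0 \<le> \<lfloor>x * Suc n\<rfloor>" by simp
  then have "real (nat \<lfloor>x * Suc n\<rfloor>) = of_int \<lfloor>x * Suc n\<rfloor>" by simp
  moreover have "of_int \<lfloor>x * Suc n\<rfloor> \<le> x * Suc n" "x * Suc n - 1 \<le> of_int \<lfloor>x * Suc n\<rfloor>" by linarith+
  ultimately have "real (nat \<lfloor>x * Suc n\<rfloor>) \<le> x * Suc n" "x * Suc n - 1 \<le> real (nat \<lfloor>x * Suc n\<rfloor>)" by linarith+
  then show "real (nat \<lfloor>x * Suc n\<rfloor>) / Suc n \<le> x" "x - 1 / Suc n \<le> real (nat \<lfloor>x * Suc n\<rfloor>) / Suc n"
    using divide_right_mono[of "x * Suc n - 1" "real (nat \<lfloor>x * Suc n\<rfloor>)" "real (Suc n)"]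
    by (auto simp: pos_divide_le_eq diff_divide_distrib simp del: of_nat_Suc)
qed

lemma lattice_sum_le:
  fixes x :: real
  assumes "0 \<le> x"
  shows "cmod (lattice_sum n t x r) \<le> \<bar>t\<bar> * x"
proof -
  have "cmod (\<Sum>j = 1..nat \<lfloor>x * Suc n\<rfloor>. iexp (r * t / Suc n) ^ j) \<le> (\<Sum>j = 1..nat \<lfloor>x * Suc n\<rfloor>. 1)"
    by (rule sum_norm_le) (simp add: norm_power del: of_real_mult of_real_divide)
  also have "\<dots> = real (nat \<lfloor>x * Suc n\<rfloor>)" by simp
  finally have "cmod (lattice_sum n t x r)
     \<le> \<bar>t\<bar> / Suc n * real (nat \<lfloor>x * Suc n\<rfloor>)"
    unfolding lattice_sum_def norm_mult by (intro mult_mono) (auto simp del: of_nat_Suc of_real_mult of_real_divide)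
  also have "\<dots> = \<bar>t\<bar> * (real (nat \<lfloor>x * Suc n\<rfloor>) / Suc n)" by simp
  also have "\<dots> \<le> \<bar>t\<bar> * x" by (intro mult_left_mono lattice_floor assms) auto
  finally show ?thesis .
qed

lemma E_lattice_le:
  assumes "0 \<le> x"
  shows "cmod (E_lattice n t x) \<le> \<bar>t\<bar> * x"
proof -
  have i: "set_integrable lborel {0<..<1} (\<lambda>r. lattice_sum n t x r)"
    unfolding set_integrable_def
  proof (rule integrableI_bounded_set_indicator[where B="\<bar>t\<bar> * x"])
    show "AE r in lborel. r \<in> {0<..<1} \<longrightarrow> cmod (lattice_sum n t x r) \<le> \<bar>t\<bar> * x"
      by (rule AE_I2, rule impI, rule lattice_sum_le[OF assms])
    show "lattice_sum n t x \<in> borel_measurable lborel"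
      by measurable
  qed auto
  have "cmod (E_lattice n t x) \<le> (LBINT r:{0<..<1}. cmod (lattice_sum n t x r))"
    unfolding E_lattice_eq by (rule set_integral_norm_bound[OF i])
  also have "\<dots> \<le> (LBINT r:{0<..<(1::real)}. \<bar>t\<bar> * x)"
    by (rule set_integral_mono[OF set_integrable_norm[OF i]])
       (simp add: set_integrable_def, rule lattice_sum_le[OF assms])
  also have "\<dots> = \<bar>t\<bar> * x" by (simp add: set_lebesgue_integral_def)
  finally show ?thesis .
qed

lemma E_lattice_tendsto:
  assumes x: "0 \<le> x"
  shows "(\<lambda>n. E_lattice n t x) \<longlonglongrightarrow> E (t * x)"
proof (cases "t = 0")
  case True
  then show ?thesis by (simp add: E_lattice_def E_0)
next
  case t: False
  \<comment> \<open>The geometric sum is written in closed form. Its prefactor equals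
    \<open>u n / r\<close>, and \<open>(exp (u n) - 1) / u n\<close> tends to
    \<open>1\<close>.\<close>
  have pw: "(\<lambda>n. lattice_sum n t x r)
     \<longlonglongrightarrow> (iexp (r * (t * x)) - 1) / of_real r" if r: "r > 0" for r
  proof -
    define s where "s = r * t"
    define h where "h n = 1 / real (Suc n)" for n
    define m where "m n = nat \<lfloor>x * Suc n\<rfloor>" for n
    define u where "u n = \<i> * of_real (s * h n)" for n
    have s: "s \<noteq> 0" using r t by (simp add: s_def)
    have h0: "h \<longlonglongrightarrow> 0" using LIMSEQ_inverse_real_of_nat by (simp add: h_def[abs_def] inverse_eq_divide)
    have "u \<longlonglongrightarrow> \<i> * of_real (s * 0)" unfolding u_def by (intro tendsto_intros h0)
    then have u0: "u \<longlonglongrightarrow> 0" by simp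
    have unz: "u n \<noteq> 0" for n using s by (simp add: u_def h_def del: of_nat_Suc)
    have uat: "filterlim u (at 0) sequentially"
      using u0 unz by (auto simp: filterlim_at)
    have q: "(\<lambda>n. (exp (u n) - 1) / u n) \<longlonglongrightarrow> 1"
      by (rule filterlim_compose[OF lim_exp_minus_1 uat])
    have mh: "(\<lambda>n. real (m n) * h n) \<longlonglongrightarrow> x"
    proof (rule tendsto_sandwich[of "\<lambda>n. x - h n" _ _ "\<lambda>_. x"])
      show "(\<lambda>n. x - h n) \<longlonglongrightarrow> x" using tendsto_diff[OF tendsto_const[of x] h0] by simp
    qed (use lattice_floor[OF x] in \<open>auto simp: m_def h_def\<close>)
    have e1: "(\<lambda>n. exp (u n)) \<longlonglongrightarrow> exp 0" by (intro tendsto_intros u0)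
    have e2: "(\<lambda>n. iexp (s * (real (m n) * h n))) \<longlonglongrightarrow> iexp (s * x)"
      by (intro tendsto_intros mh)
    have lim: "(\<lambda>n. exp (u n) * (iexp (s * (real (m n) * h n)) - 1) / ((exp (u n) - 1) / u n) / of_real r)
        \<longlonglongrightarrow> exp 0 * (iexp (s * x) - 1) / 1 / of_real r"
      by (intro tendsto_intros q e1 e2) (use r in auto)
    have ev: "eventually (\<lambda>n. (exp (u n) - 1) / u n \<noteq> 0) sequentially"
      by (rule tendsto_imp_eventually_ne[OF q]) simp
    have "eventually (\<lambda>n. exp (u n) * (iexp (s * (real (m n) * h n)) - 1) / ((exp (u n) - 1) / u n) / of_real r
      = \<i> * of_real (t / Suc n) * (\<Sum>j = 1..m n. iexp (r * t / Suc n) ^ j)) sequentially"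
      using ev
    proof eventually_elim
      case (elim n)
      then have ne: "exp (u n) \<noteq> 1" by auto
      have w: "iexp (r * t / Suc n) = exp (u n)" by (simp add: u_def s_def h_def)
      have p: "exp (u n) ^ m n = iexp (s * (real (m n) * h n))"
        by (simp add: exp_of_nat_mult[symmetric] u_def mult_ac)
      have "(\<Sum>j = 1..m n. exp (u n) ^ j) = exp (u n) * (\<Sum>j<m n. exp (u n) ^ j)"
        unfolding sum_distrib_left by (rule sum.reindex_bij_witness[of _ Suc "\<lambda>j. j - 1"]) (auto simp: power_Suc[symmetric] simp del: power_Suc)
      also have "\<dots> = exp (u n) * ((exp (u n) ^ m n - 1) / (exp (u n) - 1))"
        using ne by (simp add: geometric_sum)
      finally have sum: "(\<Sum>j = 1..m n. exp (u n) ^ j) = exp (u n) * ((exp (u n) ^ m n - 1) / (exp (u n) - 1))" .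
      have "\<i> * of_real (t / Suc n) = u n / of_real r" using r by (simp add: u_def s_def h_def)
      moreover have "e * z / (w / v) / \<rho> = v / \<rho> * (e * (z / w))" for e z w v \<rho> :: complex by (simp add: mult_ac)
      ultimately show ?case unfolding w sum p by simp
    qed
    from Lim_transform_eventually[OF lim this] show ?thesis by (simp add: lattice_sum_def m_def s_def mult_ac)
  qed
  show ?thesis
    unfolding E_lattice_eq E_def set_lebesgue_integral_def
  proof (rule integral_dominated_convergence[where w="\<lambda>r. indicator {0<..<1} r * (\<bar>t\<bar> * x)"])
    show "AE r in lborel. (\<lambda>n. indicator {0<..<1} r *\<^sub>R lattice_sum n t x r)
       \<longlonglongrightarrow> indicator {0<..<1} r *\<^sub>R ((iexp (r * (t * x)) - 1) / of_real r)"
    proof (rule AE_I2)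
      fix r :: real
      show "(\<lambda>n. indicator {0<..<1} r *\<^sub>R lattice_sum n t x r)
         \<longlonglongrightarrow> indicator {0<..<1} r *\<^sub>R ((iexp (r * (t * x)) - 1) / of_real r)"
      proof (cases "r \<in> {0<..<1}")
        case True
        then show ?thesis by (intro tendsto_scaleR tendsto_const pw) auto
      next
        case False
        then have "indicator {0<..<1} r = (0::real)" by simp
        then show ?thesis by (simp only: scaleR_zero_left tendsto_const)
      qed
    qed
    show "AE r in lborel. norm (indicator {0<..<1} r *\<^sub>R lattice_sum n t x r)
       \<le> indicator {0<..<1} r * (\<bar>t\<bar> * x)" for n
      unfolding norm_scaleR by (intro AE_I2 mult_mono lattice_sum_le[OF x]) (auto simp: x)
    show "integrable lborel (\<lambda>r::real. indicator {0<..<1} r * (\<bar>t\<bar> * x))"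
      by (intro integrable_mult_left integrable_real_indicator) auto
  qed measurable
qed

lemma isCont_exponent:
  assumes "real_distribution \<mu>" and [measurable]: "A \<in> sets borel"
    and int: "integrable \<mu> (\<lambda>x. indicator A x * ln (1 + \<bar>x\<bar>))"
  shows "isCont (\<lambda>t. CLINT x|\<mu>. indicator A x *\<^sub>R E (t * x)) 0"
  unfolding continuous_at_sequentially o_def
proof safe
  interpret real_distribution \<mu> by fact
  fix s :: "nat \<Rightarrow> real" assume s: "s \<longlonglongrightarrow> 0"
  then obtain K where K: "K > 0" "\<And>n. \<bar>s n\<bar> \<le> K"
    using BseqE[OF convergent_imp_Bseq[OF convergentI[OF s]]] by auto
  have contE: "isCont E 0" using E_tendsto_0 by (simp add: isCont_def E_0)
  show "(\<lambda>n. CLINT x|\<mu>. indicator A x *\<^sub>R E (s n * x)) \<longlonglongrightarrow> (CLINT x|\<mu>. indicator A x *\<^sub>R E (0 * x))"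
  proof (rule integral_dominated_convergence[where w="\<lambda>x. 4 * (ln (1 + K) + indicator A x * ln (1 + \<bar>x\<bar>))"])
    show "integrable \<mu> (\<lambda>x. 4 * (ln (1 + K) + indicator A x * ln (1 + \<bar>x\<bar>)))"
      by (intro integrable_mult_right Bochner_Integration.integrable_add int) simp
    show "AE x in \<mu>. (\<lambda>n. indicator A x *\<^sub>R E (s n * x)) \<longlonglongrightarrow> indicator A x *\<^sub>R E (0 * x)"
    proof (intro AE_I2 tendsto_scaleR tendsto_const)
      fix x
      have "(\<lambda>n. s n * x) \<longlonglongrightarrow> 0 * x" by (intro tendsto_intros s)
      then show "(\<lambda>n. E (s n * x)) \<longlonglongrightarrow> E (0 * x)"
        using isCont_tendsto_compose[OF contE] by simp
    qed
    show "AE x in \<mu>. norm (indicator A x *\<^sub>R E (s n * x)) \<le> 4 * (ln (1 + K) + indicator A x * ln (1 + \<bar>x\<bar>))" for n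
    proof (rule AE_I2)
      fix x
      have "cmod (E (s n * x)) \<le> 4 * (ln (1 + K) + ln (1 + \<bar>x\<bar>))"
        by (rule order_trans[OF E_le ln_one_plus_mult_le[OF K(2)]])
      moreover have "0 \<le> ln (1 + K)" using K by simp
      ultimately show "norm (indicator A x *\<^sub>R E (s n * x)) \<le> 4 * (ln (1 + K) + indicator A x * ln (1 + \<bar>x\<bar>))"
        by (simp add: indicator_def)
    qed
  qed measurable
qed

text \<open>Averaging the Riemann sums over \<open>x\<close> distributed as \<open>\<mu>\<close>
  gives \<open>1 / j\<close> the mass of \<open>[j / (n + 1), R]\<close> as its coefficient, and
  that of the mirrored interval on the negative side. These masses decrease in \<open>j\<close>, as
  the lattice laws require. Truncation at \<open>R\<close> leaves finitely many of them nonzero and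
  bounds the sums.\<close>

lemma unimodal_char_truncated:
  assumes "real_distribution \<mu>" and R: "0 \<le> R" and w: "0 \<le> w"
  shows "unimodal_char (\<lambda>t. exp (of_real w * (CLINT x|\<mu>. indicator {-R..R} x *\<^sub>R E (t * x))))"
proof -
  interpret real_distribution \<mu> by fact
  define N where "N n = nat \<lceil>R * Suc n\<rceil>" for n
  define k where "k n j = w * measure \<mu> {real j / Suc n..R}" for n j
  define l where "l n j = w * measure \<mu> {-R..- (real j / Suc n)}" for n j
  define S where "S n t x = (\<Sum>j = 1..N n. of_real (indicator {real j / Suc n..R} x / j) * (iexp (t * (real j / Suc n)) - 1)
      + of_real (indicator {-R..- (real j / Suc n)} x / j) * (iexp (- t * (real j / Suc n)) - 1))" for n t x
  have k_empty: "R < real j / Suc n" if "N n < j" for n j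
  proof -
    have "R * Suc n \<le> real (N n)" unfolding N_def by linarith
    also have "\<dots> < real j" using that by simp
    finally show ?thesis by (simp add: field_simps)
  qed
  have "\<exists>Z m. (\<forall>i\<le>m. pmf Z (i - 1) \<le> pmf Z i) \<and> (\<forall>i\<ge>m. pmf Z (i + 1) \<le> pmf Z i) \<and>
    (\<forall>t. (CLINT u|measure_pmf Z. iexp (t * real_of_int u)) =
      exp (\<Sum>j=1..N n. of_real (k n j / real j) * (iexp (t * real j) - 1) + of_real (l n j / real j) * (iexp (- t * real j) - 1)))" for n
  proof (rule two_sided_lattice_law[of "k n" "N n" "l n"])
    show "0 \<le> k n j" "0 \<le> l n j" for j using w by (auto simp: k_def l_def)
    show "k n j \<le> k n i" "l n j \<le> l n i" if "0 < i" "i \<le> j" for i j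
    proof -
      have "real i / Suc n \<le> real j / Suc n" using that by (intro divide_right_mono) auto
      then show "k n j \<le> k n i" "l n j \<le> l n i"
        unfolding k_def l_def using w by (auto intro!: mult_left_mono finite_measure_mono)
    qed
    show "k n j = 0" "l n j = 0" if "N n < j" for j using k_empty[OF that] by (simp_all add: k_def l_def)
  qed blast
  then obtain Z m where Z: "\<And>n i. i \<le> m n \<Longrightarrow> pmf (Z n) (i - 1) \<le> pmf (Z n) i" "\<And>n i. i \<ge> m n \<Longrightarrow> pmf (Z n) (i + 1) \<le> pmf (Z n) i"
    and cZ: "\<And>n t. (CLINT u|measure_pmf (Z n). iexp (t * real_of_int u)) =
      exp (\<Sum>j=1..N n. of_real (k n j / real j) * (iexp (t * real j) - 1) + of_real (l n j / real j) * (iexp (- t * real j) - 1))"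
    by metis
  have intS: "integrable \<mu> (\<lambda>x. of_real (indicator {a..b::real} x / j) * (z::complex))" for a b j z
    by (intro integrable_mult_left integrable_of_real integrable_divide_zero)
       (auto intro: integrable_const_bound[where B=1])
  have intSv: "(CLINT x|\<mu>. of_real (indicator {a..b::real} x / j) * (z::complex)) = of_real (measure \<mu> {a..b} / j) * z" for a b j z
    by (simp add: integral_complex_of_real del: of_real_divide)
  have ZS: "(CLINT u|measure_pmf (Z n). iexp (t / Suc n * real_of_int u)) = exp (of_real w * (CLINT x|\<mu>. S n t x))" for n t
  proof -
    have "(CLINT x|\<mu>. S n t x) = (\<Sum>j = 1..N n. of_real (measure \<mu> {real j / Suc n..R} / j) * (iexp (t * (real j / Suc n)) - 1)
      + of_real (measure \<mu> {-R..- (real j / Suc n)} / j) * (iexp (- t * (real j / Suc n)) - 1))"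
      unfolding S_def
      by (subst Bochner_Integration.integral_sum, intro Bochner_Integration.integrable_add intS)
         (intro sum.cong refl, subst Bochner_Integration.integral_add, auto intro!: intS simp only: intSv)
    then have "of_real w * (CLINT x|\<mu>. S n t x) = (\<Sum>j=1..N n. of_real (k n j / real j) * (iexp (t / Suc n * real j) - 1) + of_real (l n j / real j) * (iexp (- (t / Suc n) * real j) - 1))"
      by (simp add: sum_distrib_left k_def l_def algebra_simps)
    then show ?thesis unfolding cZ by simp
  qed
  have S_pos: "S n t x = E_lattice n t x" if "0 \<le> x" "x \<le> R" for n t x
  proof -
    have "real (nat \<lfloor>x * Suc n\<rfloor>) \<le> x * Suc n" using lattice_floor(1)[OF that(1), of n] by (simp add: field_simps)
    also have "\<dots> \<le> R * Suc n" using that by (intro mult_right_mono) auto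
    finally have mN: "nat \<lfloor>x * Suc n\<rfloor> \<le> N n" unfolding N_def by linarith
    have iff: "real j / Suc n \<le> x \<longleftrightarrow> j \<le> nat \<lfloor>x * Suc n\<rfloor>" for j
    proof -
      have "real j / Suc n \<le> x \<longleftrightarrow> real j \<le> x * Suc n" by (simp add: field_simps)
      also have "\<dots> \<longleftrightarrow> int j \<le> \<lfloor>x * Suc n\<rfloor>" by (simp add: le_floor_iff)
      also have "\<dots> \<longleftrightarrow> j \<le> nat \<lfloor>x * Suc n\<rfloor>" using that by (subst le_nat_iff) simp_all
      finally show ?thesis .
    qed
    have "S n t x = (\<Sum>j = 1..N n. if j \<in> {1..nat \<lfloor>x * Suc n\<rfloor>} then (iexp (t * (real j / Suc n)) - 1) / of_nat j else 0)"
      unfolding S_def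
    proof (intro sum.cong refl)
      fix j assume "j \<in> {1..N n}"
      then have "0 < real j / Suc n" by simp
      then have "indicator {-R..- (real j / Suc n)} x = (0::real)" using that by (simp add: indicator_def)
      moreover have "indicator {real j / Suc n..R} x = (if j \<in> {1..nat \<lfloor>x * Suc n\<rfloor>} then 1 else (0::real))"
        using that \<open>j \<in> {1..N n}\<close> by (auto simp: indicator_def iff simp del: of_nat_Suc)
      ultimately show "of_real (indicator {real j / Suc n..R} x / j) * (iexp (t * (real j / Suc n)) - 1)
          + of_real (indicator {-R..- (real j / Suc n)} x / j) * (iexp (- t * (real j / Suc n)) - 1)
        = (if j \<in> {1..nat \<lfloor>x * Suc n\<rfloor>} then (iexp (t * (real j / Suc n)) - 1) / of_nat j else 0)"
        by auto
    qed
    also have "\<dots> = (\<Sum>j \<in> {1..N n} \<inter> {1..nat \<lfloor>x * Suc n\<rfloor>}. (iexp (t * (real j / Suc n)) - 1) / of_nat j)"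
      by (rule sum.inter_restrict[symmetric]) simp
    also have "{1..N n} \<inter> {1..nat \<lfloor>x * Suc n\<rfloor>} = {1..nat \<lfloor>x * Suc n\<rfloor>}" using mN by auto
    finally show ?thesis by (simp add: E_lattice_def)
  qed
  \<comment> \<open>Negative \<open>x\<close> are reduced to positive ones by reflecting both
    \<open>t\<close> and \<open>x\<close>.\<close>
  have S_sym: "S n t x = S n (-t) (-x)" for n t x
    unfolding S_def
  proof (intro sum.cong refl)
    fix j
    have "indicator {real j / Suc n..R} x = (indicator {-R..- (real j / Suc n)} (-x) :: real)"
      "indicator {-R..- (real j / Suc n)} x = (indicator {real j / Suc n..R} (-x) :: real)"
      by (auto simp: indicator_def)
    then show "of_real (indicator {real j / Suc n..R} x / j) * (iexp (t * (real j / Suc n)) - 1)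
          + of_real (indicator {-R..- (real j / Suc n)} x / j) * (iexp (- t * (real j / Suc n)) - 1) =
        of_real (indicator {real j / Suc n..R} (-x) / j) * (iexp (-t * (real j / Suc n)) - 1)
          + of_real (indicator {-R..- (real j / Suc n)} (-x) / j) * (iexp (- (-t) * (real j / Suc n)) - 1)"
      by (simp add: add.commute)
  qed
  have S_out: "S n t x = 0" if "x \<notin> {-R..R}" for n t x
    unfolding S_def
  proof (rule sum.neutral, rule ballI)
    fix j assume "j \<in> {1..N n}"
    have "0 \<le> real j / Suc n" by simp
    then have "x \<notin> {real j / Suc n..R}" "x \<notin> {-R..- (real j / Suc n)}"
      using that R unfolding atLeastAtMost_iff by linarith+
    then show "of_real (indicator {real j / Suc n..R} x / j) * (iexp (t * (real j / Suc n)) - 1)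
          + of_real (indicator {-R..- (real j / Suc n)} x / j) * (iexp (- t * (real j / Suc n)) - 1) = 0" by simp
  qed
  have S_lim: "(\<lambda>n. S n t x) \<longlonglongrightarrow> indicator {-R..R} x *\<^sub>R E (t * x)" for t x
  proof (cases "x \<in> {-R..R}")
    case True
    then have "(\<lambda>n. S n t x) \<longlonglongrightarrow> E (t * x)"
      using E_lattice_tendsto[of x t] E_lattice_tendsto[of "-x" "-t"] S_pos[of x] S_pos[of "-x"] S_sym[of _ t x]
      by (cases "0 \<le> x") auto
    then show ?thesis using True by simp
  qed (simp add: S_out)
  have S_le: "cmod (S n t x) \<le> \<bar>t\<bar> * R" for n t x
  proof (cases "x \<in> {-R..R}")
    case True
    have "cmod (S n t x) \<le> \<bar>t\<bar> * \<bar>x\<bar>"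
      using E_lattice_le[of x n t] E_lattice_le[of "-x" n "-t"] True S_pos[of x] S_pos[of "-x"] S_sym[of n t x]
      by (cases "0 \<le> x") auto
    also have "\<dots> \<le> \<bar>t\<bar> * R" using True by (intro mult_left_mono) auto
    finally show ?thesis .
  qed (use R in \<open>simp add: S_out\<close>)
  show ?thesis
  proof (rule unimodal_char_lattice_limit[OF Z])
    show "(\<lambda>n. CLINT u|measure_pmf (Z n). iexp (t / Suc n * real_of_int u)) \<longlonglongrightarrow>
      exp (of_real w * (CLINT x|\<mu>. indicator {-R..R} x *\<^sub>R E (t * x)))" for t
      unfolding ZS
    proof (intro tendsto_intros integral_dominated_convergence[where w="\<lambda>_. \<bar>t\<bar> * R"])
      show "S n t \<in> borel_measurable \<mu>" for n unfolding S_def by measurable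
    qed (auto simp: S_lim S_le)
    have "integrable \<mu> (\<lambda>x. indicator {-R..R} x * ln (1 + \<bar>x\<bar>))"
      by (rule integrable_const_bound[where B="ln (1 + R)"]) (use R in \<open>auto simp: indicator_def abs_le_iff intro!: AE_I2\<close>)
    from isCont_exponent[OF assms(1) _ this]
    show "isCont (\<lambda>t. exp (of_real w * (CLINT x|\<mu>. indicator {-R..R} x *\<^sub>R E (t * x)))) 0"
      by (intro continuous_intros) auto
  qed
qed

text \<open>The logarithmic moment is the majorant that removes the truncation, both for pointwise
  convergence and for continuity at \<open>0\<close>.\<close>

lemma unimodal_char_exponent:
  assumes "real_distribution \<mu>" and int: "integrable \<mu> (\<lambda>x. ln (1 + \<bar>x\<bar>))" and w: "0 \<le> w"
  shows "unimodal_char (\<lambda>t. exp (of_real w * (CLINT x|\<mu>. E (t * x))))"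
proof (rule unimodal_char_limit)
  interpret real_distribution \<mu> by fact
  show "unimodal_char (\<lambda>t. exp (of_real w * (CLINT x|\<mu>. indicator {-real n..real n} x *\<^sub>R E (t * x))))" for n
    by (rule unimodal_char_truncated[OF assms(1) _ w]) simp
  have "isCont (\<lambda>t. CLINT x|\<mu>. E (t * x)) 0"
    using isCont_exponent[OF assms(1), of UNIV] int by simp
  then show "isCont (\<lambda>t. exp (of_real w * (CLINT x|\<mu>. E (t * x)))) 0"
    by (intro continuous_intros)
  show "(\<lambda>n. exp (of_real w * (CLINT x|\<mu>. indicator {-real n..real n} x *\<^sub>R E (t * x))))
      \<longlonglongrightarrow> exp (of_real w * (CLINT x|\<mu>. E (t * x)))" for t
  proof (intro tendsto_intros integral_dominated_convergence[where w="\<lambda>x. 4 * (ln (1 + \<bar>t\<bar>) + ln (1 + \<bar>x\<bar>))"])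
    show "integrable \<mu> (\<lambda>x. 4 * (ln (1 + \<bar>t\<bar>) + ln (1 + \<bar>x\<bar>)))"
      by (intro integrable_mult_right Bochner_Integration.integrable_add int) simp
    show "AE x in \<mu>. (\<lambda>n. indicator {- real n..real n} x *\<^sub>R E (t * x)) \<longlonglongrightarrow> E (t * x)"
    proof (rule AE_I2, rule tendsto_eventually)
      fix x
      obtain N where N: "\<bar>x\<bar> \<le> real N" using real_arch_simple by blast
      show "eventually (\<lambda>n. indicator {- real n..real n} x *\<^sub>R E (t * x) = E (t * x)) sequentially"
        using eventually_ge_at_top[of N]
      proof eventually_elim
        case (elim n)
        then have "x \<in> {- real n..real n}" using N of_nat_mono[OF elim, where 'a=real] unfolding atLeastAtMost_iff by linarith
        then show ?case by simp
      qed
    qed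
    show "AE x in \<mu>. norm (indicator {- real n..real n} x *\<^sub>R E (t * x)) \<le> 4 * (ln (1 + \<bar>t\<bar>) + ln (1 + \<bar>x\<bar>))" for n
    proof (rule AE_I2)
      fix x
      have "cmod (E (t * x)) \<le> 4 * (ln (1 + \<bar>t\<bar>) + ln (1 + \<bar>x\<bar>))"
        by (rule order_trans[OF E_le ln_one_plus_mult_le[OF order_refl]])
      then show "norm (indicator {- real n..real n} x *\<^sub>R E (t * x)) \<le> 4 * (ln (1 + \<bar>t\<bar>) + ln (1 + \<bar>x\<bar>))"
        by (simp add: indicator_def)
    qed
  qed measurable
qed

subsection \<open>Logarithmic moments\<close>

text \<open>On \<open>[1/y, 1]\<close> the oscillation of \<open>1 - cos (r * y)\<close> averages
  out, so the integral is of the order of that of \<open>1 / r\<close>, namely \<open>ln y\<close>.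
  This is the converse of the logarithmic upper bound for \<open>E\<close>.\<close>

lemma cos_integral_ge:
  fixes y :: real
  assumes y: "1 \<le> y"
  shows "ennreal (ln y - 1) \<le> (\<integral>\<^sup>+r. indicator {0<..<1} r * ennreal ((1 - cos (r * y)) / r) \<partial>lborel)"
proof -
  \<comment> \<open>The second summand of \<open>f\<close> is nonpositive and makes the primitive elementary.\<close>
  define f where "f r = (1 - cos (r * y)) / r + (sin (r * y) - 1) / (r\<^sup>2 * y)" for r
  define F where "F r = ln r - sin (r * y) / (r * y) + 1 / (r * y)" for r
  have y0: "0 < y" using y by simp
  have "(LBINT r. indicator {1/y..1} r *\<^sub>R f r) = F 1 - F (1/y)"
  proof (rule integral_FTC_atLeastAtMost)
    show "1 / y \<le> 1" using y by simp
    show "(F has_vector_derivative f r) (at r within {1/y..1})" if "1 / y \<le> r" for r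
    proof -
      have r: "r > 0" using that y0 by (meson divide_pos_pos less_le_trans zero_less_one)
      have "(F has_real_derivative 1 / r - (cos (r * y) * y * (r * y) - sin (r * y) * y) / ((r * y) * (r * y))
          + - y / ((r * y) * (r * y))) (at r)"
        unfolding F_def using r y0 by (auto intro!: derivative_eq_intros)
      also have "1 / r - (cos (r * y) * y * (r * y) - sin (r * y) * y) / ((r * y) * (r * y)) + - y / ((r * y) * (r * y)) = f r"
        unfolding f_def using r y0 by (simp add: field_simps power2_eq_square)
      finally have "(F has_real_derivative f r) (at r)" .
      then show ?thesis
        by (simp add: has_real_derivative_iff_has_vector_derivative has_vector_derivative_at_within)
    qed
    show "continuous_on {1/y..1} f"
      unfolding f_def using y0 by (intro continuous_intros) (auto simp: divide_simps)
  qed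
  \<comment> \<open>\<open>F 1\<close> is nonnegative since \<open>sin y \<le> 1\<close>, and
    \<open>F (1/y) = 1 - ln y - sin 1\<close>; hence the \<open>- 1\<close> in the bound.\<close>
  also have "F 1 - F (1/y) \<ge> ln y - 1"
  proof -
    have "sin 1 \<ge> (0::real)" by (rule sin_ge_zero) (use pi_gt3 in auto)
    moreover have "sin y / y \<le> 1 / y" using y0 by (simp add: divide_right_mono)
    ultimately show ?thesis using y0 by (simp add: F_def ln_div)
  qed
  finally have 1: "ln y - 1 \<le> (LBINT r. indicator {1/y..1} r *\<^sub>R f r)" .
  have int: "integrable lborel (\<lambda>r. indicator {1/y..1} r *\<^sub>R ((1 - cos (r * y)) / r))"
    using y0 by (intro borel_integrable_compact continuous_intros) auto
  have "(LBINT r. indicator {1/y..1} r *\<^sub>R f r) \<le> (LBINT r. indicator {1/y..1} r *\<^sub>R ((1 - cos (r * y)) / r))"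
  proof (rule integral_mono)
    show "integrable lborel (\<lambda>r. indicator {1/y..1} r *\<^sub>R f r)"
      unfolding f_def using y0 by (intro borel_integrable_compact continuous_intros) (auto simp: divide_simps)
    show "indicator {1/y..1} r *\<^sub>R f r \<le> indicator {1/y..1} r *\<^sub>R ((1 - cos (r * y)) / r)" for r
      unfolding f_def using y0 by (intro scaleR_left_mono) (auto intro!: divide_nonpos_nonneg)
  qed (rule int)
  with 1 have "ennreal (ln y - 1) \<le> ennreal (LBINT r. indicator {1/y..1} r *\<^sub>R ((1 - cos (r * y)) / r))"
    by (intro ennreal_leI) linarith
  also have "\<dots> = (\<integral>\<^sup>+r. ennreal (indicator {1/y..1} r *\<^sub>R ((1 - cos (r * y)) / r)) \<partial>lborel)"
  proof (rule nn_integral_eq_integral[symmetric, OF int], rule AE_I2)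
    fix r
    show "0 \<le> indicator {1/y..1} r *\<^sub>R ((1 - cos (r * y)) / r)"
    proof (cases "1 / y \<le> r")
      case True
      then have "0 \<le> r" using y0 by (meson divide_nonneg_pos order_trans zero_le_one)
      then show ?thesis by simp
    qed simp
  qed
  also have "\<dots> \<le> (\<integral>\<^sup>+r. indicator {0<..<1} r * ennreal ((1 - cos (r * y)) / r) \<partial>lborel)"
  proof (rule nn_integral_mono_AE)
    have "AE r in lborel. r \<noteq> (1::real)" by (rule AE_lborel_singleton)
    then show "AE r in lborel. ennreal (indicator {1/y..1} r *\<^sub>R ((1 - cos (r * y)) / r)) \<le> indicator {0<..<1} r * ennreal ((1 - cos (r * y)) / r)"
    proof eventually_elim
      case (elim r)
      show ?case
      proof (cases "1 / y \<le> r \<and> r \<le> 1")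
        case True
        then have "r \<in> {0<..<1}" using y0 elim by (auto intro: less_le_trans[of 0 "1/y" r])
        then show ?thesis using True by simp
      qed (auto simp: indicator_def)
    qed
  qed
  finally show ?thesis .
qed

text \<open>By Tonelli, the integral of \<open>C\<close> over \<open>\<mu>\<close> is the integral
  of \<open>(1 - Re (char \<mu> r)) / r\<close> over the unit interval, which is finite by
  hypothesis; and \<open>C x\<close> grows at least like \<open>ln |x|\<close>.\<close>

lemma log_moment:
  assumes "real_distribution \<mu>" and int: "set_integrable lborel {0<..<1} (\<lambda>r. (1 - char \<mu> r) / of_real r)"
  shows "integrable \<mu> (\<lambda>x. ln (1 + \<bar>x\<bar>))"
proof -
  interpret real_distribution \<mu> by fact
  interpret P: pair_sigma_finite \<mu> lborel by unfold_locales
  define C where "C x = (\<integral>\<^sup>+r. indicator {0<..<1} r * ennreal ((1 - cos (r * x)) / r) \<partial>lborel)" for x :: real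
  have [measurable]: "C \<in> borel_measurable borel" unfolding C_def by measurable
  have re: "(\<integral>\<^sup>+x. ennreal ((1 - cos (r * x)) / r) \<partial>\<mu>) = ennreal ((1 - Re (char \<mu> r)) / r)" if "r > 0" for r
  proof -
    have ii: "integrable \<mu> (\<lambda>x. iexp (r * x))" by (rule integrable_const_bound[where B=1]) auto
    have i: "integrable \<mu> (\<lambda>x. cos (r * x))" by (rule integrable_const_bound[where B=1]) auto
    have "(\<integral>\<^sup>+x. ennreal ((1 - cos (r * x)) / r) \<partial>\<mu>) = ennreal (LINT x|\<mu>. (1 - cos (r * x)) / r)"
      by (rule nn_integral_eq_integral) (use i that in auto)
    also have "(LINT x|\<mu>. (1 - cos (r * x)) / r) = (1 - (LINT x|\<mu>. cos (r * x))) / r"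
      using i prob_space by (simp del: space_eq_univ)
    also have "(LINT x|\<mu>. cos (r * x)) = Re (char \<mu> r)"
      unfolding char_def integral_Re[OF ii, symmetric] by (simp add: exp_Euler cos_of_real sin_of_real flip: of_real_mult)
    finally show ?thesis .
  qed
  have "(\<integral>\<^sup>+x. C x \<partial>\<mu>) = (\<integral>\<^sup>+r. \<integral>\<^sup>+x. indicator {0<..<1} r * ennreal ((1 - cos (r * x)) / r) \<partial>\<mu> \<partial>lborel)"
    unfolding C_def by (rule P.Fubini'[symmetric]) measurable
  also have "\<dots> = (\<integral>\<^sup>+r. indicator {0<..<1} r * ennreal ((1 - Re (char \<mu> r)) / r) \<partial>lborel)"
  proof (rule nn_integral_cong)
    fix r :: real
    show "(\<integral>\<^sup>+x. indicator {0<..<1} r * ennreal ((1 - cos (r * x)) / r) \<partial>\<mu>) = indicator {0<..<1} r * ennreal ((1 - Re (char \<mu> r)) / r)"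
      using re[of r] by (cases "r \<in> {0<..<1}") auto
  qed
  also have "\<dots> \<le> (\<integral>\<^sup>+r. ennreal (norm (indicator {0<..<1} r *\<^sub>R ((1 - char \<mu> r) / of_real r))) \<partial>lborel)"
  proof (rule nn_integral_mono)
    fix r :: real
    show "indicator {0<..<1} r * ennreal ((1 - Re (char \<mu> r)) / r) \<le> ennreal (norm (indicator {0<..<1} r *\<^sub>R ((1 - char \<mu> r) / of_real r)))"
      using complex_Re_le_cmod[of "1 - char \<mu> r"]
      by (auto simp: indicator_def norm_divide intro!: ennreal_leI divide_right_mono)
  qed
  also have "\<dots> < \<infinity>" using int unfolding set_integrable_def integrable_iff_bounded by simp
  finally have Cfin: "(\<integral>\<^sup>+x. C x \<partial>\<mu>) < \<infinity>" .
  show ?thesis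
  proof (rule integrableI_bounded)
    have "ennreal (ln (1 + \<bar>x\<bar>)) \<le> 2 + C x" for x
    proof (cases "\<bar>x\<bar> \<le> 1")
      case True
      have "ln (1 + \<bar>x\<bar>) \<le> \<bar>x\<bar>" by (rule ln_add_one_self_le_self) simp
      then have "ennreal (ln (1 + \<bar>x\<bar>)) \<le> ennreal 2" using True by (intro ennreal_leI) linarith
      also have "\<dots> \<le> 2 + C x" by simp
      finally show ?thesis .
    next
      case False
      have "cos (r * \<bar>x\<bar>) = cos (r * x)" for r by (cases "x \<ge> 0") auto
      then have Cx: "C \<bar>x\<bar> = C x" unfolding C_def by simp
      have "ln (1 + \<bar>x\<bar>) \<le> ln (2 * \<bar>x\<bar>)" using False by simp
      also have "\<dots> = ln 2 + ln \<bar>x\<bar>" using False by (intro ln_mult_pos) auto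
      \<comment> \<open>The constant \<open>2\<close> pays for \<open>ln 2 < 1\<close> and for the
        \<open>- 1\<close> of the cosine bound.\<close>
      also have "\<dots> \<le> 2 + (ln \<bar>x\<bar> - 1)" using ln_2_less_1 by simp
      finally have "ennreal (ln (1 + \<bar>x\<bar>)) \<le> ennreal (2 + (ln \<bar>x\<bar> - 1))" by (rule ennreal_leI)
      also have "\<dots> \<le> ennreal 2 + ennreal (ln \<bar>x\<bar> - 1)"
      proof -
        have "ennreal (2 + (ln \<bar>x\<bar> - 1)) \<le> ennreal (2 + max 0 (ln \<bar>x\<bar> - 1))" by (intro ennreal_leI) simp
        also have "\<dots> = ennreal 2 + ennreal (max 0 (ln \<bar>x\<bar> - 1))" by (rule ennreal_plus) auto
        also have "ennreal (max 0 (ln \<bar>x\<bar> - 1)) = ennreal (ln \<bar>x\<bar> - 1)" by (simp add: max_def ennreal_neg)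
        finally show ?thesis .
      qed
      also have "\<dots> \<le> 2 + C x" using cos_integral_ge[of "\<bar>x\<bar>"] False Cx by (intro add_mono) (auto simp: C_def)
      finally show ?thesis .
    qed
    then have "(\<integral>\<^sup>+x. ennreal (norm (ln (1 + \<bar>x\<bar>))) \<partial>\<mu>) \<le> (\<integral>\<^sup>+x. 2 + C x \<partial>\<mu>)"
      by (intro nn_integral_mono) simp
    also have "\<dots> = 2 + (\<integral>\<^sup>+x. C x \<partial>\<mu>)"
      using emeasure_space_1 by (subst nn_integral_add) (auto simp del: space_eq_univ)
    also have "\<dots> < \<infinity>" using Cfin by (simp add: ennreal_add_less_top)
    finally show "(\<integral>\<^sup>+x. ennreal (norm (ln (1 + \<bar>x\<bar>))) \<partial>\<mu>) < \<infinity>" .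
  qed measurable
qed

text \<open>Fubini, with absolute integrability from the logarithmic moment: the exponent built from
  \<open>E\<close> is recognized as an integral along the ray \<open>r * t\<close>.\<close>

lemma E_integral_eq:
  assumes "real_distribution \<mu>" and int: "integrable \<mu> (\<lambda>x. ln (1 + \<bar>x\<bar>))"
  shows "(CLINT x|\<mu>. E (t * x)) = - (CLBINT r:{0<..<1}. (1 - char \<mu> (r * t)) / of_real r)"
proof -
  interpret real_distribution \<mu> by fact
  interpret P: pair_sigma_finite \<mu> lborel by unfold_locales
  define f where "f = (\<lambda>(x::real, r::real). indicator {0<..<1} r *\<^sub>R ((iexp (r * (t * x)) - 1) / complex_of_real r))"
  have [measurable]: "f \<in> borel_measurable (\<mu> \<Otimes>\<^sub>M lborel)" unfolding f_def by measurable
  have intf: "integrable lborel (\<lambda>r. f (x, r))" for x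
    using E_integrable[of "t * x"] unfolding set_integrable_def f_def by simp
  have "integrable \<mu> (\<lambda>x. LBINT r. norm (f (x, r)))"
  proof (rule Bochner_Integration.integrable_bound)
    show "integrable \<mu> (\<lambda>x. 4 * (ln (1 + \<bar>t\<bar>) + ln (1 + \<bar>x\<bar>)))"
      by (intro integrable_mult_right Bochner_Integration.integrable_add int) simp
    show "AE x in \<mu>. norm (LBINT r. norm (f (x, r))) \<le> norm (4 * (ln (1 + \<bar>t\<bar>) + ln (1 + \<bar>x\<bar>)))"
    proof (rule AE_I2)
      fix x
      have "(LBINT r. norm (f (x, r))) = (LBINT r:{0<..<1}. cmod ((iexp (r * (t * x)) - 1) / of_real r))"
        unfolding f_def set_lebesgue_integral_def by (simp del: of_real_mult)
      also have "\<dots> \<le> 4 * ln (1 + \<bar>t * x\<bar>)" by (rule E_abs_integral_le)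
      finally have "(LBINT r. norm (f (x, r))) \<le> 4 * (ln (1 + \<bar>t\<bar>) + ln (1 + \<bar>x\<bar>))" by (rule order_trans[OF _ ln_one_plus_mult_le[OF order_refl]])
      moreover have "0 \<le> (LBINT r. norm (f (x, r)))" by simp
      ultimately show "norm (LBINT r. norm (f (x, r))) \<le> norm (4 * (ln (1 + \<bar>t\<bar>) + ln (1 + \<bar>x\<bar>)))" by simp
    qed
  qed measurable
  then have intP: "integrable (\<mu> \<Otimes>\<^sub>M lborel) f" by (rule P.Fubini_integrable[rotated]) (use intf in auto)
  have "(CLINT x|\<mu>. E (t * x)) = (CLINT x|\<mu>. CLBINT r. f (x, r))"
    by (simp add: E_def f_def set_lebesgue_integral_def)
  also have "\<dots> = (CLBINT r. (CLINT x|\<mu>. f (x, r)))"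
    using P.Fubini_integral[of "\<lambda>x r. f (x, r)"] intP by simp
  also have "\<dots> = (CLBINT r. indicator {0<..<1} r *\<^sub>R (- ((1 - char \<mu> (r * t)) / of_real r)))"
  proof (intro Bochner_Integration.integral_cong refl)
    fix r :: real
    have ii: "integrable \<mu> (\<lambda>x. iexp (r * (t * x)))" by (rule integrable_const_bound[where B=1]) auto
    have "(CLINT x|\<mu>. (iexp (r * (t * x)) - 1) / complex_of_real r) = ((CLINT x|\<mu>. iexp (r * (t * x))) - 1) / complex_of_real r"
      using ii prob_space by (simp del: space_eq_univ of_real_mult)
    also have "(CLINT x|\<mu>. iexp (r * (t * x))) = char \<mu> (r * t)" unfolding char_def by (simp only: mult.assoc)
    also have "(char \<mu> (r * t) - 1) / complex_of_real r = - ((1 - char \<mu> (r * t)) / of_real r)" by (simp add: diff_divide_distrib)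
    finally show "(CLINT x|\<mu>. f (x, r)) = indicator {0<..<1} r *\<^sub>R (- ((1 - char \<mu> (r * t)) / of_real r))"
      by (simp add: f_def del: of_real_mult)
  qed
  also have "\<dots> = - (CLBINT r:{0<..<1}. (1 - char \<mu> (r * t)) / of_real r)"
    unfolding set_lebesgue_integral_def scaleR_minus_right by (rule Bochner_Integration.integral_minus)
  finally show ?thesis .
qed

text \<open>Integrability at the single argument \<open>t = 1\<close> already yields the logarithmic
  moment, and with it the representation for every \<open>t\<close>.\<close>

lemma unimodal_char_self_decomposable_exponent:
  assumes "real_distribution \<mu>" and int: "set_integrable lborel {0<..<1} (\<lambda>r. (1 - char \<mu> r) / of_real r)" and w: "0 \<le> w"
  shows "unimodal_char (\<lambda>t. exp (- of_real w * (CLBINT r:{0<..<1}. (1 - char \<mu> (r * t)) / of_real r)))"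
  using unimodal_char_exponent[OF assms(1) log_moment[OF assms(1) int] w]
  unfolding E_integral_eq[OF assms(1) log_moment[OF assms(1) int]] by simp

section \<open>Strictly stable laws\<close>

subsection \<open>Closure properties of characteristic functions\<close>

lemma is_char_limit:
  assumes f: "\<And>n. is_char (f n)" and lim: "\<And>t. (\<lambda>n. f n t) \<longlonglongrightarrow> g t" and cont: "isCont g 0"
  shows "is_char g"
proof -
  obtain M where M: "\<And>n. real_distribution (M n)" "\<And>n. f n = char (M n)"
    using f unfolding is_char_def by metis
  show ?thesis
  proof (rule levy_continuity_existence[of M g])
    show "(\<lambda>n. char (M n) t) \<longlonglongrightarrow> g t" for t using lim[of t] by (simp add: M(2))
  qed (use M cont in \<open>auto simp: is_char_def\<close>)
qed

lemma char_distr_pair: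
  assumes M: "real_distribution M" and N: "real_distribution N"
    and h: "(\<lambda>(x, y). h x y) \<in> borel_measurable (borel \<Otimes>\<^sub>M borel)"
  shows "real_distribution (distr (M \<Otimes>\<^sub>M N) borel (\<lambda>(x, y). h x y))"
    and "char (distr (M \<Otimes>\<^sub>M N) borel (\<lambda>(x, y). h x y)) t = (CLINT x|M. CLINT y|N. iexp (t * h x y))"
proof -
  interpret M: real_distribution M by fact
  interpret N: real_distribution N by fact
  interpret P: pair_prob_space M N ..
  have [measurable]: "(\<lambda>(x, y). h x y) \<in> borel_measurable (M \<Otimes>\<^sub>M N)"
    using h by (simp cong: measurable_cong_sets)
  show "real_distribution (distr (M \<Otimes>\<^sub>M N) borel (\<lambda>(x, y). h x y))"
    unfolding real_distribution_def real_distribution_axioms_def by (auto intro!: P.prob_space_distr)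
  have "integrable (M \<Otimes>\<^sub>M N) (\<lambda>(x, y). iexp (t * h x y))"
    by (rule P.integrable_const_bound[where B=1]) (auto simp: split_beta')
  from P.integral_fst'[OF this]
  have "(CLINT x|M. CLINT y|N. iexp (t * h x y)) = (CLINT p|(M \<Otimes>\<^sub>M N). iexp (t * (case p of (x, y) \<Rightarrow> h x y)))"
    by (simp add: split_beta')
  also have "\<dots> = char (distr (M \<Otimes>\<^sub>M N) borel (\<lambda>(x, y). h x y)) t"
    unfolding char_def by (subst integral_distr) auto
  finally show "char (distr (M \<Otimes>\<^sub>M N) borel (\<lambda>(x, y). h x y)) t = (CLINT x|M. CLINT y|N. iexp (t * h x y))" by simp
qed

text \<open>The function of \<open>t\<close> is the characteristic function of \<open>h X Y\<close>
  with \<open>X\<close> and \<open>Y\<close> independent. Sums, scalings and the products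
  \<open>U powr (1 / \<alpha>) * S\<close> are all instances.\<close>

lemma is_char_mixture:
  assumes M: "real_distribution M" and N: "real_distribution N"
    and h: "(\<lambda>(x, y). h x y) \<in> borel_measurable (borel \<Otimes>\<^sub>M borel)"
  shows "is_char (\<lambda>t. CLINT x|M. CLINT y|N. iexp (t * h x y))"
  unfolding is_char_def char_distr_pair(2)[OF assms, symmetric]
  by (intro exI[of _ "distr (M \<Otimes>\<^sub>M N) borel (\<lambda>(x, y). h x y)"] conjI char_distr_pair(1)[OF assms] refl)

lemma is_char_mult:
  assumes "is_char f" "is_char g"
  shows "is_char (\<lambda>t. f t * g t)"
proof -
  obtain M N where M: "real_distribution M" "f = char M" and N: "real_distribution N" "g = char N"
    using assms unfolding is_char_def by blast
  have "(CLINT x|M. CLINT y|N. iexp (t * (x + y))) = f t * g t" for t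
  proof -
    have "(CLINT x|M. CLINT y|N. iexp (t * (x + y))) = (CLINT x|M. CLINT y|N. iexp (t * x) * iexp (t * y))"
      by (simp add: exp_add[symmetric] algebra_simps)
    then show ?thesis unfolding M N char_def by simp
  qed
  then show ?thesis using is_char_mixture[OF M(1) N(1), of "(+)"] by simp
qed

lemma is_char_scale:
  assumes "is_char f"
  shows "is_char (\<lambda>t. f (c * t))"
proof -
  obtain M where M: "real_distribution M" "f = char M" using assms unfolding is_char_def by blast
  interpret real_distribution M by fact
  have "(CLINT x|M. CLINT y|M. iexp (t * (c * x))) = f (c * t)" for t
    using prob_space by (simp add: M(2) char_def mult_ac del: space_eq_univ)
  then show ?thesis using is_char_mixture[OF M(1) M(1), of "\<lambda>x y. c * x"] by simp
qed

lemma is_char_one: "is_char (\<lambda>t. 1)"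
proof -
  have "real_distribution (return borel (0::real))"
    unfolding real_distribution_def real_distribution_axioms_def by (auto intro: prob_space_return)
  moreover have "char (return borel 0) = (\<lambda>t. 1)" unfolding char_def by (simp add: integral_return)
  ultimately show ?thesis unfolding is_char_def by metis
qed

text \<open>A Poisson variable is the lattice variable whose only coefficient is \<open>l\<close> at
  jump size \<open>1\<close>; scaling by \<open>x\<close> sets the jump.\<close>

lemma is_char_poisson:
  assumes "0 \<le> l"
  shows "is_char (\<lambda>t. exp (of_real l * (iexp (t * x) - 1)))"
proof -
  obtain Z :: "int pmf" and m :: int where Z: "\<And>t. (CLINT u|measure_pmf Z. iexp (t * real_of_int u)) =
      exp (\<Sum>j=1..1. of_real ((if j = 1 then l else 0) / real j) * (iexp (t * real j) - 1) + of_real (0 / real j) * (iexp (- t * real j) - 1))"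
  proof (rule two_sided_lattice_law[of "\<lambda>j. if j \<le> 1 then l else 0" 1 "\<lambda>_. 0"])
    fix Z :: "int pmf" and m :: int
    assume *: "\<And>t. (CLINT u|measure_pmf Z. iexp (t * real_of_int u)) =
      exp (\<Sum>j=1..1. of_real ((if j \<le> 1 then l else 0) / real j) * (iexp (t * real j) - 1) + of_real (0 / real j) * (iexp (- t * real j) - 1))"
    show thesis by (rule that[of Z]) (use * in simp)
  qed (use assms in auto)
  define D where "D = distr (measure_pmf Z) borel real_of_int"
  have D: "real_distribution D"
    unfolding D_def real_distribution_def real_distribution_axioms_def by (auto intro!: measure_pmf.prob_space_distr)
  have "char D t = exp (of_real l * (iexp t - 1))" for t
    unfolding char_def D_def using Z[of t] by (subst integral_distr) auto
  then have "char D = (\<lambda>t. exp (of_real l * (iexp t - 1)))" by (rule ext)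
  then have "is_char (\<lambda>t. exp (of_real l * (iexp t - 1)))"
    unfolding is_char_def by (intro exI[of _ D] conjI D) (rule sym)
  from is_char_scale[OF this, of x] show ?thesis by (simp add: mult.commute)
qed

text \<open>The partial sums are exponents of sums of independent scaled Poisson variables.
  Continuity of \<open>\<psi>\<close> at \<open>0\<close> replaces any summability of
  \<open>l\<close> in passing to the limit.\<close>

lemma is_char_compound_poisson:
  fixes l x :: "nat \<Rightarrow> real"
  assumes l: "\<And>j. 0 \<le> l j" and sums: "\<And>t. (\<lambda>j. of_real (l j) * (iexp (t * x j) - 1)) sums \<psi> t" and cont: "isCont \<psi> 0"
  shows "is_char (\<lambda>t. exp (\<psi> t))"
proof (rule is_char_limit)
  show "is_char (\<lambda>t. exp (\<Sum>j<n. of_real (l j) * (iexp (t * x j) - 1)))" for n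
  proof (induction n)
    case (Suc n)
    from is_char_mult[OF this is_char_poisson[OF l, of n "x n"]] show ?case by (simp add: exp_add)
  qed (simp add: is_char_one)
  show "(\<lambda>n. exp (\<Sum>j<n. of_real (l j) * (iexp (t * x j) - 1))) \<longlonglongrightarrow> exp (\<psi> t)" for t
    using sums[of t] unfolding sums_def by (intro tendsto_intros)
  show "isCont (\<lambda>t. exp (\<psi> t)) 0" using cont by (intro continuous_intros)
qed

subsection \<open>The binomial series\<close>

text \<open>The coefficient of \<open>z ^ j\<close> in \<open>(1 - z) powr \<alpha>\<close>.\<close>

definition binom_coeff :: "real \<Rightarrow> nat \<Rightarrow> real" where
  "binom_coeff \<alpha> j = (- 1) ^ j * (\<alpha> gchoose j)"

text \<open>With \<open>(- 1) ^ j\<close> absorbed into the factors, signs can be counted: the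
  factors \<open>i - \<alpha>\<close> are negative only at \<open>i = 0\<close> if
  \<open>0 < \<alpha> < 1\<close>, and only at \<open>i = 0\<close> and \<open>i = 1\<close> if
  \<open>1 < \<alpha> < 2\<close>.\<close>

lemma binom_coeff_prod: "binom_coeff \<alpha> j = (\<Prod>i<j. real i - \<alpha>) / fact j"
proof -
  have "(\<Prod>i<j. real i - \<alpha>) = (\<Prod>i<j. (- 1) * (\<alpha> - real i))" by simp
  also have "\<dots> = (- 1) ^ j * (\<Prod>i<j. \<alpha> - real i)" by (subst prod.distrib) simp
  finally show ?thesis by (simp add: binom_coeff_def gbinomial_prod_rev atLeast0LessThan)
qed

lemma binom_coeff_nonpos:
  assumes "0 < \<alpha>" "\<alpha> < 1" "1 \<le> j"
  shows "binom_coeff \<alpha> j \<le> 0"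
proof -
  obtain p where j: "j = Suc p" using assms by (cases j) auto
  have "0 \<le> (\<Prod>i<p. real (Suc i) - \<alpha>)" using assms by (intro prod_nonneg) auto
  then show ?thesis unfolding binom_coeff_prod j prod.lessThan_Suc_shift using assms
    by (simp add: divide_nonpos_nonneg mult_nonpos_nonneg del: of_nat_Suc)
qed

lemma binom_coeff_nonneg:
  assumes "1 < \<alpha>" "\<alpha> < 2" "j \<noteq> 1"
  shows "0 \<le> binom_coeff \<alpha> j"
proof (cases j)
  case 0
  then show ?thesis by (simp add: binom_coeff_def)
next
  case (Suc p)
  then obtain r where j: "j = Suc (Suc r)" using assms by (cases p) auto
  have p: "0 \<le> (\<Prod>i<r. real (Suc (Suc i)) - \<alpha>)" using assms by (intro prod_nonneg) auto
  have num: "0 \<le> (0 - \<alpha>) * ((1 - \<alpha>) * (\<Prod>i<r. real (Suc (Suc i)) - \<alpha>))"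
    by (intro mult_nonpos_nonpos mult_nonpos_nonneg p) (use assms in auto)
  have eq: "binom_coeff \<alpha> j = (0 - \<alpha>) * ((1 - \<alpha>) * (\<Prod>i<r. real (Suc (Suc i)) - \<alpha>)) / fact j"
    unfolding binom_coeff_prod j prod.lessThan_Suc_shift by simp
  show ?thesis unfolding eq by (rule divide_nonneg_nonneg[OF num]) simp
qed

lemma binom_series:
  fixes z :: complex
  assumes "0 \<le> \<rho>" "\<rho> < 1" "cmod z = 1"
  shows "(\<lambda>j. of_real (binom_coeff \<alpha> j * \<rho> ^ j) * z ^ j) sums ((1 - of_real \<rho> * z) powr of_real \<alpha>)"
proof -
  have "(of_real \<alpha> gchoose j :: complex) = of_real (\<alpha> gchoose j)" for j by (simp add: gbinomial_prod_rev)
  moreover have "(\<lambda>j. (of_real \<alpha> gchoose j) * (- of_real \<rho> * z) ^ j) sums ((1 + (- of_real \<rho> * z)) powr of_real \<alpha>)"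
    by (rule gen_binomial_complex) (use assms in \<open>simp add: norm_mult\<close>)
  moreover have "(- of_real \<rho> * z) ^ j = (- 1) ^ j * (of_real \<rho> ^ j * z ^ j)" for j
    using power_minus[of "of_real \<rho> * z" j] by (simp add: power_mult_distrib)
  ultimately show ?thesis by (simp add: binom_coeff_def mult_ac)
qed

text \<open>Multiplying \<open>(1 - \<rho> z) powr \<alpha>\<close> by \<open>z powi (- d)\<close> moves the one coefficient of the wrong sign to
  the constant term, where it is irrelevant.\<close>

lemma is_char_binomial:
  fixes \<epsilon> \<alpha> c h \<rho> :: real and d :: nat
  assumes \<rho>: "0 \<le> \<rho>" "\<rho> < 1" and c: "0 \<le> c"
    and sign: "\<And>j. j \<noteq> d \<Longrightarrow> 0 \<le> \<epsilon> * binom_coeff \<alpha> j"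
  shows "is_char (\<lambda>t. exp (of_real (\<epsilon> * c) * (iexp (- (real d * h * t)) * (1 - of_real \<rho> * iexp (h * t)) powr of_real \<alpha>
     - (1 - of_real \<rho>) powr of_real \<alpha>)))" (is "is_char (\<lambda>t. exp (?\<psi> t))")
proof (rule is_char_compound_poisson)
  define l where "l j = (if j = d then 0 else \<epsilon> * c * (binom_coeff \<alpha> j * \<rho> ^ j))" for j
  define x where "x j = h * (real j - real d)" for j
  show "0 \<le> l j" for j
    using mult_nonneg_nonneg[OF sign[of j], of "c * \<rho> ^ j"] c \<rho> by (auto simp: l_def mult_ac)
  show "(\<lambda>j. of_real (l j) * (iexp (t * x j) - 1)) sums ?\<psi> t" for t
  proof -
    define b where "b j = complex_of_real (binom_coeff \<alpha> j * \<rho> ^ j)" for j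
    define e where "e = iexp (- (real d * h * t))"
    define z where "z = iexp (h * t)"
    have "(\<lambda>j. b j * z ^ j) sums ((1 - of_real \<rho> * z) powr of_real \<alpha>)"
      unfolding b_def z_def by (rule binom_series) (use \<rho> in auto)
    moreover have "(\<lambda>j. b j * 1 ^ j) sums ((1 - of_real \<rho> * 1) powr of_real \<alpha>)"
      unfolding b_def by (rule binom_series) (use \<rho> in auto)
    ultimately have "(\<lambda>j. of_real (\<epsilon> * c) * (e * (b j * z ^ j) - b j * 1 ^ j)) sums
      (of_real (\<epsilon> * c) * (e * (1 - of_real \<rho> * z) powr of_real \<alpha> - (1 - of_real \<rho> * 1) powr of_real \<alpha>))"
      by (intro sums_mult sums_diff)
    moreover have "of_real (\<epsilon> * c) * (e * (b j * z ^ j) - b j * 1 ^ j) = of_real (l j) * (iexp (t * x j) - 1)" for j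
    proof -
      have "e * z ^ j = iexp (t * x j)"
        unfolding e_def z_def x_def by (simp add: exp_of_nat_mult[symmetric] exp_add[symmetric] algebra_simps)
      then have "of_real (\<epsilon> * c) * (e * (b j * z ^ j) - b j * 1 ^ j) = of_real (\<epsilon> * c) * b j * (iexp (t * x j) - 1)"
        by (simp add: algebra_simps)
      also have "\<dots> = of_real (l j) * (iexp (t * x j) - 1)" by (simp add: l_def b_def x_def)
      finally show ?thesis .
    qed
    ultimately show ?thesis by (simp add: e_def z_def)
  qed
  have "1 - complex_of_real \<rho> * iexp (h * 0) \<notin> \<real>\<^sub>\<le>\<^sub>0" using \<rho> by (simp add: complex_nonpos_Reals_iff)
  then have 1: "isCont (\<lambda>t. (1 - of_real \<rho> * iexp (h * t)) powr of_real \<alpha>) 0"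
    by (rule isCont_powr_complex) (intro continuous_intros)+
  have 2: "isCont (\<lambda>t. iexp (- (real d * h * t))) 0" by (intro continuous_intros)
  have "isCont (\<lambda>t. iexp (- (real d * h * t)) * (1 - of_real \<rho> * iexp (h * t)) powr of_real \<alpha>) 0"
    by (rule isCont_mult[OF 2 1])
  from isCont_diff[OF this continuous_const[of _ "(1 - of_real \<rho>) powr of_real \<alpha>"]]
  show "isCont ?\<psi> 0" by (rule isCont_mult[OF continuous_const])
qed

subsection \<open>Existence\<close>

definition stable_exponent :: "real \<Rightarrow> real \<Rightarrow> real \<Rightarrow> real \<Rightarrow> complex" where
  "stable_exponent \<alpha> \<theta> l t = complex_of_real (l * \<bar>t\<bar> powr \<alpha>) * exp (- (\<i> * complex_of_real (\<theta> * sgn t)))"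

lemma norm_stable_exponent: "0 \<le> l \<Longrightarrow> cmod (stable_exponent \<alpha> \<theta> l t) = l * \<bar>t\<bar> powr \<alpha>"
  by (simp add: stable_exponent_def norm_mult)

lemma isCont_stable_exponent_0:
  assumes "0 < \<alpha>" "0 \<le> l"
  shows "isCont (stable_exponent \<alpha> \<theta> l) 0"
proof -
  have "((\<lambda>t. l * \<bar>t\<bar> powr \<alpha>) \<longlongrightarrow> l * \<bar>0\<bar> powr \<alpha>) (at (0::real))"
    using assms by (intro tendsto_intros) auto
  then have "((\<lambda>t. l * \<bar>t\<bar> powr \<alpha>) \<longlongrightarrow> 0) (at (0::real))" using assms by simp
  then have "(stable_exponent \<alpha> \<theta> l \<longlongrightarrow> 0) (at 0)"
    by (rule Lim_null_comparison[rotated]) (use assms in \<open>simp add: norm_stable_exponent\<close>)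
  then show ?thesis using assms by (simp add: isCont_def stable_exponent_def)
qed

lemma stable_exponent_tendsto:
  assumes "a \<longlonglongrightarrow> \<alpha>" "th \<longlonglongrightarrow> \<theta>"
  shows "(\<lambda>n. stable_exponent (a n) (th n) l t) \<longlonglongrightarrow> stable_exponent \<alpha> \<theta> l t"
proof (cases "t = 0")
  case False
  then show ?thesis unfolding stable_exponent_def using assms by (intro tendsto_intros) auto
qed (simp add: stable_exponent_def)

text \<open>On the principal branch, \<open>Ln (- \<i> * t)\<close> is
  \<open>ln |t| - \<i> * pi / 2 * sgn t\<close> for \<open>t \<noteq> 0\<close>. The power is thus
  an exponent with angle \<open>pi * \<alpha> / 2\<close>, and it is what the binomial sums converge
  to.\<close>

lemma minus_ii_powr: "(- (\<i> * of_real t)) powr of_real \<alpha> = stable_exponent \<alpha> (pi * \<alpha> / 2) 1 t"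
proof (cases "t = 0")
  case False
  have Ln_eq: "Ln (- (\<i> * of_real t)) = of_real (ln \<bar>t\<bar>) - \<i> * of_real (pi / 2 * sgn t)"
  proof (cases "t > 0")
    case True
    have 1: "- (\<i> * of_real t) = of_real t * (- \<i>)" by simp
    have 2: "Ln (of_real t * (- \<i>)) = Ln (of_real t) + Ln (- \<i>)"
      by (rule Ln_times_of_real) (use True in simp_all)
    have 3: "Ln (of_real t) = of_real (ln t)" using True by (rule Ln_of_real)
    have 4: "Ln (- \<i>) = - (\<i> * of_real (pi / 2 * 1))" by simp
    show ?thesis unfolding 1 2 3 4 abs_of_pos[OF True] sgn_pos[OF True] by (rule diff_conv_add_uminus[symmetric])
  next
    case neg: False
    then have t: "t < 0" using False by simp
    have 1: "- (\<i> * of_real t) = of_real (- t) * \<i>" by simp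
    have 2: "Ln (of_real (- t) * \<i>) = Ln (of_real (- t)) + Ln \<i>"
      by (rule Ln_times_of_real) (use t in simp_all)
    have 3: "Ln (of_real (- t)) = of_real (ln (- t))" by (rule Ln_of_real) (use t in simp)
    have 4: "Ln \<i> = - (\<i> * of_real (pi / 2 * (- 1)))" by simp
    show ?thesis unfolding 1 2 3 4 abs_of_neg[OF t] sgn_neg[OF t] by (rule diff_conv_add_uminus[symmetric])
  qed
  have "of_real \<alpha> * Ln (- (\<i> * of_real t)) = of_real (\<alpha> * ln \<bar>t\<bar>) + (- (\<i> * of_real (pi * \<alpha> / 2 * sgn t)))"
    unfolding Ln_eq of_real_mult of_real_divide by algebra
  moreover have "(- (\<i> * of_real t)) powr of_real \<alpha> = exp (of_real \<alpha> * Ln (- (\<i> * of_real t)))"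
    using False by (simp only: powr_def mult_eq_0_iff neg_equal_0_iff_equal complex_i_not_zero of_real_eq_0_iff simp_thms if_False)
  ultimately have "(- (\<i> * of_real t)) powr of_real \<alpha> = of_real (exp (\<alpha> * ln \<bar>t\<bar>)) * exp (- (\<i> * of_real (pi * \<alpha> / 2 * sgn t)))"
    by (simp only: exp_add exp_of_real)
  also have "exp (\<alpha> * ln \<bar>t\<bar>) = 1 * \<bar>t\<bar> powr \<alpha>" using False by (simp add: powr_def)
  also have "of_real \<dots> * exp (- (\<i> * of_real (pi * \<alpha> / 2 * sgn t))) = stable_exponent \<alpha> (pi * \<alpha> / 2) 1 t"
    unfolding stable_exponent_def ..
  finally show ?thesis .
qed (simp add: stable_exponent_def)

text \<open>As \<open>h\<close> tends to \<open>0\<close>,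
  \<open>(1 - \<rho> * iexp (h * t)) / h\<close> tends to \<open>- \<i> * t\<close>, so
  \<open>h powr (- \<alpha>)\<close> times the binomial series tends to the stable exponent. The
  sign \<open>\<epsilon>\<close> and the exceptional index \<open>d\<close> are left open to treat
  \<open>\<alpha>\<close> below and above \<open>1\<close> together.\<close>

lemma is_char_one_sided_stable:
  fixes \<epsilon> \<alpha> l :: real and d :: nat
  assumes \<alpha>: "0 < \<alpha>" and l: "0 \<le> l"
    and sign: "\<And>j. j \<noteq> d \<Longrightarrow> 0 \<le> \<epsilon> * binom_coeff \<alpha> j"
  shows "is_char (\<lambda>t. exp (of_real \<epsilon> * stable_exponent \<alpha> (pi * \<alpha> / 2) l t))"
proof (rule is_char_limit)
  define h where "h n = 1 / real (Suc n)" for n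
  \<comment> \<open>\<open>\<rho> < 1\<close> makes the series converge absolutely. The gap
    \<open>1 - \<rho> = h\<^sup>2\<close> is of smaller order than \<open>h\<close>, so it disturbs
    neither the limit of \<open>w\<close> nor, after scaling by \<open>h powr (- \<alpha>)\<close>,
    the constant term.\<close>
  define \<rho> where "\<rho> n = 1 - (h n)\<^sup>2" for n
  have h: "0 < h n" "h n \<le> 1" for n by (auto simp: h_def)
  have \<rho>: "0 \<le> \<rho> n" "\<rho> n < 1" for n using h[of n] by (auto simp: \<rho>_def abs_square_le_1)
  define \<psi> where "\<psi> n t = of_real (\<epsilon> * (l * h n powr (- \<alpha>))) * (iexp (- (real d * h n * t)) * (1 - of_real (\<rho> n) * iexp (h n * t)) powr of_real \<alpha>
     - (1 - of_real (\<rho> n)) powr of_real \<alpha>)" for n t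
  show "is_char (\<lambda>t. exp (\<psi> n t))" for n
    unfolding \<psi>_def by (rule is_char_binomial[OF \<rho> _ sign]) (use l in auto)
  show "isCont (\<lambda>t. exp (of_real \<epsilon> * stable_exponent \<alpha> (pi * \<alpha> / 2) l t)) 0"
    using isCont_stable_exponent_0[OF \<alpha> l] by (intro continuous_intros)
  have h0: "h \<longlonglongrightarrow> 0" using LIMSEQ_inverse_real_of_nat by (simp add: h_def[abs_def] inverse_eq_divide)
  show "(\<lambda>n. exp (\<psi> n t)) \<longlonglongrightarrow> exp (of_real \<epsilon> * stable_exponent \<alpha> (pi * \<alpha> / 2) l t)" for t
  proof (cases "t = 0")
    case True
    then show ?thesis by (simp add: \<psi>_def stable_exponent_def)
  next
    case t: False
    define w where "w n = (1 - of_real (\<rho> n) * iexp (h n * t)) / of_real (h n)" for n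
    define u where "u n = \<i> * of_real (h n * t)" for n
    have w: "w \<longlonglongrightarrow> - (\<i> * of_real t)"
    proof -
      have "u \<longlonglongrightarrow> \<i> * of_real (0 * t)" unfolding u_def by (intro tendsto_intros h0)
      moreover have unz: "u n \<noteq> 0" for n using t h[of n] by (simp add: u_def)
      ultimately have "filterlim u (at 0) sequentially" by (auto simp: filterlim_at)
      from filterlim_compose[OF lim_exp_minus_1 this]
      have q: "(\<lambda>n. (exp (u n) - 1) / u n) \<longlonglongrightarrow> 1" .
      have "(\<lambda>n. - ((exp (u n) - 1) / u n) * (\<i> * of_real t) + of_real (h n) * iexp (h n * t)) \<longlonglongrightarrow> - 1 * (\<i> * of_real t) + of_real 0 * iexp (0 * t)"
        by (intro tendsto_intros q h0)
      moreover have "- ((exp (u n) - 1) / u n) * (\<i> * of_real t) + of_real (h n) * iexp (h n * t) = w n" for n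
      proof -
        have e: "iexp (h n * t) = exp (u n)" by (simp add: u_def)
        have "(\<i> * of_real t) / u n = 1 / of_real (h n)" using t h[of n] by (simp add: u_def)
        have "- ((exp (u n) - 1) / u n) * (\<i> * of_real t) = (1 - exp (u n)) / of_real (h n)"
        proof -
          have "- ((e - 1) / v) * x = (1 - e) * (x / v)" for e v x :: complex
            by (cases "v = 0") (auto simp: field_simps)
          from this[of "exp (u n)" "u n" "\<i> * of_real t"] show ?thesis
            unfolding \<open>(\<i> * of_real t) / u n = 1 / of_real (h n)\<close> by simp
        qed
        then show ?thesis unfolding w_def e \<rho>_def using h[of n] by (simp add: field_simps power2_eq_square)
      qed
      ultimately show ?thesis by simp
    qed
    have np: "- (\<i> * of_real t) \<notin> \<real>\<^sub>\<le>\<^sub>0" using t by (simp add: complex_nonpos_Reals_iff)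
    have powh: "of_real (h n powr (- \<alpha>)) * (of_real (h n) * v) powr of_real \<alpha> = v powr of_real \<alpha>" if "v \<noteq> 0" for n and v :: complex
    proof -
      have L: "Ln (of_real (h n) * v) = of_real (ln (h n)) + Ln v"
        using Ln_times_of_real[OF h(1) that, of n] Ln_of_real[OF h(1), of n] by simp
      have "(of_real (h n) * v) powr of_real \<alpha> = exp (of_real \<alpha> * Ln (of_real (h n) * v))"
        using that h(1)[of n] by (simp add: powr_def)
      also have "\<dots> = exp (of_real (\<alpha> * ln (h n)) + of_real \<alpha> * Ln v)"
        unfolding L by (simp add: distrib_left)
      also have "\<dots> = of_real (h n powr \<alpha>) * v powr of_real \<alpha>"
        unfolding exp_add exp_of_real using that h[of n] by (simp add: powr_def)
      finally have "of_real (h n powr (- \<alpha>)) * (of_real (h n) * v) powr of_real \<alpha> = of_real (h n powr (- \<alpha>) * h n powr \<alpha>) * v powr of_real \<alpha>"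
        by simp
      also have "h n powr (- \<alpha>) * h n powr \<alpha> = 1" using h[of n] by (simp add: powr_add[symmetric])
      finally show ?thesis by simp
    qed
    have "\<psi> n t = of_real (\<epsilon> * l) * (iexp (- (real d * h n * t)) * w n powr of_real \<alpha> - of_real (h n) powr of_real \<alpha>)" for n
    proof -
      have a: "1 - of_real (\<rho> n) * iexp (h n * t) = of_real (h n) * w n" using h[of n] by (simp add: w_def)
      have w0: "w n \<noteq> 0"
      proof
        assume "w n = 0"
        then have "of_real (\<rho> n) * iexp (h n * t) = 1" using h[of n] by (simp add: w_def)
        then have "cmod (of_real (\<rho> n) * iexp (h n * t)) = 1" by (simp only: norm_one)
        then show False using \<rho>[of n] by (simp add: norm_mult)
      qed
      have b: "1 - complex_of_real (\<rho> n) = of_real (h n) * of_real (h n)" by (simp add: \<rho>_def power2_eq_square)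
      have h0: "complex_of_real (h n) \<noteq> 0" using h(1)[of n] by simp
      have distr: "of_real (\<epsilon> * (l * c)) * (e * A - B) = of_real (\<epsilon> * l) * (e * (of_real c * A) - of_real c * B)" for c and e A B :: complex
        by (simp add: algebra_simps)
      show ?thesis unfolding \<psi>_def a b distr powh[OF w0] powh[OF h0] ..
    qed
    moreover have "(\<lambda>n. of_real (\<epsilon> * l) * (iexp (- (real d * h n * t)) * w n powr of_real \<alpha> - of_real (h n) powr of_real \<alpha>)) \<longlonglongrightarrow>
       of_real (\<epsilon> * l) * (iexp (- (real d * 0 * t)) * (- (\<i> * of_real t)) powr of_real \<alpha> - of_real 0 powr of_real \<alpha>)"
      using \<alpha> np by (intro tendsto_intros h0 w) auto
    ultimately have "(\<lambda>n. \<psi> n t) \<longlonglongrightarrow> of_real \<epsilon> * stable_exponent \<alpha> (pi * \<alpha> / 2) l t"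
      unfolding minus_ii_powr by (simp add: stable_exponent_def mult_ac)
    then show ?thesis by (intro tendsto_intros)
  qed
qed

lemma stable_exponent_minus: "stable_exponent \<alpha> \<theta> l (- t) = stable_exponent \<alpha> (- \<theta>) l t"
  by (simp add: stable_exponent_def sgn_minus)

text \<open>For \<open>s = 1\<close> and \<open>s = -1\<close>,
  \<open>exp (- \<i> * \<theta> * s)\<close> is a combination of the same expressions at the angles
  \<open>\<beta>\<close> and \<open>- \<beta>\<close>. The weights are nonnegative when
  \<open>|\<theta>| \<le> \<beta>\<close>, so a general stable law is a convolution of two extremal
  ones.\<close>

lemma stable_exponent_combination:
  assumes \<beta>: "0 < \<beta>" "\<beta> < pi / 2"
  shows "stable_exponent \<alpha> \<theta> l t = stable_exponent \<alpha> \<beta> (l * sin (\<beta> + \<theta>) / sin (2 * \<beta>)) t + stable_exponent \<alpha> (- \<beta>) (l * sin (\<beta> - \<theta>) / sin (2 * \<beta>)) t"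
proof -
  have s2: "sin (2 * \<beta>) > 0" using \<beta> by (intro sin_gt_zero) auto
  have c: "cos \<beta> \<noteq> 0" "sin \<beta> \<noteq> 0" using s2 by (auto simp: sin_double)
  have key: "of_real (sin (2 * \<beta>)) * exp (- (\<i> * of_real (\<theta> * s))) = of_real (sin (\<beta> + \<theta>)) * exp (- (\<i> * of_real (\<beta> * s))) + of_real (sin (\<beta> - \<theta>)) * exp (- (\<i> * of_real (- \<beta> * s)))"
    if "s = 1 \<or> s = -1" for s
    unfolding sin_double using that
    by (intro complex_eqI) (auto simp: Re_exp Im_exp sin_add sin_diff algebra_simps)
  show ?thesis
  proof (cases "t = 0")
    case False
    then have s: "sgn t = 1 \<or> sgn t = -1" by (auto simp: sgn_if)
    define m where "m = complex_of_real (l * \<bar>t\<bar> powr \<alpha> / sin (2 * \<beta>))"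
    have "stable_exponent \<alpha> \<theta> l t = m * (of_real (sin (2 * \<beta>)) * exp (- (\<i> * of_real (\<theta> * sgn t))))"
      using s2 by (simp add: stable_exponent_def m_def)
    also have "\<dots> = stable_exponent \<alpha> \<beta> (l * sin (\<beta> + \<theta>) / sin (2 * \<beta>)) t + stable_exponent \<alpha> (- \<beta>) (l * sin (\<beta> - \<theta>) / sin (2 * \<beta>)) t"
      unfolding key[OF s] by (simp add: stable_exponent_def m_def algebra_simps)
    finally show ?thesis .
  qed (simp add: stable_exponent_def)
qed

lemma is_char_stable_nondegenerate:
  assumes \<alpha>: "0 < \<alpha>" "\<alpha> < 2" "\<alpha> \<noteq> 1" and l: "0 \<le> l" and \<theta>: "\<bar>\<theta>\<bar> \<le> min (pi * \<alpha> / 2) (pi - pi * \<alpha> / 2)"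
  shows "is_char (\<lambda>t. exp (- stable_exponent \<alpha> \<theta> l t))"
proof -
  define \<beta> where "\<beta> = min (pi * \<alpha> / 2) (pi - pi * \<alpha> / 2)"
  have \<beta>: "0 < \<beta>" "\<beta> < pi / 2" using \<alpha> by (auto simp: \<beta>_def min_def)
  have pos: "is_char (\<lambda>t. exp (- stable_exponent \<alpha> \<beta> l t)) \<and> is_char (\<lambda>t. exp (- stable_exponent \<alpha> (- \<beta>) l t))" if "0 \<le> l" for l
  proof (cases "\<alpha> < 1")
    case True
    then have b: "\<beta> = pi * \<alpha> / 2" by (simp add: \<beta>_def min_def)
    have "is_char (\<lambda>t. exp (of_real (- 1) * stable_exponent \<alpha> (pi * \<alpha> / 2) l t))"
      by (rule is_char_one_sided_stable[where d=0, OF \<alpha>(1) that]) (use binom_coeff_nonpos \<alpha> True in auto)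
    then have 1: "is_char (\<lambda>t. exp (- stable_exponent \<alpha> \<beta> l t))" by (simp add: b)
    from is_char_scale[OF 1, of "-1"] 1 show ?thesis by (simp add: stable_exponent_minus)
  next
    case False
    then have b: "\<beta> = pi - pi * \<alpha> / 2" by (simp add: \<beta>_def min_def field_simps)
    have "is_char (\<lambda>t. exp (of_real 1 * stable_exponent \<alpha> (pi * \<alpha> / 2) l t))"
      by (rule is_char_one_sided_stable[where d=1, OF \<alpha>(1) that]) (use binom_coeff_nonneg \<alpha> False in auto)
    \<comment> \<open>The angles \<open>pi * \<alpha> / 2\<close> and \<open>- \<beta>\<close>
      differ by \<open>pi\<close>; this half turn turns the positive sign
      \<open>\<epsilon> = 1\<close> into the required negative one.\<close>
    moreover have "stable_exponent \<alpha> (pi * \<alpha> / 2) l t = - stable_exponent \<alpha> (- \<beta>) l t" for t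
    proof (cases "t = 0")
      case False
      have "exp (- (\<i> * of_real (pi * \<alpha> / 2 * sgn t))) = - exp (- (\<i> * of_real (- \<beta> * sgn t)))"
      proof (rule complex_eqI)
        have s: "sgn t = 1 \<or> sgn t = -1" using False by (auto simp: sgn_if)
        show "Re (exp (- (\<i> * of_real (pi * \<alpha> / 2 * sgn t)))) = Re (- exp (- (\<i> * of_real (- \<beta> * sgn t))))"
          using s by (auto simp: Re_exp b)
        show "Im (exp (- (\<i> * of_real (pi * \<alpha> / 2 * sgn t)))) = Im (- exp (- (\<i> * of_real (- \<beta> * sgn t))))"
          using s by (auto simp: Im_exp b)
      qed
      then show ?thesis by (simp add: stable_exponent_def)
    qed (simp add: stable_exponent_def)
    ultimately have 1: "is_char (\<lambda>t. exp (- stable_exponent \<alpha> (- \<beta>) l t))" by simp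
    from is_char_scale[OF 1, of "-1"] 1 show ?thesis by (simp add: stable_exponent_minus)
  qed
  have s: "sin (2 * \<beta>) > 0" using \<beta> by (intro sin_gt_zero) auto
  have "\<bar>\<theta>\<bar> \<le> \<beta>" using \<theta> by (simp add: \<beta>_def)
  then have "sin (\<beta> + \<theta>) \<ge> 0" "sin (\<beta> - \<theta>) \<ge> 0" using \<beta> by (auto intro!: sin_ge_zero simp: abs_le_iff)
  then have "is_char (\<lambda>t. exp (- stable_exponent \<alpha> \<beta> (l * sin (\<beta> + \<theta>) / sin (2 * \<beta>)) t) * exp (- stable_exponent \<alpha> (- \<beta>) (l * sin (\<beta> - \<theta>) / sin (2 * \<beta>)) t))"
    by (intro is_char_mult pos[THEN conjunct1] pos[THEN conjunct2]) (use l s in auto)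
  then show ?thesis
    unfolding stable_exponent_combination[OF \<beta>, of \<alpha> \<theta> l] by (simp add: exp_add[symmetric])
qed

text \<open>For \<open>\<alpha> = 1\<close>, shrinking \<open>\<alpha>\<close> and
  \<open>\<theta>\<close> by a common factor below \<open>1\<close> preserves
  \<open>|\<theta>| \<le> pi * \<alpha> / 2\<close>, which is the binding constraint below
  \<open>1\<close>. For \<open>\<alpha> = 2\<close> the angle is \<open>0\<close> and stays
  so.\<close>

lemma stable_parameter_approximation:
  assumes \<alpha>: "0 < \<alpha>" "\<alpha> \<le> 2" and \<theta>: "\<bar>\<theta>\<bar> \<le> min (pi * \<alpha> / 2) (pi - pi * \<alpha> / 2)"
  obtains a th where "a \<longlonglongrightarrow> \<alpha>" "th \<longlonglongrightarrow> \<theta>"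
    "\<And>n. 0 < a n" "\<And>n. a n < 2" "\<And>n. a n \<noteq> 1" "\<And>n. \<bar>th n\<bar> \<le> min (pi * a n / 2) (pi - pi * a n / 2)"
proof (cases "\<alpha> = 1 \<or> \<alpha> = 2")
  case True
  \<comment> \<open>Starting at \<open>n + 3\<close> gives \<open>\<delta> n \<ge> 2 / 3\<close>, so
    that \<open>2 * \<delta> n\<close> exceeds \<open>1\<close>; with \<open>n + 2\<close> it would
    equal \<open>1\<close> at \<open>n = 0\<close>.\<close>
  define \<delta> where "\<delta> n = 1 - 1 / real (n + 3)" for n
  have \<delta>0: "2 / 3 \<le> \<delta> n" "\<delta> n < 1" for n by (auto simp: \<delta>_def field_simps)
  have "(\<lambda>n. 1 / real (n + 3)) \<longlonglongrightarrow> 0"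
    using LIMSEQ_ignore_initial_segment[OF lim_1_over_n, of 3] by simp
  then have \<delta>: "\<delta> \<longlonglongrightarrow> 1" unfolding \<delta>_def using tendsto_diff[OF tendsto_const] by fastforce
  show thesis
  proof (rule that[of "\<lambda>n. \<alpha> * \<delta> n" "\<lambda>n. \<theta> * \<delta> n"])
    show "(\<lambda>n. \<alpha> * \<delta> n) \<longlonglongrightarrow> \<alpha>" "(\<lambda>n. \<theta> * \<delta> n) \<longlonglongrightarrow> \<theta>"
      using tendsto_mult[OF tendsto_const \<delta>] by fastforce+
    fix n
    show "0 < \<alpha> * \<delta> n" "\<alpha> * \<delta> n < 2" "\<alpha> * \<delta> n \<noteq> 1" using True \<delta>0[of n] by auto
    show "\<bar>\<theta> * \<delta> n\<bar> \<le> min (pi * (\<alpha> * \<delta> n) / 2) (pi - pi * (\<alpha> * \<delta> n) / 2)"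
    proof (cases "\<alpha> = 1")
      case True
      have "\<bar>\<theta> * \<delta> n\<bar> = \<bar>\<theta>\<bar> * \<delta> n" using \<delta>0[of n] by (simp add: abs_mult)
      also have "\<dots> \<le> pi / 2 * \<delta> n" using \<theta> True \<delta>0[of n] by (intro mult_right_mono) auto
      finally have 1: "\<bar>\<theta> * \<delta> n\<bar> \<le> pi * (\<alpha> * \<delta> n) / 2" using True by simp
      have "pi * \<delta> n \<le> pi * 1" using \<delta>0[of n] by (intro mult_left_mono) auto
      then show ?thesis using 1 True by simp
    next
      case False
      then have "\<alpha> = 2" "\<theta> = 0" using True \<theta> by auto
      then show ?thesis using \<delta>0[of n] by simp
    qed
  qed
qed (use assms that[of "\<lambda>_. \<alpha>" "\<lambda>_. \<theta>"] in auto)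

lemma is_char_stable:
  assumes \<alpha>: "0 < \<alpha>" "\<alpha> \<le> 2" and l: "0 \<le> l" and \<theta>: "\<bar>\<theta>\<bar> \<le> min (pi * \<alpha> / 2) (pi - pi * \<alpha> / 2)"
  shows "is_char (\<lambda>t. exp (- stable_exponent \<alpha> \<theta> l t))"
proof -
  from stable_parameter_approximation[OF \<alpha> \<theta>]
  obtain a th where a: "a \<longlonglongrightarrow> \<alpha>" "th \<longlonglongrightarrow> \<theta>"
    and p: "\<And>n. 0 < a n" "\<And>n. a n < 2" "\<And>n. a n \<noteq> 1" "\<And>n. \<bar>th n\<bar> \<le> min (pi * a n / 2) (pi - pi * a n / 2)"
    by blast
  show ?thesis
  proof (rule is_char_limit)
    show "is_char (\<lambda>t. exp (- stable_exponent (a n) (th n) l t))" for n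
      by (rule is_char_stable_nondegenerate[OF p(1-3) l p(4)])
    show "(\<lambda>n. exp (- stable_exponent (a n) (th n) l t)) \<longlonglongrightarrow> exp (- stable_exponent \<alpha> \<theta> l t)" for t
      by (intro tendsto_intros stable_exponent_tendsto a)
    show "isCont (\<lambda>t. exp (- stable_exponent \<alpha> \<theta> l t)) 0"
      by (intro continuous_intros isCont_stable_exponent_0 \<alpha> l)
  qed
qed

text \<open>The two upper bounds for \<open>|\<theta>|\<close> add up to \<open>pi\<close>, so the
  angle is at most \<open>pi / 2\<close>.\<close>

lemma Re_stable_exponent:
  assumes l: "0 \<le> l" and \<theta>: "\<bar>\<theta>\<bar> \<le> min (pi * \<alpha> / 2) (pi - pi * \<alpha> / 2)"
  shows "0 \<le> Re (stable_exponent \<alpha> \<theta> l t)"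
proof -
  have "cos (\<theta> * sgn t) = cos \<bar>\<theta> * sgn t\<bar>" by simp
  also have "0 \<le> cos \<bar>\<theta> * sgn t\<bar>"
  proof (rule cos_ge_zero)
    have "\<bar>\<theta> * sgn t\<bar> \<le> \<bar>\<theta>\<bar>" by (simp add: abs_mult sgn_if)
    moreover have "\<bar>\<theta>\<bar> \<le> pi * \<alpha> / 2" "\<bar>\<theta>\<bar> \<le> pi - pi * \<alpha> / 2" using \<theta> by auto
    ultimately show "\<bar>\<theta> * sgn t\<bar> \<le> pi / 2" by linarith
    have "0 \<le> pi / 2" by simp
    then show "- (pi / 2) \<le> \<bar>\<theta> * sgn t\<bar>" by linarith
  qed
  finally show ?thesis using l by (simp add: stable_exponent_def Re_exp)
qed

text \<open>If \<open>\<phi>\<close> is the Laplace transform of \<open>U\<close> and \<open>S\<close> is strictly stable, this is the law of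
  \<open>U powr (1 / \<alpha>) * S\<close> with \<open>U\<close> and \<open>S\<close> independent.\<close>

lemma is_char_subordination:
  assumes \<phi>: "is_laplace_transform \<phi>"
    and \<alpha>: "0 < \<alpha>" "\<alpha> \<le> 2" and l: "0 \<le> l" and \<theta>: "\<bar>\<theta>\<bar> \<le> min (pi * \<alpha> / 2) (pi - pi * \<alpha> / 2)"
  shows "is_char (\<lambda>t. \<phi> (stable_exponent \<alpha> \<theta> l t))"
proof -
  obtain M where M: "real_distribution M" and pos: "AE u in M. 0 \<le> u"
    and \<phi>M: "\<And>s. 0 \<le> Re s \<Longrightarrow> \<phi> s = laplace_transform M s"
    using \<phi> unfolding is_laplace_transform_def by blast
  obtain S where S: "real_distribution S" and cS: "(\<lambda>t. exp (- stable_exponent \<alpha> \<theta> l t)) = char S"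
    using is_char_stable[OF \<alpha> l \<theta>] unfolding is_char_def by blast
  interpret M: real_distribution M by fact
  interpret S: real_distribution S by fact
  have "\<phi> (stable_exponent \<alpha> \<theta> l t) = (CLINT u|M. CLINT x|S. iexp (t * (u powr (1 / \<alpha>) * x)))" for t
  proof -
    have "\<phi> (stable_exponent \<alpha> \<theta> l t) = (CLINT u|M. exp (- (stable_exponent \<alpha> \<theta> l t * of_real u)))"
      unfolding laplace_transform_def[symmetric] by (rule \<phi>M[OF Re_stable_exponent[OF l \<theta>]])
    also have "\<dots> = (CLINT u|M. char S (u powr (1 / \<alpha>) * t))"
    proof (rule integral_cong_AE)
      show "AE u in M. exp (- (stable_exponent \<alpha> \<theta> l t * of_real u)) = char S (u powr (1 / \<alpha>) * t)"
        using pos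
      proof eventually_elim
        case (elim u)
        show ?case
        proof (cases "u = 0")
          case False
          then have u: "u > 0" using elim by simp
          \<comment> \<open>Strict stability: scaling the argument by
            \<open>u powr (1 / \<alpha>)\<close> multiplies the exponent by
            \<open>u\<close>.\<close>
          have "stable_exponent \<alpha> \<theta> l (u powr (1 / \<alpha>) * t) = stable_exponent \<alpha> \<theta> l t * of_real u"
            using u \<alpha> by (simp add: stable_exponent_def abs_mult powr_mult powr_powr sgn_mult)
          then show ?thesis unfolding cS[symmetric] by simp
        qed (simp add: S.char_zero)
      qed
    qed measurable
    also have "\<dots> = (CLINT u|M. CLINT x|S. iexp (t * (u powr (1 / \<alpha>) * x)))"
      unfolding char_def by (simp add: mult_ac)
    finally show ?thesis .
  qed
  then show ?thesis using is_char_mixture[OF M S, of "\<lambda>u x. u powr (1 / \<alpha>) * x"] by simp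
qed

section \<open>Laplace transforms\<close>

locale nonneg_distribution = real_distribution +
  assumes nonneg: "AE u in M. 0 \<le> u"
begin

abbreviation P :: "complex \<Rightarrow> complex" where "P \<equiv> laplace_transform M"

lemma integrable_exp: "0 \<le> Re s \<Longrightarrow> integrable M (\<lambda>u. exp (- (s * complex_of_real u)))"
proof (rule integrable_const_bound[where B=1])
  assume s: "0 \<le> Re s"
  show "AE u in M. norm (exp (- (s * complex_of_real u))) \<le> 1"
    using nonneg by eventually_elim (use s in simp)
qed simp

lemma P_0: "P 0 = 1"
  unfolding laplace_transform_def using prob_space by (simp del: space_eq_univ)

lemma P_tendsto:
  assumes s: "s \<longlonglongrightarrow> z" "\<And>n. 0 \<le> Re (s n)"
  shows "(\<lambda>n. P (s n)) \<longlonglongrightarrow> P z"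
  unfolding laplace_transform_def
proof (rule integral_dominated_convergence[where w="\<lambda>_. 1"])
  show "AE u in M. (\<lambda>n. exp (- (s n * complex_of_real u))) \<longlonglongrightarrow> exp (- (z * complex_of_real u))"
    by (intro AE_I2 tendsto_intros s)
  show "AE u in M. norm (exp (- (s n * complex_of_real u))) \<le> 1" for n
    using nonneg by eventually_elim (use s(2)[of n] in simp)
qed auto

text \<open>The derivative is bounded by \<open>u * exp (- \<sigma> * u) \<le> 1 / \<sigma>\<close>,
  uniformly in \<open>u\<close>. Difference quotients of the transform are thereby dominated without
  any moment of the distribution.\<close>

lemma exp_diff_quotient_bound:
  assumes "0 < \<sigma>" "0 \<le> u" "\<sigma> \<le> Re x" "\<sigma> \<le> Re y"
  shows "cmod (exp (- (x * complex_of_real u)) - exp (- (y * complex_of_real u))) \<le> 1 / \<sigma> * cmod (x - y)"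
proof (rule field_differentiable_bound[where S="{z. \<sigma> \<le> Re z}"])
  show "convex {z. \<sigma> \<le> Re z}" by (rule convex_halfspace_Re_ge)
  show "((\<lambda>z. exp (- (z * complex_of_real u))) has_field_derivative (- of_real u * exp (- (z * complex_of_real u)))) (at z within {z. \<sigma> \<le> Re z})" for z
    by (auto intro!: derivative_eq_intros)
  fix z assume z: "z \<in> {z. \<sigma> \<le> Re z}"
  have "cmod (- of_real u * exp (- (z * complex_of_real u))) = u * exp (- (Re z * u))" using assms by (simp add: norm_mult)
  also have "\<dots> \<le> u * exp (- (\<sigma> * u))" using z assms by (intro mult_left_mono) (auto intro: mult_right_mono)
  also have "\<dots> \<le> 1 / \<sigma>"
  proof -
    have "\<sigma> * u \<le> exp (\<sigma> * u)" using exp_ge_add_one_self[of "\<sigma> * u"] by linarith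
    then have "\<sigma> * u * exp (- (\<sigma> * u)) \<le> exp (\<sigma> * u) * exp (- (\<sigma> * u))" by (rule mult_right_mono) simp
    also have "\<dots> = 1" by (simp add: exp_minus)
    finally show ?thesis using assms by (simp add: field_simps)
  qed
  finally show "cmod (- of_real u * exp (- (z * complex_of_real u))) \<le> 1 / \<sigma>" .
qed (use assms in auto)

lemma P_has_derivative:
  assumes s: "0 < Re s"
  shows "(P has_field_derivative (CLINT u|M. - of_real u * exp (- (s * complex_of_real u)))) (at s)"
  unfolding DERIV_def tendsto_at_iff_sequentially o_def
proof safe
  fix X :: "nat \<Rightarrow> complex" assume X: "\<forall>i. X i \<in> UNIV - {0}" "X \<longlonglongrightarrow> 0"
  \<comment> \<open>Half of \<open>Re s\<close> leaves room for the increments, which are eventually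
    smaller than \<open>\<sigma>\<close> in norm.\<close>
  define \<sigma> where "\<sigma> = Re s / 2"
  have \<sigma>: "0 < \<sigma>" using s by (simp add: \<sigma>_def)
  obtain N where N: "\<And>n. n \<ge> N \<Longrightarrow> norm (X n) < \<sigma>" using LIMSEQ_D[OF X(2) \<sigma>] by auto
  have Re: "\<sigma> \<le> Re (s + X (n + N))" for n
    using N[of "n + N"] abs_Re_le_cmod[of "X (n + N)"] by (simp add: \<sigma>_def)
  have Xnz: "X n \<noteq> 0" for n using X(1) by auto
  have "(\<lambda>n. (P (s + X (n + N)) - P s) / X (n + N)) \<longlonglongrightarrow> (CLINT u|M. - of_real u * exp (- (s * complex_of_real u)))"
  proof -
    have eq: "(P (s + X (n + N)) - P s) / X (n + N) = (CLINT u|M. (exp (- ((s + X (n + N)) * complex_of_real u)) - exp (- (s * complex_of_real u))) / X (n + N))" for n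
      unfolding laplace_transform_def using integrable_exp[of "s + X (n + N)"] integrable_exp[of s] Re[of n] s \<sigma>
      by (subst integral_divide_zero, subst Bochner_Integration.integral_diff) auto
    show ?thesis unfolding eq
    proof (rule integral_dominated_convergence[where w="\<lambda>_. 1 / \<sigma>"])
      show "AE u in M. (\<lambda>n. (exp (- ((s + X (n + N)) * complex_of_real u)) - exp (- (s * complex_of_real u))) / X (n + N)) \<longlonglongrightarrow> - of_real u * exp (- (s * complex_of_real u))"
      proof (rule AE_I2)
        fix u
        have "((\<lambda>z. exp (- (z * complex_of_real u))) has_field_derivative (- of_real u * exp (- (s * complex_of_real u)))) (at s)"
          by (auto intro!: derivative_eq_intros)
        then have "(\<lambda>n. (exp (- ((s + X n) * complex_of_real u)) - exp (- (s * complex_of_real u))) / X n) \<longlonglongrightarrow> - of_real u * exp (- (s * complex_of_real u))"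
          using X unfolding DERIV_def tendsto_at_iff_sequentially o_def by blast
        then show "(\<lambda>n. (exp (- ((s + X (n + N)) * complex_of_real u)) - exp (- (s * complex_of_real u))) / X (n + N)) \<longlonglongrightarrow> - of_real u * exp (- (s * complex_of_real u))"
          by (rule LIMSEQ_ignore_initial_segment)
      qed
      show "AE u in M. norm ((exp (- ((s + X (n + N)) * complex_of_real u)) - exp (- (s * complex_of_real u))) / X (n + N)) \<le> 1 / \<sigma>" for n
        using nonneg
      proof eventually_elim
        case (elim u)
        have "\<sigma> \<le> Re s" using s by (simp add: \<sigma>_def)
        from exp_diff_quotient_bound[OF \<sigma> elim Re[of n] this]
        show ?case using Xnz[of "n + N"] by (simp add: norm_divide divide_le_eq)
      qed
    qed auto
  qed
  then show "(\<lambda>n. (P (s + X n) - P s) / X n) \<longlonglongrightarrow> (CLINT u|M. - of_real u * exp (- (s * complex_of_real u)))"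
    by (rule LIMSEQ_offset)
qed

lemma P_holomorphic: "P holomorphic_on {s. 0 < Re s}"
  unfolding holomorphic_on_def
proof safe
  fix z assume "0 < Re z"
  from P_has_derivative[OF this] have "P field_differentiable (at z)"
    unfolding field_differentiable_def by (rule exI)
  then show "P field_differentiable (at z within {s. 0 < Re s})" by (rule field_differentiable_at_within)
qed

text \<open>Integrating the derivative of \<open>exp (- s * r * u)\<close> over \<open>r\<close> compares complex with real arguments.\<close>

lemma exp_complex_le_real:
  assumes s: "0 < Re s" and u: "0 \<le> u"
  shows "cmod (1 - exp (- (s * complex_of_real u))) \<le> cmod s / Re s * (1 - exp (- (Re s * u)))"
proof -
  have "norm (exp (- (s * complex_of_real (1 * u))) - exp (- (s * complex_of_real (0 * u))))
    \<le> (- (cmod s / Re s) * exp (- (Re s * (1 * u)))) - (- (cmod s / Re s) * exp (- (Re s * (0 * u))))"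
  proof (rule differentiable_bound_general[where f="\<lambda>r. exp (- (s * complex_of_real (r * u)))"
        and \<phi>="\<lambda>r. - (cmod s / Re s) * exp (- (Re s * (r * u)))"
        and f'="\<lambda>r. - (s * of_real u) * exp (- (s * complex_of_real (r * u)))"
        and \<phi>'="\<lambda>r. cmod s * u * exp (- (Re s * (r * u)))"])
    show "((\<lambda>r. exp (- (s * complex_of_real (r * u)))) has_vector_derivative - (s * of_real u) * exp (- (s * complex_of_real (x * u)))) (at x)" for x
    proof -
      have "((\<lambda>z. exp (- (s * (z * of_real u)))) has_field_derivative - (s * of_real u) * exp (- (s * (of_real x * of_real u)))) (at (of_real x))"
        by (auto intro!: derivative_eq_intros)
      from has_vector_derivative_real_field[OF this] show ?thesis by simp
    qed
    show "((\<lambda>r. - (cmod s / Re s) * exp (- (Re s * (r * u)))) has_vector_derivative cmod s * u * exp (- (Re s * (x * u)))) (at x)" for x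
      using s by (auto intro!: derivative_eq_intros simp: has_real_derivative_iff_has_vector_derivative[symmetric])
    show "norm (- (s * of_real u) * exp (- (s * complex_of_real (x * u)))) \<le> cmod s * u * exp (- (Re s * (x * u)))" for x
      using u by (simp add: norm_mult)
  qed (use s in \<open>auto intro!: continuous_intros\<close>)
  then show ?thesis by (simp add: algebra_simps norm_minus_commute)
qed

definition p :: "real \<Rightarrow> real" where "p x = (LINT u|M. exp (- (x * u)))"

lemma P_of_real: "P (of_real x) = of_real (p x)"
  unfolding laplace_transform_def p_def integral_complex_of_real[symmetric]
  by (simp add: exp_of_real[symmetric])

lemma integrable_exp_real: "0 \<le> x \<Longrightarrow> integrable M (\<lambda>u. exp (- (x * u)))"
proof (rule integrable_const_bound[where B=1])
  assume x: "0 \<le> x"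
  show "AE u in M. norm (exp (- (x * u))) \<le> 1"
    using nonneg by eventually_elim (use x in simp)
qed simp

lemma p_pos: "0 \<le> x \<Longrightarrow> 0 < p x"
proof -
  assume x: "0 \<le> x"
  have "0 \<le> p x" unfolding p_def by simp
  moreover have "p x \<noteq> 0"
  proof
    assume "p x = 0"
    then have "AE u in M. exp (- (x * u)) = 0"
      unfolding p_def using integrable_exp_real[OF x] by (subst (asm) integral_nonneg_eq_0_iff_AE) auto
    then have "AE u in M. False" by simp
    then show False by simp
  qed
  ultimately show ?thesis by simp
qed

lemma p_antimono: "0 \<le> x \<Longrightarrow> x \<le> y \<Longrightarrow> p y \<le> p x"
  unfolding p_def
proof (rule integral_mono_AE)
  assume x: "0 \<le> x" "x \<le> y"
  show "AE u in M. exp (- (y * u)) \<le> exp (- (x * u))"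
    using nonneg by eventually_elim (use x in \<open>auto intro: mult_right_mono\<close>)
qed (auto intro: integrable_exp_real)

lemma p_le_1: "0 \<le> x \<Longrightarrow> p x \<le> 1"
  using p_antimono[of 0 x] prob_space by (simp add: p_def del: space_eq_univ)

text \<open>The constant depends only on the direction of \<open>s\<close>, so real estimates for
  \<open>p\<close> become complex ones along a ray.\<close>

lemma one_minus_P_le:
  assumes s: "0 < Re s"
  shows "cmod (1 - P s) \<le> cmod s / Re s * (1 - p (Re s))"
proof -
  have i: "integrable M (\<lambda>u. exp (- (s * complex_of_real u)))" using s by (intro integrable_exp) simp
  have "1 - P s = (CLINT u|M. 1 - exp (- (s * complex_of_real u)))"
    unfolding laplace_transform_def using i prob_space by (simp del: space_eq_univ)
  also have "cmod \<dots> \<le> (LINT u|M. cmod (1 - exp (- (s * complex_of_real u))))" by (rule integral_norm_bound)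
  also have "\<dots> \<le> (LINT u|M. cmod s / Re s * (1 - exp (- (Re s * u))))"
  proof (rule integral_mono_AE)
    show "AE u in M. cmod (1 - exp (- (s * complex_of_real u))) \<le> cmod s / Re s * (1 - exp (- (Re s * u)))"
      using nonneg by eventually_elim (rule exp_complex_le_real[OF s])
    show "integrable M (\<lambda>u. cmod s / Re s * (1 - exp (- (Re s * u))))"
      using s by (intro integrable_mult_right Bochner_Integration.integrable_diff integrable_exp_real) auto
  qed (use i in simp)
  also have "\<dots> = cmod s / Re s * (1 - p (Re s))"
    unfolding p_def using integrable_exp_real[of "Re s"] s prob_space by (simp del: space_eq_univ)
  finally show ?thesis .
qed

end

lemma is_laplace_transformE:
  assumes "is_laplace_transform \<phi>"
  obtains M where "nonneg_distribution M" "\<And>s. 0 \<le> Re s \<Longrightarrow> \<phi> s = laplace_transform M s"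
  using assms unfolding is_laplace_transform_def nonneg_distribution_def nonneg_distribution_axioms_def by blast

section \<open>Class L Laplace transforms\<close>

locale class_L_distribution = nonneg_distribution +
  fixes Mc :: "real \<Rightarrow> real measure"
  assumes Mc: "\<And>c. 0 < c \<Longrightarrow> c < 1 \<Longrightarrow> nonneg_distribution (Mc c)"
    and eq_real: "\<And>c x. 0 < c \<Longrightarrow> c < 1 \<Longrightarrow> 0 < x \<Longrightarrow>
      laplace_transform M (complex_of_real x) = laplace_transform M (complex_of_real (c * x)) * laplace_transform (Mc c) (complex_of_real x)"
begin

lemma connected_halfplane: "connected {s. 0 < Re s}"
  by (intro convex_connected convex_halfspace_Re_gt)

text \<open>Identity theorem: both sides are holomorphic on the open half-plane and agree on the
  positive reals, which accumulate at \<open>1\<close>.\<close>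

lemma factor_interior:
  assumes c: "0 < c" "c < 1" and s: "0 < Re s"
  shows "P s = P (of_real c * s) * laplace_transform (Mc c) s"
proof -
  interpret c: nonneg_distribution "Mc c" by (rule Mc[OF c])
  have "P s - P (of_real c * s) * laplace_transform (Mc c) s = 0"
  proof (rule analytic_continuation[where f="\<lambda>s. P s - P (of_real c * s) * laplace_transform (Mc c) s" and w=s and S="{s. 0 < Re s}" and U="{s. 0 < Re s \<and> Im s = 0}" and \<xi>=1])
    have "(P \<circ> (\<lambda>s. of_real c * s)) holomorphic_on {s. 0 < Re s}"
      by (rule holomorphic_on_compose_gen[OF _ P_holomorphic]) (use c in \<open>auto intro!: holomorphic_intros\<close>)
    then show "(\<lambda>s. P s - P (of_real c * s) * laplace_transform (Mc c) s) holomorphic_on {s. 0 < Re s}"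
      using P_holomorphic c.P_holomorphic by (auto intro!: holomorphic_intros simp: o_def)
    show "open {s. 0 < Re s}" by (rule open_halfspace_Re_gt)
    show "connected {s. 0 < Re s}" by (rule connected_halfplane)
    have "(\<lambda>n. of_real (1 + 1 / real (Suc n))) \<longlonglongrightarrow> complex_of_real (1 + 0)"
      by (intro tendsto_intros) (use LIMSEQ_inverse_real_of_nat in \<open>simp add: inverse_eq_divide\<close>)
    then show "1 islimpt {s. 0 < Re s \<and> Im s = 0}"
      unfolding islimpt_sequential
      by (intro exI[of _ "\<lambda>n. complex_of_real (1 + 1 / real (Suc n))"]) (auto simp: complex_eq_iff add_pos_pos simp del: of_nat_Suc)
    fix z assume "z \<in> {s. 0 < Re s \<and> Im s = 0}"
    then have "z = of_real (Re z)" "0 < Re z" by (auto simp: complex_eq_iff)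
    then show "P z - P (of_real c * z) * laplace_transform (Mc c) z = 0" using eq_real[OF c, of "Re z"] by simp
  qed (use s in auto)
  then show ?thesis by simp
qed

text \<open>Boundary points are approached horizontally from the right. They occur as stable
  exponents when \<open>\<alpha> = 1\<close> and \<open>|\<theta>| = pi / 2\<close>.\<close>

lemma factor:
  assumes c: "0 < c" "c < 1" and s: "0 \<le> Re s"
  shows "P s = P (of_real c * s) * laplace_transform (Mc c) s"
proof -
  interpret c: nonneg_distribution "Mc c" by (rule Mc[OF c])
  define X where "X n = s + of_real (1 / real (Suc n))" for n
  have X: "X \<longlonglongrightarrow> s" unfolding X_def
    using tendsto_add[OF tendsto_const tendsto_of_real[OF LIMSEQ_inverse_real_of_nat], of s] by (simp add: inverse_eq_divide)
  have ReX: "0 < Re (X n)" for n using s by (simp add: X_def add_nonneg_pos)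
  have "(\<lambda>n. P (X n)) \<longlonglongrightarrow> P s" by (rule P_tendsto[OF X]) (rule less_imp_le[OF ReX])
  moreover have "(\<lambda>n. P (of_real c * X n) * laplace_transform (Mc c) (X n)) \<longlonglongrightarrow> P (of_real c * s) * laplace_transform (Mc c) s"
  proof (rule tendsto_mult)
    show "(\<lambda>n. P (of_real c * X n)) \<longlonglongrightarrow> P (of_real c * s)"
      by (rule P_tendsto) (use X c ReX in \<open>auto intro!: tendsto_intros simp: less_imp_le\<close>)
    show "(\<lambda>n. laplace_transform (Mc c) (X n)) \<longlonglongrightarrow> laplace_transform (Mc c) s"
      by (rule c.P_tendsto[OF X]) (rule less_imp_le[OF ReX])
  qed
  ultimately show ?thesis unfolding factor_interior[OF c ReX] by (rule LIMSEQ_unique)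
qed

definition pc :: "real \<Rightarrow> real \<Rightarrow> real" where "pc c x = nonneg_distribution.p (Mc c) x"

lemma p_factor:
  assumes c: "0 < c" "c < 1" and x: "0 \<le> x"
  shows "p x = p (c * x) * pc c x"
proof -
  interpret c: nonneg_distribution "Mc c" by (rule Mc[OF c])
  have "complex_of_real (p x) = of_real (p (c * x) * pc c x)"
  proof -
    have "P (of_real x) = P (of_real (c * x)) * c.P (of_real x)"
      using factor[OF c, of "of_real x"] x by simp
    then show ?thesis unfolding P_of_real c.P_of_real pc_def by (simp only: of_real_mult)
  qed
  then show ?thesis by (simp only: of_real_eq_iff)
qed

text \<open>The values of \<open>c\<close> tending to \<open>1\<close>. They start at
  \<open>1 / 2\<close>, so that \<open>1 / c \<le> 2\<close> in the bounds for the
  quotients.\<close>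

definition seq1 :: "nat \<Rightarrow> real" where "seq1 n = 1 - 1 / real (n + 2)"

lemma seq1: "1 / 2 \<le> seq1 n" "0 < seq1 n" "seq1 n < 1"
  by (auto simp: seq1_def field_simps)

lemma seq1_tendsto: "seq1 \<longlonglongrightarrow> 1"
proof -
  have "(\<lambda>n. 1 / real (n + 2)) \<longlonglongrightarrow> 0"
    using LIMSEQ_ignore_initial_segment[OF lim_1_over_n, of 2] by simp
  from tendsto_diff[OF tendsto_const[of 1] this] show ?thesis by (simp add: seq1_def[abs_def])
qed

text \<open>For \<open>c\<close> close to \<open>1\<close>, the factor at \<open>s\<close> is close
  to \<open>1\<close>, because it is so at \<open>Re s\<close>. A zero at \<open>s\<close> is
  therefore inherited by \<open>c * s\<close>; such zeros accumulate at \<open>s\<close> and force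
  \<open>P\<close> to vanish identically, against \<open>P 1 > 0\<close>.\<close>

lemma P_nonzero:
  assumes s: "0 < Re s"
  shows "P s \<noteq> 0"
proof
  assume P0: "P s = 0"
  have lim: "(\<lambda>n. pc (seq1 n) (Re s)) \<longlonglongrightarrow> 1"
  proof -
    have "(\<lambda>n. P (of_real (seq1 n * Re s))) \<longlonglongrightarrow> P (of_real (1 * Re s))"
    proof (rule P_tendsto)
      show "(\<lambda>n. complex_of_real (seq1 n * Re s)) \<longlonglongrightarrow> of_real (1 * Re s)"
        by (intro tendsto_of_real tendsto_mult seq1_tendsto tendsto_const)
    qed (use s seq1(2) in \<open>simp add: less_imp_le\<close>)
    then have "(\<lambda>n. p (seq1 n * Re s)) \<longlonglongrightarrow> p (Re s)" unfolding P_of_real tendsto_of_real_iff by simp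
    then have "(\<lambda>n. p (Re s) / p (seq1 n * Re s)) \<longlonglongrightarrow> p (Re s) / p (Re s)"
      using p_pos[of "Re s"] s by (intro tendsto_intros) auto
    moreover have "p (Re s) / p (seq1 n * Re s) = pc (seq1 n) (Re s)" for n
      using p_factor[OF seq1(2,3), of "Re s" n] p_pos[of "seq1 n * Re s"] s seq1(2)[of n] by simp
    ultimately show ?thesis using p_pos[of "Re s"] s by simp
  qed
  have "(\<lambda>n. cmod s / Re s * (1 - pc (seq1 n) (Re s))) \<longlonglongrightarrow> cmod s / Re s * (1 - 1)"
    by (intro tendsto_intros lim)
  then have "eventually (\<lambda>n. cmod s / Re s * (1 - pc (seq1 n) (Re s)) < 1) sequentially"
    by (rule order_tendstoD) simp
  then obtain N where N: "\<And>n. n \<ge> N \<Longrightarrow> cmod s / Re s * (1 - pc (seq1 n) (Re s)) < 1"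
    by (auto simp: eventually_sequentially)
  have zero: "P (of_real (seq1 n) * s) = 0" if "n \<ge> N" for n
  proof -
    interpret c: nonneg_distribution "Mc (seq1 n)" by (rule Mc[OF seq1(2,3)])
    have "cmod (1 - c.P s) < 1" using c.one_minus_P_le[OF s] N[OF that] unfolding pc_def by linarith
    then have "c.P s \<noteq> 0" by auto
    then show ?thesis using factor_interior[OF seq1(2,3) s, of n] P0 by simp
  qed
  have "P 1 = 0"
  proof (rule analytic_continuation[OF P_holomorphic open_halfspace_Re_gt connected_halfplane, where U="{of_real (seq1 n) * s |n. n \<ge> N}" and \<xi>=s])
    have s0: "s \<noteq> 0" using s by auto
    show "s islimpt {of_real (seq1 n) * s |n. n \<ge> N}"
      unfolding islimpt_sequential
    proof (intro exI[of _ "\<lambda>n. of_real (seq1 (n + N)) * s"] conjI allI)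
      show "of_real (seq1 (n + N)) * s \<in> {of_real (seq1 n) * s |n. n \<ge> N} - {s}" for n
      proof -
        have "seq1 (n + N) \<noteq> 1" using seq1(3)[of "n + N"] by simp
        then show ?thesis using s0 by (auto intro!: exI[of _ "n + N"])
      qed
      have "(\<lambda>n. of_real (seq1 (n + N)) * s) \<longlonglongrightarrow> of_real 1 * s"
        by (intro tendsto_intros LIMSEQ_ignore_initial_segment seq1_tendsto)
      then show "(\<lambda>n. of_real (seq1 (n + N)) * s) \<longlonglongrightarrow> s" by simp
    qed
  qed (use s seq1(2) zero in auto)
  then show False using p_pos[of 1] P_of_real[of 1] by simp
qed

text \<open>For \<open>x > 0\<close>, \<open>J x = x * L' x\<close> with \<open>L = - ln p\<close>; as a limit of the functions
  \<open>(1 - pc c x) / (1 - c)\<close>, which increase with \<open>x\<close>, it is increasing.\<close>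

definition J :: "complex \<Rightarrow> complex" where "J s = - s * deriv P s / P s"

text \<open>The factor at \<open>c\<close> is \<open>H c\<close> with
  \<open>H z = P s / P (z * s)\<close>. The quotient is thus a difference quotient of
  \<open>H\<close> at \<open>1\<close>, and the derivative of \<open>H\<close> there is
  \<open>- s * deriv P s / P s\<close>.\<close>

lemma J_tendsto:
  assumes s: "0 < Re s"
  shows "(\<lambda>n. (1 - laplace_transform (Mc (seq1 n)) s) / of_real (1 - seq1 n)) \<longlonglongrightarrow> J s"
proof -
  define H where "H z = P s / P (z * s)" for z
  have dP: "(P has_field_derivative deriv P s) (at s)"
    unfolding DERIV_imp_deriv[OF P_has_derivative[OF s]] by (rule P_has_derivative[OF s])
  have "((\<lambda>z. P (z * s)) has_field_derivative deriv P s * s) (at 1)"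
    by (rule DERIV_chain'[where f="\<lambda>z. z * s" and g=P]) (auto intro!: derivative_eq_intros dP)
  then have "(H has_field_derivative J s) (at 1)"
    unfolding H_def J_def using P_nonzero[OF s] by (auto intro!: derivative_eq_intros simp: divide_simps power2_eq_square)
  then have lim: "((\<lambda>h. (H (1 + h) - H 1) / h) \<longlongrightarrow> J s) (at 0)" by (simp add: DERIV_def)
  define h where "h n = complex_of_real (seq1 n - 1)" for n
  have "h \<longlonglongrightarrow> of_real (1 - 1)" unfolding h_def by (intro tendsto_intros seq1_tendsto)
  moreover have "h n \<noteq> 0" for n using seq1(3)[of n] by (simp add: h_def)
  ultimately have "filterlim h (at 0) sequentially" by (simp add: filterlim_at)
  from filterlim_compose[OF lim this] have "(\<lambda>n. (H (1 + h n) - H 1) / h n) \<longlonglongrightarrow> J s" .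
  moreover have "(H (1 + h n) - H 1) / h n = (1 - laplace_transform (Mc (seq1 n)) s) / of_real (1 - seq1 n)" for n
  proof -
    have "P (of_real (seq1 n) * s) \<noteq> 0" using s seq1(2)[of n] by (intro P_nonzero) simp
    then have "H (1 + h n) = laplace_transform (Mc (seq1 n)) s"
      using factor_interior[OF seq1(2,3) s, of n] by (simp add: H_def h_def)
    moreover have "H 1 = 1" using P_nonzero[OF s] by (simp add: H_def)
    moreover have "h n = - of_real (1 - seq1 n)" by (simp add: h_def)
    moreover have d: "(x - 1) / - d = (1 - x) / d" for x d :: complex
      by (cases "d = 0") (auto simp: field_simps)
    ultimately show ?thesis by (simp only: d)
  qed
  ultimately show ?thesis by simp
qed

definition L :: "real \<Rightarrow> real" where "L x = - ln (p x)"

definition K :: "real \<Rightarrow> real" where "K x = Re (J (of_real x))"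

lemma p_has_derivative:
  assumes x: "0 < x"
  shows "(p has_real_derivative Re (deriv P (of_real x))) (at x)"
proof -
  have "(P has_field_derivative deriv P (of_real x)) (at (of_real x))"
  proof -
    have s: "0 < Re (complex_of_real x)" using x by simp
    show ?thesis unfolding DERIV_imp_deriv[OF P_has_derivative[OF s]] by (rule P_has_derivative[OF s])
  qed
  from has_vector_derivative_real_field[OF this]
  have "((\<lambda>x. P (of_real x)) has_vector_derivative deriv P (of_real x)) (at x)" .
  then show ?thesis by (simp add: P_of_real has_vector_derivative_complex_iff)
qed

lemma L_has_derivative:
  assumes x: "0 < x"
  shows "(L has_real_derivative K x / x) (at x)"
proof -
  have "Re (- of_real x * deriv P (of_real x) / P (of_real x)) = - x * Re (deriv P (of_real x)) / p x"
    unfolding P_of_real by (simp add: Re_divide_of_real)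
  then have K: "K x / x = - (Re (deriv P (of_real x)) / p x)" using x by (simp add: K_def J_def)
  show ?thesis unfolding L_def K
    using p_pos[of x] x by (auto intro!: derivative_eq_intros p_has_derivative)
qed

lemma K_tendsto: "0 < x \<Longrightarrow> (\<lambda>n. (1 - pc (seq1 n) x) / (1 - seq1 n)) \<longlonglongrightarrow> K x"
proof -
  assume x: "0 < x"
  have "(\<lambda>n. Re ((1 - laplace_transform (Mc (seq1 n)) (of_real x)) / of_real (1 - seq1 n))) \<longlonglongrightarrow> K x"
    unfolding K_def by (intro tendsto_Re J_tendsto) (use x in simp)
  moreover have "laplace_transform (Mc (seq1 n)) (of_real x) = of_real (pc (seq1 n) x)" for n
    unfolding pc_def by (rule nonneg_distribution.P_of_real[OF Mc[OF seq1(2,3)]])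
  ultimately show ?thesis by (simp flip: of_real_diff add: Re_divide_of_real)
qed

lemma K_mono: "0 < x \<Longrightarrow> x \<le> y \<Longrightarrow> K x \<le> K y"
proof -
  assume xy: "0 < x" "x \<le> y"
  have "pc (seq1 n) y \<le> pc (seq1 n) x" for n
    unfolding pc_def by (rule nonneg_distribution.p_antimono[OF Mc[OF seq1(2,3)]]) (use xy in auto)
  then show ?thesis using xy seq1(3)
    by (intro LIMSEQ_le[OF K_tendsto K_tendsto]) (auto intro!: exI[of _ 0] divide_right_mono simp: less_imp_le)
qed

lemma K_nonneg: "0 < x \<Longrightarrow> 0 \<le> K x"
proof -
  assume x: "0 < x"
  have "pc (seq1 n) x \<le> 1" for n
    unfolding pc_def by (rule nonneg_distribution.p_le_1[OF Mc[OF seq1(2,3)]]) (use x in auto)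
  then show ?thesis using seq1(3) x
    by (intro LIMSEQ_le_const[OF K_tendsto]) (auto intro!: exI[of _ 0] divide_nonneg_nonneg simp: less_imp_le)
qed

text \<open>\<open>1 - pc c x\<close> is at most \<open>- ln (pc c x) = L x - L (c * x)\<close>,
  which the mean value theorem expresses by \<open>K\<close> at an intermediate point. Monotonicity
  of \<open>K\<close> and \<open>1 / c \<le> 2\<close> make the bound independent of
  \<open>c\<close>.\<close>

lemma one_minus_pc_le:
  assumes c: "1 / 2 \<le> c" "c < 1" and x: "0 < x"
  shows "(1 - pc c x) / (1 - c) \<le> 2 * K x"
proof -
  have c0: "0 < c" using c by simp
  have pcp: "0 < pc c x" unfolding pc_def by (rule nonneg_distribution.p_pos[OF Mc[OF c0 c(2)]]) (use x in auto)
  have pos: "0 < p x" "0 < p (c * x)" using p_pos x c0 by auto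
  have "c * x < x" using c x by simp
  have cx: "0 < c * x" using c0 x by simp
  have "(L has_real_derivative K y / y) (at y)" if "c * x \<le> y" for y
    using that cx by (intro L_has_derivative) simp
  from MVT2[OF \<open>c * x < x\<close> this] obtain \<xi> where \<xi>: "c * x < \<xi>" "\<xi> < x" "L x - L (c * x) = (x - c * x) * (K \<xi> / \<xi>)"
    by blast
  have \<xi>0: "0 < \<xi>" using \<xi> cx by linarith
  have "1 - pc c x \<le> - ln (pc c x)" using ln_le_minus_one[OF pcp] by simp
  also have "- ln (pc c x) = L x - L (c * x)"
  proof -
    have "pc c x = p x / p (c * x)" using p_factor[OF c0 c(2), of x] x pos by (simp add: field_simps)
    then show ?thesis using pos by (simp add: L_def ln_div)
  qed
  also have "\<dots> = (x - c * x) * (K \<xi> / \<xi>)" by (rule \<xi>(3))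
  also have "\<dots> \<le> (x - c * x) * (K x / (c * x))"
    using \<xi> \<xi>0 x c0 c K_mono[OF \<xi>0, of x] K_nonneg[OF \<xi>0] by (intro mult_left_mono frac_le) auto
  also have "\<dots> = (1 - c) * (K x / c)" using x c0 by (simp add: field_simps)
  also have "\<dots> \<le> (1 - c) * (2 * K x)"
  proof (intro mult_left_mono)
    have "K x * 1 \<le> K x * (2 * c)" using K_nonneg[OF x] c by (intro mult_left_mono) auto
    then show "K x / c \<le> 2 * K x" using c0 by (simp add: field_simps)
  qed (use c in auto)
  finally show ?thesis using c by (simp add: field_simps)
qed

end

lemma stable_exponent_scale:
  assumes "0 < r"
  shows "stable_exponent \<alpha> \<theta> l (r * t) = of_real (r powr \<alpha>) * stable_exponent \<alpha> \<theta> l t"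
  using assms by (simp add: stable_exponent_def abs_mult powr_mult sgn_mult)

section \<open>Subordination of stable laws by a class L distribution\<close>

context class_L_distribution
begin

lemma quotient_le:
  assumes z: "0 < Re z"
  shows "cmod ((1 - laplace_transform (Mc (seq1 n)) z) / of_real (1 - seq1 n)) \<le> cmod z / Re z * (2 * K (Re z))"
proof -
  interpret c: nonneg_distribution "Mc (seq1 n)" by (rule Mc[OF seq1(2,3)])
  have pos: "0 < 1 - seq1 n" using seq1(3)[of n] by simp
  have "cmod ((1 - c.P z) / of_real (1 - seq1 n)) = cmod (1 - c.P z) / (1 - seq1 n)"
    unfolding norm_divide norm_of_real abs_of_pos[OF pos] ..
  also have "\<dots> \<le> (cmod z / Re z * (1 - pc (seq1 n) (Re z))) / (1 - seq1 n)"
    unfolding pc_def using pos by (intro divide_right_mono c.one_minus_P_le z) auto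
  also have "\<dots> = cmod z / Re z * ((1 - pc (seq1 n) (Re z)) / (1 - seq1 n))" by simp
  also have "\<dots> \<le> cmod z / Re z * (2 * K (Re z))"
    using z by (intro mult_left_mono one_minus_pc_le seq1) auto
  finally show ?thesis .
qed

lemma J_le:
  assumes z: "0 < Re z"
  shows "cmod (J z) \<le> cmod z / Re z * (2 * K (Re z))"
proof (rule tendsto_upperbound[OF tendsto_norm[OF J_tendsto[OF z]]])
  show "eventually (\<lambda>n. cmod ((1 - laplace_transform (Mc (seq1 n)) z) / of_real (1 - seq1 n)) \<le> cmod z / Re z * (2 * K (Re z))) sequentially"
    by (intro always_eventually allI quotient_le z)
qed simp

lemma J_isCont: "0 < Re z \<Longrightarrow> isCont J z"
proof -
  assume z: "0 < Re z"
  have "(\<lambda>s. - s * deriv P s / P s) holomorphic_on {s. 0 < Re s}"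
    using P_holomorphic P_nonzero holomorphic_deriv[OF P_holomorphic open_halfspace_Re_gt]
    by (intro holomorphic_intros) (auto simp: open_halfspace_Re_gt)
  then have "continuous_on {s. 0 < Re s} J"
    unfolding J_def by (rule holomorphic_on_imp_continuous_on)
  then show ?thesis using z continuous_on_eq_continuous_at[OF open_halfspace_Re_gt] by blast
qed

lemma J_isCont_ray:
  assumes s: "0 < Re s" and r: "0 < r"
  shows "isCont (\<lambda>r. J (of_real (r powr \<alpha>) * s) / of_real r) r"
proof -
  have "isCont (\<lambda>r. J (of_real (r powr \<alpha>) * s)) r"
  proof (rule isCont_o2[where g=J])
    show "isCont (\<lambda>r. complex_of_real (r powr \<alpha>) * s) r" using r by (intro continuous_intros) auto
    show "isCont J (of_real (r powr \<alpha>) * s)" by (rule J_isCont) (use r s in simp)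
  qed
  then show ?thesis by (rule isCont_divide) (use r in \<open>auto intro: isCont_of_real\<close>)
qed

lemma K_isCont: "0 < x \<Longrightarrow> isCont K x"
proof -
  assume x: "0 < x"
  have "isCont (\<lambda>x. J (of_real x)) x"
    by (rule isCont_o2[where g=J]) (use x in \<open>auto intro: J_isCont isCont_of_real\<close>)
  then show ?thesis unfolding K_def by (rule continuous_Re)
qed

lemma P_continuous_on: "continuous_on {s. 0 \<le> Re s} P"
  unfolding continuous_on_sequentially o_def using P_tendsto by auto

lemma L_tendsto_0: "(L \<longlongrightarrow> 0) (at_right 0)"
proof -
  have "((\<lambda>x. P (of_real x)) \<longlongrightarrow> P (of_real 0)) (at_right 0)"
  proof (rule continuous_on_tendsto_compose[OF P_continuous_on])
    show "eventually (\<lambda>x. complex_of_real x \<in> {s. 0 \<le> Re s}) (at_right 0)"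
      using eventually_at_right_less[of 0] by eventually_elim simp
    show "(complex_of_real \<longlongrightarrow> of_real 0) (at_right 0)" by (intro tendsto_of_real tendsto_ident_at)
  qed simp
  then have "(p \<longlongrightarrow> p 0) (at_right 0)" unfolding P_of_real tendsto_of_real_iff .
  moreover have "p 0 = 1" using P_0 P_of_real[of 0] by simp
  ultimately have "((\<lambda>x. - ln (p x)) \<longlongrightarrow> - ln 1) (at_right 0)" by (intro tendsto_intros) auto
  then show ?thesis unfolding L_def by simp
qed

lemma powr_tendsto_0:
  assumes "0 < \<alpha>" "0 < \<sigma>"
  shows "filterlim (\<lambda>r. r powr \<alpha> * \<sigma>) (at_right 0) (at_right (0::real))"
proof -
  have ev: "eventually (\<lambda>r. 0 \<le> r) (at_right (0::real))"
    using eventually_at_right_less[of "0::real"] by eventually_elim simp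
  have "((\<lambda>r. r powr \<alpha> * \<sigma>) \<longlongrightarrow> 0 powr \<alpha> * \<sigma>) (at_right 0)"
    using assms by (intro tendsto_intros) (auto intro: ev)
  moreover have "eventually (\<lambda>r. r powr \<alpha> * \<sigma> \<in> {0<..} \<and> r powr \<alpha> * \<sigma> \<noteq> 0) (at_right 0)"
    using eventually_at_right_less[of "0::real"] by eventually_elim (use assms in simp)
  ultimately show ?thesis using assms by (simp add: filterlim_at)
qed

text \<open>Up to the factor \<open>\<alpha>\<close>, the integrand is the derivative of
  \<open>L (r powr \<alpha> * \<sigma>)\<close>. It is nonnegative and its primitive has finite
  limits at both ends, so it is integrable although nothing is known about the rate at which
  \<open>K\<close> decays at \<open>0\<close>. It is the majorant for all limits along the
  ray.\<close>

lemma K_integrable: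
  assumes \<alpha>: "0 < \<alpha>" and \<sigma>: "0 < \<sigma>"
  shows "set_integrable lborel {0<..<1} (\<lambda>r. K (r powr \<alpha> * \<sigma>) / r)"
proof -
  have "set_integrable lborel (einterval 0 1) (\<lambda>r. \<alpha> * (K (r powr \<alpha> * \<sigma>) / r))"
  proof (rule interval_integral_FTC_nonneg(1)[where F="\<lambda>r. L (r powr \<alpha> * \<sigma>)"])
    fix r :: real assume "0 < ereal r"
    then have r: "0 < r" by simp
    have x: "0 < r powr \<alpha> * \<sigma>" using r \<sigma> by simp
    have "((\<lambda>r. r powr \<alpha> * \<sigma>) has_real_derivative (\<alpha> * r powr (\<alpha> - 1)) * \<sigma>) (at r)"
      using r by (auto intro!: derivative_eq_intros)
    from DERIV_chain2[OF L_has_derivative[OF x] this]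
    have "((\<lambda>r. L (r powr \<alpha> * \<sigma>)) has_real_derivative K (r powr \<alpha> * \<sigma>) / (r powr \<alpha> * \<sigma>) * (\<alpha> * r powr (\<alpha> - 1) * \<sigma>)) (at r)" .
    also have "K (r powr \<alpha> * \<sigma>) / (r powr \<alpha> * \<sigma>) * (\<alpha> * r powr (\<alpha> - 1) * \<sigma>) = \<alpha> * (K (r powr \<alpha> * \<sigma>) / r)"
      using r \<sigma> by (simp add: powr_diff)
    finally show "((\<lambda>r. L (r powr \<alpha> * \<sigma>)) has_real_derivative \<alpha> * (K (r powr \<alpha> * \<sigma>) / r)) (at r)" .
    have "isCont (\<lambda>r. K (r powr \<alpha> * \<sigma>)) r"
    proof (rule isCont_o2[where g=K])
      show "isCont (\<lambda>r. r powr \<alpha> * \<sigma>) r" using r by (intro continuous_intros) auto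
    qed (rule K_isCont[OF x])
    then show "isCont (\<lambda>r. \<alpha> * (K (r powr \<alpha> * \<sigma>) / r)) r" using r by (intro continuous_intros) auto
  next
    show "AE r in lborel. 0 < ereal r \<longrightarrow> ereal r < 1 \<longrightarrow> 0 \<le> \<alpha> * (K (r powr \<alpha> * \<sigma>) / r)"
      using \<alpha> \<sigma> K_nonneg by (intro AE_I2) auto
    show "(((\<lambda>r. L (r powr \<alpha> * \<sigma>)) \<circ> real_of_ereal) \<longlongrightarrow> 0) (at_right 0)"
      unfolding zero_ereal_def ereal_tendsto_simps1
      by (rule filterlim_compose[OF L_tendsto_0 powr_tendsto_0[OF \<alpha> \<sigma>]])
    have "isCont (\<lambda>r. L (r powr \<alpha> * \<sigma>)) 1"
    proof (rule isCont_o2[where g=L])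
      show "isCont (\<lambda>r. r powr \<alpha> * \<sigma>) 1" by (intro continuous_intros) auto
      show "isCont L (1 powr \<alpha> * \<sigma>)" using DERIV_isCont[OF L_has_derivative[OF \<sigma>]] by simp
    qed
    then show "(((\<lambda>r. L (r powr \<alpha> * \<sigma>)) \<circ> real_of_ereal) \<longlongrightarrow> L (1 powr \<alpha> * \<sigma>)) (at_left 1)"
      unfolding one_ereal_def ereal_tendsto_simps1 isCont_def by (rule filterlim_mono[OF _ order_refl at_le]) simp
  qed simp
  then have "set_integrable lborel {0<..<1} (\<lambda>r. \<alpha> * (K (r powr \<alpha> * \<sigma>) / r))" by (simp add: zero_ereal_def one_ereal_def einterval_eq)
  from set_integrable_mult_right[OF this, of "1 / \<alpha>"]
  have "set_integrable lborel {0<..<1} (\<lambda>r. 1 / \<alpha> * (\<alpha> * (K (r powr \<alpha> * \<sigma>) / r)))" by blast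
  moreover have "1 / \<alpha> * (\<alpha> * x) = x" for x using \<alpha> by simp
  ultimately show ?thesis by (simp only:)
qed

lemma J_set_measurable:
  assumes s: "0 < Re s"
  shows "(\<lambda>r. indicator {0<..<1} r *\<^sub>R (J (of_real (r powr \<alpha>) * s) / of_real r)) \<in> borel_measurable borel"
proof (rule borel_measurable_continuous_on_indicator)
  show "continuous_on {0<..<1} (\<lambda>r. J (of_real (r powr \<alpha>) * s) / of_real r)"
    by (intro continuous_at_imp_continuous_on ballI J_isCont_ray[OF s]) simp
qed simp

text \<open>Scaling by \<open>r powr \<alpha>\<close> cancels in \<open>|z| / Re z\<close>, so the
  constant is that of \<open>s\<close>.\<close>

lemma bound_on_ray:
  assumes s: "0 < Re s" and r: "0 < r"
    and le: "cmod w \<le> cmod (of_real (r powr \<alpha>) * s) / Re (of_real (r powr \<alpha>) * s) * (2 * K (Re (of_real (r powr \<alpha>) * s)))"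
  shows "cmod (w / of_real r) \<le> cmod s / Re s * 2 * (K (r powr \<alpha> * Re s) / r)"
proof -
  have "cmod w \<le> cmod s / Re s * (2 * K (r powr \<alpha> * Re s))"
    using le s r by (simp add: norm_mult)
  then have "cmod w / r \<le> (cmod s / Re s * (2 * K (r powr \<alpha> * Re s))) / r" using r by (intro divide_right_mono) auto
  then show ?thesis using r by (simp add: norm_divide)
qed

text \<open>Having no zeros, \<open>P\<close> has a holomorphic logarithm \<open>\<Lambda>\<close>
  on the half-plane, with derivative \<open>- J z / z\<close>. Along the ray, the integrand is then
  the derivative of \<open>- \<Lambda>\<close>. The ray is cut off at \<open>\<delta> n\<close>
  because its end \<open>0\<close> lies on the boundary.\<close>

lemma exp_J_integral:
  assumes \<alpha>: "0 < \<alpha>" and s: "0 < Re s"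
  shows "exp (- (of_real \<alpha> * (CLBINT r:{0<..<1}. J (of_real (r powr \<alpha>) * s) / of_real r))) = P s"
proof -
  obtain \<Lambda> where \<Lambda>: "\<Lambda> holomorphic_on {s. 0 < Re s}" "\<And>z. 0 < Re z \<Longrightarrow> exp (\<Lambda> z) = P z"
  proof (rule holomorphic_logarithm_exists[OF convex_halfspace_Re_gt open_halfspace_Re_gt P_holomorphic])
    show "1 \<in> {s. 0 < Re s}" by simp
  qed (use P_nonzero in auto)
  have d\<Lambda>: "(\<Lambda> has_field_derivative (- J z / z)) (at z)" if z: "0 < Re z" for z
  proof -
    have 1: "(\<Lambda> has_field_derivative deriv \<Lambda> z) (at z)"
      using holomorphic_derivI[OF \<Lambda>(1) open_halfspace_Re_gt] z by simp
    have "((\<lambda>z. exp (\<Lambda> z)) has_field_derivative exp (\<Lambda> z) * deriv \<Lambda> z) (at z)"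
      by (rule DERIV_chain'[OF 1 DERIV_exp])
    moreover have "eventually (\<lambda>w. w \<in> {s. 0 < Re s}) (nhds z)"
      using z by (intro eventually_nhds_in_open open_halfspace_Re_gt) simp
    then have "eventually (\<lambda>w. exp (\<Lambda> w) = P w) (nhds z)" by eventually_elim (simp add: \<Lambda>(2))
    ultimately have "(P has_field_derivative exp (\<Lambda> z) * deriv \<Lambda> z) (at z)"
      by (subst (asm) DERIV_cong_ev[OF refl _ refl]) auto
    then have "deriv P z = P z * deriv \<Lambda> z" unfolding \<Lambda>(2)[OF z] by (rule DERIV_imp_deriv)
    then have "deriv \<Lambda> z = - J z / z" using P_nonzero[OF z] z by (auto simp: J_def field_simps)
    then show ?thesis using 1 by simp
  qed
  define f where "f r = of_real \<alpha> * (J (of_real (r powr \<alpha>) * s) / of_real r)" for r :: real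
  define F where "F r = - \<Lambda> (of_real (r powr \<alpha>) * s)" for r :: real
  have dF: "(F has_vector_derivative f r) (at r)" and cf: "isCont f r" if r: "0 < r" for r
  proof -
    have z: "0 < Re (of_real (r powr \<alpha>) * s)" using s r by simp
    have "((\<lambda>r. complex_of_real (r powr \<alpha>) * s) has_vector_derivative of_real (\<alpha> * r powr (\<alpha> - 1)) * s) (at r)"
      using r by (auto intro!: derivative_eq_intros simp: has_real_derivative_iff_has_vector_derivative[symmetric])
    from field_vector_diff_chain_at[OF this d\<Lambda>[OF z]]
    have "((\<lambda>r. \<Lambda> (complex_of_real (r powr \<alpha>) * s)) has_vector_derivative
       of_real (\<alpha> * r powr (\<alpha> - 1)) * s * (- J (of_real (r powr \<alpha>) * s) / (of_real (r powr \<alpha>) * s))) (at r)" by (simp add: o_def)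
    from has_vector_derivative_minus[OF this]
    have "(F has_vector_derivative - (of_real (\<alpha> * r powr (\<alpha> - 1)) * s * (- J (of_real (r powr \<alpha>) * s) / (of_real (r powr \<alpha>) * s)))) (at r)"
      unfolding F_def .
    also have "- (of_real (\<alpha> * r powr (\<alpha> - 1)) * s * (- J (of_real (r powr \<alpha>) * s) / (of_real (r powr \<alpha>) * s))) = f r"
      using s r by (auto simp: f_def powr_diff field_simps)
    finally show "(F has_vector_derivative f r) (at r)" .
    show "isCont f r" unfolding f_def by (intro isCont_mult continuous_const J_isCont_ray s r)
  qed
  define \<delta> where "\<delta> n = 1 / real (n + 2)" for n
  have \<delta>: "0 < \<delta> n" "\<delta> n \<le> 1" for n by (auto simp: \<delta>_def)
  have \<delta>0: "\<delta> \<longlonglongrightarrow> 0"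
    using LIMSEQ_ignore_initial_segment[OF lim_1_over_n, of 2] unfolding \<delta>_def .
  have cont_f: "continuous_on {\<delta> n..1} f" for n
  proof (rule continuous_at_imp_continuous_on, rule ballI)
    fix x assume "x \<in> {\<delta> n..1}"
    then have "0 < x" using \<delta>(1)[of n] by simp
    then show "isCont f x" by (rule cf)
  qed
  have int: "(CLBINT r. indicator {\<delta> n..1} r *\<^sub>R f r) = F 1 - F (\<delta> n)" for n
  proof (rule integral_FTC_atLeastAtMost[OF \<delta>(2)])
    show "(F has_vector_derivative f x) (at x within {\<delta> n..1})" if "\<delta> n \<le> x" for x
      by (rule has_vector_derivative_at_within, rule dF) (use that \<delta>(1)[of n] in linarith)
    show "continuous_on {\<delta> n..1} f" by (rule cont_f)
  qed
  have fle: "norm (f r) \<le> \<alpha> * (cmod s / Re s * 2) * (K (r powr \<alpha> * Re s) / r)" if r: "0 < r" for r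
  proof -
    have "cmod (J (of_real (r powr \<alpha>) * s) / of_real r) \<le> cmod s / Re s * 2 * (K (r powr \<alpha> * Re s) / r)"
      by (rule bound_on_ray[OF s r], rule J_le) (use s r in simp)
    then have "\<alpha> * cmod (J (of_real (r powr \<alpha>) * s) / of_real r) \<le> \<alpha> * (cmod s / Re s * 2 * (K (r powr \<alpha> * Re s) / r))"
      using \<alpha> by (intro mult_left_mono) auto
    then show ?thesis unfolding f_def norm_mult[of "of_real \<alpha>"] using \<alpha> by (simp add: mult.assoc)
  qed
  have ae: "AE r in lborel. r \<noteq> (1::real)" by (rule AE_lborel_singleton)
  have lim: "(\<lambda>n. CLBINT r. indicator {\<delta> n..1} r *\<^sub>R f r) \<longlonglongrightarrow> (CLBINT r. indicator {0<..<1} r *\<^sub>R f r)"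
  proof (rule integral_dominated_convergence[where w="\<lambda>r. indicator {0<..<1} r *\<^sub>R (\<alpha> * (cmod s / Re s * 2) * (K (r powr \<alpha> * Re s) / r))"])
    show "(\<lambda>r. indicator {0<..<1} r *\<^sub>R f r) \<in> borel_measurable lborel"
      using borel_measurable_times[OF borel_measurable_const[of "of_real \<alpha>"] J_set_measurable[OF s, of \<alpha>]]
      by (simp add: f_def mult.left_commute)
    show "(\<lambda>r. indicator {\<delta> n..1} r *\<^sub>R f r) \<in> borel_measurable lborel" for n
      unfolding measurable_lborel2 by (rule borel_measurable_continuous_on_indicator[OF _ cont_f]) simp
    show "integrable lborel (\<lambda>r. indicator {0<..<1} r *\<^sub>R (\<alpha> * (cmod s / Re s * 2) * (K (r powr \<alpha> * Re s) / r)))"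
      using set_integrable_mult_right[OF K_integrable[OF \<alpha> s], of "\<alpha> * (cmod s / Re s * 2)"]
      unfolding set_integrable_def[symmetric] by blast
    show "AE r in lborel. (\<lambda>n. indicator {\<delta> n..1} r *\<^sub>R f r) \<longlonglongrightarrow> indicator {0<..<1} r *\<^sub>R f r"
      using ae
    proof eventually_elim
      case (elim r)
      show ?case
      proof (cases "0 < r \<and> r < 1")
        case True
        then have "eventually (\<lambda>n. \<delta> n < r) sequentially" using \<delta>0 by (intro order_tendstoD) auto
        then have "eventually (\<lambda>n. indicator {\<delta> n..1} r *\<^sub>R f r = indicator {0<..<1} r *\<^sub>R f r) sequentially"
          by eventually_elim (use True in simp)
        then show ?thesis by (rule tendsto_eventually)
      next
        case False
        have "r \<notin> {\<delta> n..1}" for n using False elim \<delta>(1)[of n] by auto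
        then have "indicator {\<delta> n..1} r *\<^sub>R f r = 0" for n by simp
        moreover have "indicator {0<..<1} r *\<^sub>R f r = 0" using False by simp
        ultimately show ?thesis by (simp only: tendsto_const)
      qed
    qed
    show "AE r in lborel. norm (indicator {\<delta> n..1} r *\<^sub>R f r) \<le> indicator {0<..<1} r *\<^sub>R (\<alpha> * (cmod s / Re s * 2) * (K (r powr \<alpha> * Re s) / r))" for n
      using ae
    proof eventually_elim
      case (elim r)
      show ?case
      proof (cases "r \<in> {\<delta> n..1}")
        case True
        then have r: "0 < r" "r < 1" using elim \<delta>(1)[of n] by auto
        then show ?thesis using True fle[OF r(1)] by simp
      next
        case False
        have "0 \<le> indicator {0<..<1} r *\<^sub>R (\<alpha> * (cmod s / Re s * 2) * (K (r powr \<alpha> * Re s) / r))"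
        proof (cases "0 < r")
          case True
          show ?thesis by (rule scaleR_nonneg_nonneg[OF indicator_pos_le order_trans[OF norm_ge_zero fle[OF True]]])
        qed simp
        then show ?thesis using False by simp
      qed
    qed
  qed
  \<comment> \<open>Passing to the limit only after exponentiation makes the branch of
    \<open>\<Lambda>\<close> irrelevant: the denominator
    \<open>P (\<delta> n powr \<alpha> * s)\<close> tends to \<open>P 0 = 1\<close>.\<close>
  have "exp (- (CLBINT r. indicator {0<..<1} r *\<^sub>R f r)) = P s"
  proof (rule LIMSEQ_unique)
    show "(\<lambda>n. exp (- (CLBINT r. indicator {\<delta> n..1} r *\<^sub>R f r))) \<longlonglongrightarrow> exp (- (CLBINT r. indicator {0<..<1} r *\<^sub>R f r))"
      by (intro tendsto_intros lim)
    have "exp (- (CLBINT r. indicator {\<delta> n..1} r *\<^sub>R f r)) = P s / P (of_real (\<delta> n powr \<alpha>) * s)" for n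
    proof -
      have "- (F 1 - F (\<delta> n)) = \<Lambda> s - \<Lambda> (of_real (\<delta> n powr \<alpha>) * s)" by (simp add: F_def)
      then show ?thesis unfolding int using s \<delta>(1)[of n] by (simp add: exp_diff \<Lambda>(2))
    qed
    moreover have "(\<lambda>n. P s / P (of_real (\<delta> n powr \<alpha>) * s)) \<longlonglongrightarrow> P s / P (of_real 0 * s)"
    proof (intro tendsto_divide tendsto_const P_tendsto tendsto_mult tendsto_of_real)
      have "(\<lambda>n. \<delta> n powr \<alpha>) \<longlonglongrightarrow> 0 powr \<alpha>" using \<alpha> \<delta>(1) by (intro tendsto_intros \<delta>0) (auto simp: less_imp_le)
      then show "(\<lambda>n. \<delta> n powr \<alpha>) \<longlonglongrightarrow> 0" using \<alpha> by simp
    qed (use s P_0 in auto)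
    ultimately show "(\<lambda>n. exp (- (CLBINT r. indicator {\<delta> n..1} r *\<^sub>R f r))) \<longlonglongrightarrow> P s" by (simp add: P_0)
  qed
  moreover have "(CLBINT r. indicator {0<..<1} r *\<^sub>R f r) = of_real \<alpha> * (CLBINT r:{0<..<1}. J (of_real (r powr \<alpha>) * s) / of_real r)"
    unfolding f_def set_lebesgue_integral_def mult_scaleR_right[symmetric] by (rule integral_mult_right_zero)
  ultimately show ?thesis by simp
qed

text \<open>For these parameters \<open>|\<theta>| < pi / 2\<close>, so the exponent has positive
  real part at every \<open>t \<noteq> 0\<close> and the whole ray stays inside the half-plane. The
  exponents with weight \<open>\<alpha> / (1 - c)\<close> belong to unimodal laws, and as
  \<open>c\<close> tends to \<open>1\<close> they converge to the integral of
  \<open>J\<close>.\<close>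

lemma unimodal_subordination_nondegenerate:
  assumes \<alpha>: "0 < \<alpha>" "\<alpha> < 2" "\<alpha> \<noteq> 1" and l: "0 < l" and \<theta>: "\<bar>\<theta>\<bar> \<le> min (pi * \<alpha> / 2) (pi - pi * \<alpha> / 2)"
  shows "unimodal_char (\<lambda>t. P (stable_exponent \<alpha> \<theta> l t))"
proof -
  have is_lap: "is_laplace_transform (laplace_transform N)" if "nonneg_distribution N" for N
    using that unfolding is_laplace_transform_def nonneg_distribution_def nonneg_distribution_axioms_def by blast
  have "is_char (\<lambda>t. laplace_transform (Mc (seq1 n)) (stable_exponent \<alpha> \<theta> l t))" for n
    by (rule is_char_subordination[OF is_lap[OF Mc[OF seq1(2,3)]] \<alpha>(1) _ _ \<theta>]) (use \<alpha> l in auto)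
  then obtain \<mu> where \<mu>: "\<And>n. real_distribution (\<mu> n)"
    and c\<mu>: "\<And>n. (\<lambda>t. laplace_transform (Mc (seq1 n)) (stable_exponent \<alpha> \<theta> l t)) = char (\<mu> n)"
    unfolding is_char_def by metis
  have Re_pos: "0 < Re (stable_exponent \<alpha> \<theta> l t)" if "t \<noteq> 0" for t
  proof -
    have "min (pi * \<alpha> / 2) (pi - pi * \<alpha> / 2) < pi / 2" using \<alpha> by (auto simp: min_def)
    then have "\<bar>\<theta>\<bar> < pi / 2" using \<theta> by linarith
    moreover have "\<bar>\<theta> * sgn t\<bar> = \<bar>\<theta>\<bar>" using that by (simp add: abs_mult sgn_if)
    ultimately have "0 < cos (\<theta> * sgn t)" by (intro cos_gt_zero_pi) (simp_all add: abs_less_iff)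
    then show ?thesis using that l by (simp add: stable_exponent_def Re_exp)
  qed
  define G where "G n t r = (1 - char (\<mu> n) (r * t)) / of_real r" for n t and r :: real
  have G: "G n t r = (1 - laplace_transform (Mc (seq1 n)) (of_real (r powr \<alpha>) * stable_exponent \<alpha> \<theta> l t)) / of_real r"
    if "0 < r" for n t r
    using stable_exponent_scale[OF that, of \<alpha> \<theta> l t] by (simp add: G_def c\<mu>[symmetric])
  have G_meas [measurable]: "G n t \<in> borel_measurable borel" for n t
    unfolding G_def using real_distribution.char_measurable[OF \<mu>, of n] by measurable
  \<comment> \<open>Dividing by \<open>1 - seq1 n\<close> gives the quotients that converge to
    \<open>J\<close> on the ray under a majorant free of \<open>n\<close>. This factor is already
    contained in the weight \<open>\<alpha> / (1 - seq1 n)\<close>.\<close>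
  define q where "q n t r = of_real (1 / (1 - seq1 n)) * G n t r" for n t and r :: real
  have q_le: "cmod (q n t r) \<le> cmod s / Re s * 2 * (K (r powr \<alpha> * Re s) / r)"
    if r: "0 < r" and t: "t \<noteq> 0" and s: "s = stable_exponent \<alpha> \<theta> l t" for n t r s
  proof -
    have "q n t r = (1 - laplace_transform (Mc (seq1 n)) (of_real (r powr \<alpha>) * s)) / of_real (1 - seq1 n) / of_real r"
      by (simp add: q_def G[OF r] s)
    also have "cmod \<dots> \<le> cmod s / Re s * 2 * (K (r powr \<alpha> * Re s) / r)"
      by (rule bound_on_ray[OF _ r quotient_le]) (use Re_pos[OF t] r s in simp_all)
    finally show ?thesis .
  qed
  have dom: "integrable lborel (\<lambda>r. indicator {0<..<1} r *\<^sub>R (cmod s / Re s * 2 * (K (r powr \<alpha> * Re s) / r)))"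
    if "0 < Re s" for s
    using set_integrable_mult_right[OF K_integrable[OF \<alpha>(1) that], of "cmod s / Re s * 2"]
    unfolding set_integrable_def[symmetric] by blast
  have q_ind: "norm (indicator {0<..<1} r *\<^sub>R q n t r) \<le> indicator {0<..<1} r *\<^sub>R (cmod s / Re s * 2 * (K (r powr \<alpha> * Re s) / r))"
    if t: "t \<noteq> 0" and s: "s = stable_exponent \<alpha> \<theta> l t" for n t r s
    using q_le[OF _ t s, of r n] by (cases "r \<in> {0<..<1}") auto
  have q_int: "integrable lborel (\<lambda>r. indicator {0<..<1} r *\<^sub>R q n t r)" if t: "t \<noteq> 0" for n t
  proof (rule Bochner_Integration.integrable_bound[OF dom[OF Re_pos[OF t]]])
    show "(\<lambda>r. indicator {0<..<1} r *\<^sub>R q n t r) \<in> borel_measurable lborel" unfolding q_def by measurable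
    show "AE r in lborel. norm (indicator {0<..<1} r *\<^sub>R q n t r) \<le> norm (indicator {0<..<1} r *\<^sub>R (cmod (stable_exponent \<alpha> \<theta> l t) / Re (stable_exponent \<alpha> \<theta> l t) * 2 * (K (r powr \<alpha> * Re (stable_exponent \<alpha> \<theta> l t)) / r)))"
      by (rule AE_I2, rule order_trans[OF q_ind[OF t refl]], simp only: real_norm_def abs_ge_self)
  qed
  have G_q: "G n t r = of_real (1 - seq1 n) * q n t r" for n t r
    using seq1(3)[of n] by (simp add: q_def flip: of_real_mult)
  have G_int: "set_integrable lborel {0<..<1} (G n 1)" for n
    using integrable_mult_right[OF q_int[of 1 n], of "of_real (1 - seq1 n)"] unfolding set_integrable_def G_q by simp
  have w: "0 \<le> \<alpha> / (1 - seq1 n)" for n using \<alpha> seq1(3)[of n] by simp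
  have uni: "unimodal_char (\<lambda>t. exp (- of_real (\<alpha> / (1 - seq1 n)) * (CLBINT r:{0<..<1}. G n t r)))" for n
    using unimodal_char_self_decomposable_exponent[OF \<mu>[of n] _ w[of n]] G_int[of n]
    unfolding G_def by simp
  have "is_char (\<lambda>t. P (stable_exponent \<alpha> \<theta> l t))"
    by (rule is_char_subordination[OF is_lap \<alpha>(1) _ _ \<theta>]) (use \<alpha> l nonneg_distribution_axioms in auto)
  then have cont: "isCont (\<lambda>t. P (stable_exponent \<alpha> \<theta> l t)) 0"
    unfolding is_char_def using real_distribution.isCont_char by auto
  have lim: "(\<lambda>n. exp (- of_real (\<alpha> / (1 - seq1 n)) * (CLBINT r:{0<..<1}. G n t r))) \<longlonglongrightarrow> P (stable_exponent \<alpha> \<theta> l t)" for t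
  proof (cases "t = 0")
    case True
    have "char (\<mu> n) 0 = 1" for n by (rule real_distribution.char_zero[OF \<mu>])
    then show ?thesis using True by (simp add: G_def P_0 stable_exponent_def)
  next
    case t: False
    define s where "s = stable_exponent \<alpha> \<theta> l t"
    have s: "0 < Re s" unfolding s_def by (rule Re_pos[OF t])
    have eq: "- of_real (\<alpha> / (1 - seq1 n)) * (CLBINT r:{0<..<1}. G n t r) = - (of_real \<alpha> * (CLBINT r:{0<..<1}. q n t r))" for n
      unfolding q_def by (simp add: divide_inverse)
    have "(\<lambda>n. CLBINT r:{0<..<1}. q n t r) \<longlonglongrightarrow> (CLBINT r:{0<..<1}. J (of_real (r powr \<alpha>) * s) / of_real r)"
      unfolding set_lebesgue_integral_def
    proof (rule integral_dominated_convergence[OF _ _ dom[OF s]])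
      show "(\<lambda>r. indicator {0<..<1} r *\<^sub>R (J (of_real (r powr \<alpha>) * s) / of_real r)) \<in> borel_measurable lborel"
        using J_set_measurable[OF s, of \<alpha>] by simp
      show "(\<lambda>r. indicator {0<..<1} r *\<^sub>R q n t r) \<in> borel_measurable lborel" for n unfolding q_def by measurable
      show "AE r in lborel. norm (indicator {0<..<1} r *\<^sub>R q n t r) \<le> indicator {0<..<1} r *\<^sub>R (cmod s / Re s * 2 * (K (r powr \<alpha> * Re s) / r))" for n
        by (intro AE_I2 q_ind[OF t s_def])
      show "AE r in lborel. (\<lambda>n. indicator {0<..<1} r *\<^sub>R q n t r) \<longlonglongrightarrow> indicator {0<..<1} r *\<^sub>R (J (of_real (r powr \<alpha>) * s) / of_real r)"
      proof (rule AE_I2)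
        fix r :: real
        show "(\<lambda>n. indicator {0<..<1} r *\<^sub>R q n t r) \<longlonglongrightarrow> indicator {0<..<1} r *\<^sub>R (J (of_real (r powr \<alpha>) * s) / of_real r)"
        proof (cases "r \<in> {0<..<1}")
          case True
          then have r: "0 < r" by simp
          have z: "0 < Re (of_real (r powr \<alpha>) * s)" using s r by simp
          have "(\<lambda>n. (1 - laplace_transform (Mc (seq1 n)) (of_real (r powr \<alpha>) * s)) / of_real (1 - seq1 n) / of_real r) \<longlonglongrightarrow> J (of_real (r powr \<alpha>) * s) / of_real r"
            by (intro tendsto_divide J_tendsto z tendsto_const) (use r in auto)
          moreover have "q n t r = (1 - laplace_transform (Mc (seq1 n)) (of_real (r powr \<alpha>) * s)) / of_real (1 - seq1 n) / of_real r" for n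
            by (simp add: q_def G[OF r] s_def)
          ultimately show ?thesis by (intro tendsto_scaleR tendsto_const) simp
        qed simp
      qed
    qed
    then have "(\<lambda>n. exp (- (of_real \<alpha> * (CLBINT r:{0<..<1}. q n t r)))) \<longlonglongrightarrow> exp (- (of_real \<alpha> * (CLBINT r:{0<..<1}. J (of_real (r powr \<alpha>) * s) / of_real r)))"
      by (intro tendsto_intros)
    then show ?thesis unfolding eq exp_J_integral[OF \<alpha>(1) s] unfolding s_def .
  qed
  from uni lim cont show ?thesis by (rule unimodal_char_limit)
qed

lemma unimodal_subordination:
  assumes \<alpha>: "0 < \<alpha>" "\<alpha> \<le> 2" and l: "0 < l" and \<theta>: "\<bar>\<theta>\<bar> \<le> min (pi * \<alpha> / 2) (pi - pi * \<alpha> / 2)"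
  shows "unimodal_char (\<lambda>t. P (stable_exponent \<alpha> \<theta> l t))"
proof -
  obtain a th where a: "a \<longlonglongrightarrow> \<alpha>" "th \<longlonglongrightarrow> \<theta>"
    and p: "\<And>n. 0 < a n" "\<And>n. a n < 2" "\<And>n. a n \<noteq> 1" "\<And>n. \<bar>th n\<bar> \<le> min (pi * a n / 2) (pi - pi * a n / 2)"
    using stable_parameter_approximation[OF \<alpha> \<theta>] by blast
  show ?thesis
  proof (rule unimodal_char_limit)
    show "unimodal_char (\<lambda>t. P (stable_exponent (a n) (th n) l t))" for n
      by (rule unimodal_subordination_nondegenerate[OF p(1-3) l p(4)])
    show "(\<lambda>n. P (stable_exponent (a n) (th n) l t)) \<longlonglongrightarrow> P (stable_exponent \<alpha> \<theta> l t)" for t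
      by (rule P_tendsto[OF stable_exponent_tendsto[OF a]], rule Re_stable_exponent[OF _ p(4)]) (use l in simp)
    have "is_laplace_transform P"
      unfolding is_laplace_transform_def using real_distribution_axioms nonneg by blast
    then have "is_char (\<lambda>t. P (stable_exponent \<alpha> \<theta> l t))"
      by (rule is_char_subordination[OF _ \<alpha> _ \<theta>]) (use l in simp)
    then show "isCont (\<lambda>t. P (stable_exponent \<alpha> \<theta> l t)) 0"
      unfolding is_char_def using real_distribution.isCont_char by auto
  qed
qed

end

section \<open>Absolute continuity\<close>

text \<open>An open set is the countable disjoint union of its components. These are open intervals,
  and on each the Lipschitz bound compares mass with length.\<close>

lemma (in real_distribution) emeasure_open_le:
  assumes U: "open U" "U \<subseteq> {a<..<b}" and K: "0 \<le> K"
    and lip: "\<And>c d. a \<le> c \<Longrightarrow> c < d \<Longrightarrow> d \<le> b \<Longrightarrow> cdf M d - cdf M c \<le> K * (d - c)"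
  shows "emeasure M U \<le> ennreal K * emeasure lborel U"
proof -
  have oC: "open C" if "C \<in> components U" for C using U(1) that by (rule open_components)
  have cnt: "countable (components U)"
    using pairwise_disjoint_components[of U] oC
    by (intro countable_disjoint_open_subsets) (auto simp: pairwise_def disjnt_def)
  have disj: "disjoint_family_on (\<lambda>C. C) (components U)"
    using pairwise_disjoint_components[of U] by (auto simp: disjoint_family_on_def pairwise_def)
  have le: "emeasure M C \<le> ennreal K * emeasure lborel C" if C: "C \<in> components U" for C
  proof -
    have sub: "C \<subseteq> {a<..<b}" using in_components_subset[OF C] U(2) by blast
    have ne: "C \<noteq> {}" using C by (rule in_components_nonempty)
    define c d where "c = Inf C" and "d = Sup C"
    have "bdd_below {a<..<b}" "bdd_above {a<..<b}" by auto
    then have bdd: "bdd_below C" "bdd_above C" using sub by (auto intro: bdd_below_mono bdd_above_mono)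
    have ac: "a \<le> c" unfolding c_def using ne sub by (intro cInf_greatest) auto
    have db: "d \<le> b" unfolding d_def using ne sub by (intro cSup_least) auto
    obtain x where x: "x \<in> C" using ne by blast
    have "c \<notin> C"
    proof
      assume "c \<in> C"
      then obtain e where e: "0 < e" "ball c e \<subseteq> C" using oC[OF C] by (meson open_contains_ball)
      then have "c - e / 2 \<in> C" by (auto simp: dist_real_def)
      then have "c \<le> c - e / 2" unfolding c_def using bdd by (intro cInf_lower)
      then show False using e by simp
    qed
    moreover have "d \<notin> C"
    proof
      assume "d \<in> C"
      then obtain e where e: "0 < e" "ball d e \<subseteq> C" using oC[OF C] by (meson open_contains_ball)
      then have "d + e / 2 \<in> C" by (auto simp: dist_real_def)
      then have "d + e / 2 \<le> d" unfolding d_def using bdd by (intro cSup_upper)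
      then show False using e by simp
    qed
    moreover have "c \<le> y" "y \<le> d" if "y \<in> C" for y
      unfolding c_def d_def using that bdd by (auto intro: cInf_lower cSup_upper)
    ultimately have Csub: "C \<subseteq> {c<..<d}" by (force simp: less_le)
    then have cd: "c < d" using x by auto
    have "{c<..<d} \<subseteq> C"
    proof
      fix y assume y: "y \<in> {c<..<d}"
      obtain u where u: "u \<in> C" "u < y" using y cInf_less_iff[OF ne bdd(1), of y] by (auto simp: c_def)
      obtain v where v: "v \<in> C" "y < v" using y less_cSup_iff[OF ne bdd(2), of y] by (auto simp: d_def)
      show "y \<in> C" using in_components_connected[OF C] u v by (meson connected_iff_interval less_imp_le)
    qed
    with Csub have Ceq: "C = {c<..<d}" by blast
    have "measure M C \<le> measure M {c<..d}" unfolding Ceq by (rule finite_measure_mono) auto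
    also have "\<dots> = cdf M d - cdf M c" using cd by (simp add: cdf_diff_eq)
    also have "\<dots> \<le> K * (d - c)" using ac cd db by (rule lip)
    finally have "ennreal (measure M C) \<le> ennreal (K * (d - c))" by (rule ennreal_leI)
    then show ?thesis using cd K by (simp add: Ceq emeasure_eq_measure ennreal_mult)
  qed
  have "emeasure M U = emeasure M (\<Union>C\<in>components U. C)" by simp
  also have "\<dots> = (\<integral>\<^sup>+C. emeasure M C \<partial>count_space (components U))"
    using oC cnt disj by (intro emeasure_UN_countable) auto
  also have "\<dots> \<le> (\<integral>\<^sup>+C. ennreal K * emeasure lborel C \<partial>count_space (components U))"
    by (rule nn_integral_mono) (simp add: le)
  also have "\<dots> = ennreal K * (\<integral>\<^sup>+C. emeasure lborel C \<partial>count_space (components U))"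
    by (rule nn_integral_cmult) simp
  also have "(\<integral>\<^sup>+C. emeasure lborel C \<partial>count_space (components U)) = emeasure lborel (\<Union>C\<in>components U. C)"
    using oC cnt disj by (intro emeasure_UN_countable[symmetric]) auto
  finally show ?thesis by simp
qed

lemma (in real_distribution) null_set_of_lipschitz:
  assumes A: "A \<in> null_sets lborel" "A \<subseteq> {a<..<b}" and K: "0 \<le> K"
    and lip: "\<And>c d. a \<le> c \<Longrightarrow> c < d \<Longrightarrow> d \<le> b \<Longrightarrow> cdf M d - cdf M c \<le> K * (d - c)"
  shows "A \<in> null_sets M"
proof -
  have AB: "A \<in> sets borel" and A0: "emeasure lborel A = 0" using A(1) by auto
  have "emeasure M A \<le> 0"
  proof (rule ennreal_le_epsilon)
    fix e :: real assume e: "0 < e"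
    \<comment> \<open>The \<open>+ 1\<close> covers \<open>K = 0\<close>.\<close>
    have e': "0 < e / (K + 1)" using e K by simp
    obtain U where U: "open U" "A \<subseteq> U" "emeasure lborel (U - A) < ennreal (e / (K + 1))"
      using outer_regular_lborel[OF AB e'] .
    define V where "V = U \<inter> {a<..<b}"
    have V: "open V" "V \<subseteq> {a<..<b}" "A \<subseteq> V" using U A(2) by (auto simp: V_def)
    have Uset: "U \<in> sets lborel" using U(1) by simp
    have "emeasure lborel V \<le> emeasure lborel U" unfolding V_def by (rule emeasure_mono[OF _ Uset]) simp
    also have "\<dots> = emeasure lborel (U - A)"
      using emeasure_Diff_null_set[OF A(1) Uset] by simp
    also have "\<dots> \<le> ennreal (e / (K + 1))" using U(3) by simp
    finally have V_le: "emeasure lborel V \<le> ennreal (e / (K + 1))" .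
    have "emeasure M A \<le> emeasure M V" by (rule emeasure_mono) (use V in auto)
    also have "\<dots> \<le> ennreal K * emeasure lborel V" by (rule emeasure_open_le[OF V(1,2) K lip])
    also have "\<dots> \<le> ennreal K * ennreal (e / (K + 1))" by (rule mult_left_mono[OF V_le]) simp
    also have "\<dots> = ennreal (K * (e / (K + 1)))" using K e' by (intro ennreal_mult[symmetric]) auto
    also have "\<dots> \<le> ennreal e" using K e by (intro ennreal_leI) (simp add: field_simps)
    finally show "emeasure M A \<le> 0 + ennreal e" by simp
  qed
  then show ?thesis using AB by (auto simp: null_sets_def)
qed

text \<open>By convexity, every slope to the left of \<open>m - h n\<close> is at most the secant
  slope over the next half step \<open>h n / 2\<close>, so the distribution function is Lipschitz
  away from the mode; similarly on the right. Letting \<open>h n\<close> tend to \<open>0\<close>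
  exhausts the complement of \<open>m\<close>.\<close>

lemma (in real_distribution) null_set_off_mode:
  assumes convex: "convex_on {..<m} (cdf M)" and concave: "concave_on {m<..} (cdf M)"
    and A: "A \<in> null_sets lborel"
  shows "A - {m} \<in> null_sets M"
proof -
  define h where "h n = 1 / real (Suc n)" for n
  have h: "0 < h n" for n by (simp add: h_def)
  have AB: "A \<in> sets borel" using A by auto
  have left: "A \<inter> {m - real n<..<m - h n} \<in> null_sets M" for n
  proof (rule null_set_of_lipschitz[OF _ Int_lower2])
    define K where "K = (cdf M (m - h n / 2) - cdf M (m - h n)) / (h n / 2)"
    show "A \<inter> {m - real n<..<m - h n} \<in> null_sets lborel" using A by (rule null_set_Int2) simp
    show "0 \<le> K" unfolding K_def using h[of n] by (intro divide_nonneg_nonneg) (auto intro: cdf_nondecreasing)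
    fix c d assume cd: "c < d" "d \<le> m - h n"
    have cd1: "(cdf M d - cdf M c) * (m - h n / 2 - d) \<le> (cdf M (m - h n / 2) - cdf M d) * (d - c)"
      using cd h[of n] by (intro slopes_of_convex_on[OF convex]) auto
    have "(cdf M (m - h n / 2) - cdf M d) * (h n / 2) \<le> (cdf M (m - h n / 2) - cdf M (m - h n)) * (m - h n / 2 - d)"
    proof (cases "d = m - h n")
      case False
      then have "(cdf M (m - h n) - cdf M d) * (m - h n / 2 - (m - h n)) \<le> (cdf M (m - h n / 2) - cdf M (m - h n)) * (m - h n - d)"
        using cd h[of n] by (intro slopes_of_convex_on[OF convex]) auto
      then show ?thesis by (simp add: algebra_simps)
    qed simp
    then have "cdf M (m - h n / 2) - cdf M d \<le> K * (m - h n / 2 - d)" using h[of n] by (simp add: K_def field_simps)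
    then have "(cdf M (m - h n / 2) - cdf M d) * (d - c) \<le> K * (m - h n / 2 - d) * (d - c)" using cd by (intro mult_right_mono) auto
    with cd1 have "(cdf M d - cdf M c) * (m - h n / 2 - d) \<le> K * (d - c) * (m - h n / 2 - d)" by (simp add: mult_ac)
    moreover have "0 < m - h n / 2 - d" using cd h[of n] by simp
    ultimately show "cdf M d - cdf M c \<le> K * (d - c)" by (simp only: mult_le_cancel_right_pos)
  qed
  have convex': "convex_on {m<..} (\<lambda>x. - cdf M x)" using concave by (simp add: concave_on_def)
  have right: "A \<inter> {m + h n<..<m + real n} \<in> null_sets M" for n
  proof (rule null_set_of_lipschitz[OF _ Int_lower2])
    define K where "K = (cdf M (m + h n) - cdf M (m + h n / 2)) / (h n / 2)"
    show "A \<inter> {m + h n<..<m + real n} \<in> null_sets lborel" using A by (rule null_set_Int2) simp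
    show "0 \<le> K" unfolding K_def using h[of n] by (intro divide_nonneg_nonneg) (auto intro: cdf_nondecreasing)
    fix c d assume cd: "m + h n \<le> c" "c < d"
    have cd1: "(- cdf M c - - cdf M (m + h n / 2)) * (d - c) \<le> (- cdf M d - - cdf M c) * (c - (m + h n / 2))"
      using cd h[of n] by (intro slopes_of_convex_on[OF convex']) auto
    have "(cdf M c - cdf M (m + h n / 2)) * (h n / 2) \<le> (cdf M (m + h n) - cdf M (m + h n / 2)) * (c - (m + h n / 2))"
    proof (cases "c = m + h n")
      case False
      then have "(- cdf M (m + h n) - - cdf M (m + h n / 2)) * (c - (m + h n)) \<le> (- cdf M c - - cdf M (m + h n)) * (m + h n - (m + h n / 2))"
        using cd h[of n] by (intro slopes_of_convex_on[OF convex']) auto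
      then show ?thesis by (simp add: algebra_simps)
    qed simp
    then have "cdf M c - cdf M (m + h n / 2) \<le> K * (c - (m + h n / 2))" using h[of n] by (simp add: K_def field_simps)
    then have "(cdf M c - cdf M (m + h n / 2)) * (d - c) \<le> K * (c - (m + h n / 2)) * (d - c)" using cd by (intro mult_right_mono) auto
    moreover have "(cdf M d - cdf M c) * (c - (m + h n / 2)) \<le> (cdf M c - cdf M (m + h n / 2)) * (d - c)"
      using cd1 by (simp add: algebra_simps)
    ultimately have "(cdf M d - cdf M c) * (c - (m + h n / 2)) \<le> K * (d - c) * (c - (m + h n / 2))" by (simp add: mult_ac)
    moreover have "0 < c - (m + h n / 2)" using cd h[of n] by simp
    ultimately show "cdf M d - cdf M c \<le> K * (d - c)" by (simp only: mult_le_cancel_right_pos)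
  qed
  have "A - {m} \<subseteq> (\<Union>n. A \<inter> {m - real n<..<m - h n}) \<union> (\<Union>n. A \<inter> {m + h n<..<m + real n})"
  proof
    fix x assume x: "x \<in> A - {m}"
    then have "0 < \<bar>x - m\<bar>" by simp
    then obtain n1 where n1: "h n1 < \<bar>x - m\<bar>"
      using reals_Archimedean unfolding h_def inverse_eq_divide by blast
    obtain n2 where n2: "\<bar>x - m\<bar> < real n2" using reals_Archimedean2 by blast
    define n where "n = max n1 n2"
    have "h n \<le> h n1" unfolding h_def n_def by (intro divide_left_mono) auto
    then have "h n < \<bar>x - m\<bar>" "\<bar>x - m\<bar> < real n" using n1 n2 by (auto simp: n_def)
    then have "x \<in> {m - real n<..<m - h n} \<or> x \<in> {m + h n<..<m + real n}" using h[of n] by (auto simp: abs_if split: if_splits)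
    then show "x \<in> (\<Union>n. A \<inter> {m - real n<..<m - h n}) \<union> (\<Union>n. A \<inter> {m + h n<..<m + real n})"
      using x by blast
  qed
  moreover have "(\<Union>n. A \<inter> {m - real n<..<m - h n}) \<union> (\<Union>n. A \<inter> {m + h n<..<m + real n}) \<in> null_sets M"
    using left right by (intro null_sets.Un null_sets_UN') auto
  ultimately show ?thesis using AB by (auto intro: null_sets_subset)
qed

section \<open>Excluding an atom at the mode\<close>

lemma char_return_borel: "char (return borel m) t = iexp (t * m)"
  unfolding char_def by (subst integral_return) auto

lemma degenerate_return_borel: "degenerate (return borel m)"
  unfolding degenerate_def by (intro exI[of _ m]) (simp add: AE_return)

text \<open>If \<open>c * X + Y\<close> has the law of \<open>X\<close>, its atom at \<open>m\<close> can only come from \<open>X = m\<close>, so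
  \<open>Y = (1 - c) * m\<close> almost surely; then let \<open>c\<close> tend to \<open>0\<close>.\<close>

lemma degenerate_if_atom_at_mode:
  assumes M: "real_distribution M"
    and off: "\<And>x. x \<noteq> m \<Longrightarrow> measure M {x} = 0" and atom: "measure M {m} \<noteq> 0"
    and L: "class_L_char (char M)"
  shows "degenerate M"
proof -
  interpret M: real_distribution M by fact
  have eq: "char M t = char M (c * t) * iexp (t * ((1 - c) * m))" if c: "0 < c" "c < 1" for c t
  proof -
    obtain N where N: "real_distribution N" and eqN: "\<And>t. char M t = char M (c * t) * char N t"
      using L c unfolding class_L_char_def is_char_def by metis
    interpret N: real_distribution N by fact
    interpret P: pair_prob_space M N ..
    have meas: "(\<lambda>(x, y). c * x + y) \<in> borel_measurable (borel \<Otimes>\<^sub>M borel)" by measurable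
    then have [measurable]: "(\<lambda>(x, y). c * x + y) \<in> borel_measurable (M \<Otimes>\<^sub>M N)"
      by (simp cong: measurable_cong_sets)
    note D = char_distr_pair(1)[OF M N meas] and cD = char_distr_pair(2)[OF M N meas]
    have "M = distr (M \<Otimes>\<^sub>M N) borel (\<lambda>(x, y). c * x + y)"
    proof (rule Levy_uniqueness[OF M D], rule ext)
      fix t
      have "(CLINT x|M. CLINT y|N. iexp (t * (c * x + y))) = (CLINT x|M. CLINT y|N. iexp (c * t * x) * iexp (t * y))"
        by (simp add: exp_add[symmetric] algebra_simps)
      also have "\<dots> = char M (c * t) * char N t" unfolding char_def by simp
      finally show "char M t = char (distr (M \<Otimes>\<^sub>M N) borel (\<lambda>(x, y). c * x + y)) t" unfolding cD eqN[of t] ..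
    qed
    moreover have "emeasure (distr (M \<Otimes>\<^sub>M N) borel (\<lambda>(x, y). c * x + y)) {m} = emeasure M {m} * emeasure N {(1 - c) * m}"
    proof -
      define A where "A = (\<lambda>(x, y). c * x + y) -` {m} \<inter> space (M \<Otimes>\<^sub>M N)"
      have A: "A \<in> sets (M \<Otimes>\<^sub>M N)" unfolding A_def by measurable
      \<comment> \<open>The slice at \<open>y\<close> is the single point
        \<open>(m - y) / c\<close>, which has mass only if it equals \<open>m\<close>.\<close>
      have slice: "emeasure M ((\<lambda>x. (x, y)) -` A) = emeasure M {m} * indicator {(1 - c) * m} y" for y
      proof -
        have "(\<lambda>x. (x, y)) -` A = {(m - y) / c}"
          using c by (auto simp: A_def space_pair_measure field_simps)
        moreover have "(m - y) / c = m \<longleftrightarrow> y = (1 - c) * m" using c by (auto simp: field_simps)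
        ultimately show ?thesis using off[of "(m - y) / c"]
          by (auto simp: M.emeasure_eq_measure split: split_indicator)
      qed
      have "emeasure (distr (M \<Otimes>\<^sub>M N) borel (\<lambda>(x, y). c * x + y)) {m} = emeasure (M \<Otimes>\<^sub>M N) A"
        unfolding A_def by (rule emeasure_distr) auto
      also have "\<dots> = (\<integral>\<^sup>+y. emeasure M {m} * indicator {(1 - c) * m} y \<partial>N)"
        unfolding P.emeasure_pair_measure_alt2[OF A] slice ..
      also have "\<dots> = emeasure M {m} * emeasure N {(1 - c) * m}"
        by (rule nn_integral_cmult_indicator) auto
      finally show ?thesis .
    qed
    ultimately have "emeasure M {m} = emeasure M {m} * emeasure N {(1 - c) * m}" by metis
    then have "measure M {m} = measure M {m} * measure N {(1 - c) * m}"
      unfolding M.emeasure_eq_measure N.emeasure_eq_measure by (simp flip: ennreal_mult)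
    then have "N.prob {(1 - c) * m} = 1" using atom by simp
    then have "AE y in N. y = (1 - c) * m" by (simp add: N.prob_eq_1)
    then have "char N t = (CLINT y|N. iexp (t * ((1 - c) * m)))"
      unfolding char_def by (intro integral_cong_AE) (auto elim!: eventually_mono)
    also have "\<dots> = iexp (t * ((1 - c) * m))" using N.prob_space by (simp del: N.space_eq_univ)
    finally show ?thesis using eqN[of t] by simp
  qed
  have "char M t = iexp (t * m)" for t
  proof -
    define c where "c n = 1 / real (n + 2)" for n
    have c: "0 < c n" "c n < 1" for n by (auto simp: c_def)
    have c0: "c \<longlonglongrightarrow> 0" using LIMSEQ_ignore_initial_segment[OF lim_1_over_n, of 2] unfolding c_def .
    have "(\<lambda>n. char M (c n * t)) \<longlonglongrightarrow> char M 0"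
      by (rule isCont_tendsto_compose[OF M.isCont_char]) (use tendsto_mult[OF c0 tendsto_const[of t]] in simp)
    moreover have "(\<lambda>n. iexp (t * ((1 - c n) * m))) \<longlonglongrightarrow> iexp (t * ((1 - 0) * m))"
      by (intro tendsto_intros c0)
    ultimately have "(\<lambda>n. char M (c n * t) * iexp (t * ((1 - c n) * m))) \<longlonglongrightarrow> char M 0 * iexp (t * ((1 - 0) * m))"
      by (rule tendsto_mult)
    then have "(\<lambda>n. char M t) \<longlonglongrightarrow> iexp (t * m)" unfolding eq[OF c, symmetric] M.char_zero by simp
    then show ?thesis by (rule LIMSEQ_unique[OF tendsto_const])
  qed
  then have "char M = char (return borel m)" by (auto simp: char_return_borel)
  moreover have "real_distribution (return borel m)"
    unfolding real_distribution_def real_distribution_axioms_def by (auto intro: prob_space_return)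
  ultimately have "M = return borel m" using M by (intro Levy_uniqueness)
  then show ?thesis by (simp add: degenerate_return_borel)
qed

theorem absolutely_continuous_unimodal_class_L:
  assumes M: "real_distribution M" and uni: "unimodal M" and L: "class_L_char (char M)" and nondeg: "\<not> degenerate M"
  shows "absolutely_continuous lborel M"
proof -
  interpret real_distribution M by fact
  obtain m where m: "convex_on {..<m} (cdf M)" "concave_on {m<..} (cdf M)"
    using uni unfolding unimodal_def by blast
  have off: "measure M {x} = 0" if "x \<noteq> m" for x
  proof -
    have "{x} \<in> null_sets lborel" by (auto simp: null_sets_def)
    from null_set_off_mode[OF m this] have "{x} \<in> null_sets M" using that by simp
    then show ?thesis by (simp add: null_sets_def measure_def)
  qed
  have "measure M {m} = 0" using degenerate_if_atom_at_mode[OF M off _ L] nondeg by blast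
  then have m0: "{m} \<in> null_sets M" by (simp add: null_sets_def emeasure_eq_measure)
  show ?thesis unfolding absolutely_continuous_def
  proof
    fix A :: "real set" assume A: "A \<in> null_sets lborel"
    have "A \<subseteq> (A - {m}) \<union> {m}" by blast
    moreover have "(A - {m}) \<union> {m} \<in> null_sets M" using null_set_off_mode[OF m A] m0 by (rule null_sets.Un)
    moreover have "A \<in> sets M" using A by auto
    ultimately show "A \<in> null_sets M" by (auto intro: null_sets_subset)
  qed
qed

theorem mainTheorem11:
  fixes \<phi> :: "complex \<Rightarrow> complex" and f :: "real \<Rightarrow> complex"
  assumes "is_laplace_transform \<phi>"
    and "phi_ID \<phi> f"
    and "phi_strictly_stable \<phi> f"
    and "class_L_laplace \<phi>"
  shows "class_L_char f \<and>
    (\<forall>M. real_distribution M \<and> char M = f \<longrightarrow>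
       unimodal M \<and> (\<not> degenerate M \<longrightarrow> absolutely_continuous lborel M))"
proof -
  obtain M where M: "nonneg_distribution M" and \<phi>M: "\<And>s. 0 \<le> Re s \<Longrightarrow> \<phi> s = laplace_transform M s"
    by (rule is_laplace_transformE[OF assms(1)]) blast
  have "\<exists>N. nonneg_distribution N \<and> (\<forall>x>0. laplace_transform M (complex_of_real x) =
      laplace_transform M (complex_of_real (c * x)) * laplace_transform N (complex_of_real x))"
    if c: "0 < c" "c < 1" for c
  proof -
    obtain \<phi>c where \<phi>c: "is_laplace_transform \<phi>c"
      and eq: "\<And>x. 0 < x \<Longrightarrow> \<phi> (complex_of_real x) = \<phi> (complex_of_real (c * x)) * \<phi>c (complex_of_real x)"
      using assms(4) c unfolding class_L_laplace_def by blast
    obtain N where N: "nonneg_distribution N" and \<phi>N: "\<And>s. 0 \<le> Re s \<Longrightarrow> \<phi>c s = laplace_transform N s"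
      by (rule is_laplace_transformE[OF \<phi>c]) blast
    show ?thesis
    proof (intro exI conjI allI impI)
      fix x :: real assume x: "0 < x"
      then show "laplace_transform M (complex_of_real x) =
          laplace_transform M (complex_of_real (c * x)) * laplace_transform N (complex_of_real x)"
        using eq[OF x] \<phi>M[of "of_real x"] \<phi>M[of "of_real (c * x)"] \<phi>N[of "of_real x"] c by simp
    qed (rule N)
  qed
  then obtain Mc where Mc: "\<And>c. 0 < c \<Longrightarrow> c < 1 \<Longrightarrow> nonneg_distribution (Mc c)"
    "\<And>c x. 0 < c \<Longrightarrow> c < 1 \<Longrightarrow> 0 < x \<Longrightarrow> laplace_transform M (complex_of_real x) =
      laplace_transform M (complex_of_real (c * x)) * laplace_transform (Mc c) (complex_of_real x)"
    by metis
  interpret class_L_distribution M Mc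
    using M Mc by (auto simp: class_L_distribution_def class_L_distribution_axioms_def)
  obtain l \<alpha> \<theta> where l: "0 < l" and \<alpha>: "0 < \<alpha>" "\<alpha> \<le> 2" and \<theta>: "\<bar>\<theta>\<bar> \<le> min (pi * \<alpha> / 2) (pi - pi * \<alpha> / 2)"
    and f\<phi>: "\<And>t. f t = \<phi> (stable_exponent \<alpha> \<theta> l t)"
    using assms(3) unfolding phi_strictly_stable_def strictly_stable_exponent_def stable_exponent_def by auto
  have Re: "0 \<le> Re (stable_exponent \<alpha> \<theta> l t)" for t using l by (intro Re_stable_exponent \<theta>) simp
  have f: "f t = P (stable_exponent \<alpha> \<theta> l t)" for t unfolding f\<phi> by (rule \<phi>M[OF Re])
  have class_L: "class_L_char f"
    unfolding class_L_char_def
  proof (intro conjI allI impI)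
    show "is_char f" using assms(2) by (simp add: phi_ID_def)
    fix c :: real assume c: "0 < c \<and> c < 1"
    have c': "0 < c powr \<alpha>" "c powr \<alpha> < 1"
      using c \<alpha> powr_less_mono2[of \<alpha> c 1] by auto
    have "is_laplace_transform (laplace_transform (Mc (c powr \<alpha>)))"
      using Mc(1)[OF c'] unfolding is_laplace_transform_def nonneg_distribution_def nonneg_distribution_axioms_def by blast
    then have "is_char (\<lambda>t. laplace_transform (Mc (c powr \<alpha>)) (stable_exponent \<alpha> \<theta> l t))"
      by (rule is_char_subordination[OF _ \<alpha> _ \<theta>]) (use l in simp)
    moreover have "f t = f (c * t) * laplace_transform (Mc (c powr \<alpha>)) (stable_exponent \<alpha> \<theta> l t)" for t
      using c factor[OF c' Re, of t] by (simp add: f stable_exponent_scale)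
    ultimately show "\<exists>fc. is_char fc \<and> (\<forall>t. f t = f (c * t) * fc t)" by blast
  qed
  have "unimodal_char f"
    using unimodal_subordination[OF \<alpha> l \<theta>] by (simp add: f[abs_def])
  then obtain N where N: "real_distribution N" "unimodal N" "char N = f"
    unfolding unimodal_char_def by blast
  have "unimodal M' \<and> (\<not> degenerate M' \<longrightarrow> absolutely_continuous lborel M')"
    if M': "real_distribution M'" "char M' = f" for M'
  proof -
    \<comment> \<open>By uniqueness of the law, unimodality of one representative holds for every
      law with characteristic function \<open>f\<close>.\<close>
    have "M' = N" using M' N by (intro Levy_uniqueness) auto
    then show ?thesis
      using absolutely_continuous_unimodal_class_L[of N] N class_L by auto
  qed
  with class_L show ?thesis by blast
qed

end
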